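(* Let $(\mathcal{M},g)$ be a smooth connected Riemannian manifold that is complete as a metric space, let $\lambda$ be a positive real number, and let $\mu$ be a Borel probability measure on $\mathcal{M}$ of the form $d\mu\propto e^{-\phi-\Psi}\,d\,vol_g$ with $\phi,\Psi$ real-valued functions on $\mathcal{M}$. Then $\mu$ has a Poincaré inequality with constant $\lambda$ if and only if the functional $D^\mu$ is $2\lambda$-geodesically convex in the space of functions $f\in L^2(\mathcal{M},\mu)$ satisfying $\int_{\mathcal{M}} f\,d\mu=1$, equipped with the $L^2(\mathcal{M},\mu)$ distance.
   Context: The Dirichlet energy $D^\mu:L^2(\mathcal{M},\mu)\to[0,\infty]$ is $$D^\mu(f)=\int_{\mathcal{M}}\|\nabla_g f(u)\|^2\,d\mu(u)\ \text{ if } f\in L^2(\mathcal{M},\mu)\cap H^1(\mathcal{M}),\qquad D^\mu(f)=+\infty\ \text{ otherwise},$$ where $\nabla_g$ is the (weak) gradient on $(\mathcal{M},g)$, $\|\cdot\|$ is the norm induced by $g$ on each tangent space, $vol_g$ is the Riemannian volume, and $H^1(\mathcal{M})$ is the usual first-order Sobolev space on $(\mathcal{M},g)$. Poincaré inequality: $\mu$ has a Poincaré inequality with constant $\lambda$ if for every $f\in L^2(\mathcal{M},\mu)$ with $\int_{\mathcal{M}}f\,d\mu=0$, $$\|f\|_\mu^2\le\frac1\lambda D^\mu(f),$$ where $\|\cdot\|_\mu$ is the $L^2(\mathcal{M},\mu)$ norm. Geodesic convexity: in a geodesic space $(X,d_X)$, a functional $E:X\to\mathbb{R}\cup\{\infty\}$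 is $\kappa$-geodesically convex if for any $x_0,x_1\in X$ there is a constant speed geodesic $\gamma:[0,1]\to X$ with $\gamma(0)=x_0$, $\gamma(1)=x_1$ and $$E(\gamma(t))\le(1-t)E(x_0)+tE(x_1)-\kappa\frac{t(1-t)}2d_X^2(x_0,x_1)\quad\text{for all }t\in[0,1].$$ In the space of functions $f\in L^2(\mathcal{M},\mu)$ with $\int f\,d\mu=1$ and the $L^2(\mathcal{M},\mu)$ distance, the constant speed geodesic from $f_0$ to $f_1$ is $t\mapsto(1-t)f_0+tf_1$. *)

theory Defs
  imports "HOL-Probability.Probability"
begin

section \<open>Smooth manifolds\<close>

primrec C_k_on :: "nat \<Rightarrow> 'u::real_normed_vector set \<Rightarrow> ('u \<Rightarrow> 'v::real_normed_vector) \<Rightarrow> bool"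
  where
    "C_k_on 0 S f \<longleftrightarrow> continuous_on S f"
  | "C_k_on (Suc k) S f \<longleftrightarrow>
       (\<forall>x\<in>S. f differentiable at x) \<and>
       (\<forall>v. C_k_on k S (\<lambda>x. frechet_derivative f (at x) v))"

text \<open>Only meant for open \<open>S\<close> in a finite-dimensional space, where it is the usual \<open>C\<close>-infinity.\<close>

definition smooth_on :: "'u::real_normed_vector set \<Rightarrow> ('u \<Rightarrow> 'v::real_normed_vector) \<Rightarrow> bool"
  where "smooth_on S f \<longleftrightarrow> (\<forall>k. C_k_on k S f)"

text \<open>
  The manifold is the whole type \<open>'m\<close> (Hausdorff and second countable), with a smooth atlas.
  A chart is a pair of a domain \<open>U\<close> and a map that matters on \<open>U\<close> only.
\<close>

type_synonym ('m, 'n) chart = "'m set \<times> ('m \<Rightarrow> real ^ 'n)"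

definition chart_image :: "('m, 'n) chart \<Rightarrow> (real ^ 'n) set"
  where "chart_image c = snd c ` fst c"

definition chart_inv :: "('m, 'n) chart \<Rightarrow> real ^ 'n \<Rightarrow> 'm"
  where "chart_inv c = inv_into (fst c) (snd c)"

definition transition :: "('m, 'n) chart \<Rightarrow> ('m, 'n) chart \<Rightarrow> real ^ 'n \<Rightarrow> real ^ 'n"
  where "transition c c' = snd c' \<circ> chart_inv c"

definition smooth_atlas ::
    "('m::{t2_space, second_countable_topology}, 'n::finite) chart set \<Rightarrow> bool"
  where "smooth_atlas A \<longleftrightarrow>
    (\<Union>c\<in>A. fst c) = UNIV \<and>
    (\<forall>c\<in>A. open (fst c) \<and> open (chart_image c) \<and>
           homeomorphism (fst c) (chart_image c) (snd c) (chart_inv c)) \<and>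
    (\<forall>c\<in>A. \<forall>c'\<in>A. smooth_on (snd c ` (fst c \<inter> fst c')) (transition c c'))"


section \<open>Tangent vectors and Riemannian metrics\<close>

text \<open>
  A tangent vector at \<open>p\<close> is represented by its components in all the charts around \<open>p\<close>, which
  are related by the derivatives of the transition maps; it is \<open>0\<close> at all other charts, so that
  equality of tangent vectors is equality of functions.
\<close>

type_synonym ('m, 'n) tangent = "('m, 'n) chart \<Rightarrow> real ^ 'n"

definition tangent_space ::
    "('m, 'n::finite) chart set \<Rightarrow> 'm \<Rightarrow> ('m, 'n) tangent set"
  where "tangent_space A p = {v.
    (\<forall>c. \<not> (c \<in> A \<and> p \<in> fst c) \<longrightarrow> v c = 0) \<and>
    (\<forall>c\<in>A. \<forall>c'\<in>A. p \<in> fst c \<inter> fst c' \<longrightarrow>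
       v c' = frechet_derivative (transition c c') (at (snd c p)) (v c))}"

definition coord_vector ::
    "('m, 'n::finite) chart set \<Rightarrow> ('m, 'n) chart \<Rightarrow> 'n \<Rightarrow> 'm \<Rightarrow> ('m, 'n) tangent"
  where "coord_vector A c i p = (\<lambda>c'.
    if c' \<in> A \<and> p \<in> fst c'
    then frechet_derivative (transition c c') (at (snd c p)) (axis i 1) else 0)"

type_synonym ('m, 'n) metric_tensor = "'m \<Rightarrow> ('m, 'n) tangent \<Rightarrow> ('m, 'n) tangent \<Rightarrow> real"

definition gram ::
    "('m, 'n::finite) chart set \<Rightarrow> ('m, 'n) metric_tensor \<Rightarrow> ('m, 'n) chart \<Rightarrow>
     real ^ 'n \<Rightarrow> real ^ 'n ^ 'n"
  where "gram A g c x = (\<chi> i j.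
    g (chart_inv c x) (coord_vector A c i (chart_inv c x)) (coord_vector A c j (chart_inv c x)))"

definition inner_product_on ::
    "('m, 'n::finite) tangent set \<Rightarrow> (('m, 'n) tangent \<Rightarrow> ('m, 'n) tangent \<Rightarrow> real) \<Rightarrow> bool"
  where "inner_product_on V b \<longleftrightarrow>
    (\<forall>u\<in>V. \<forall>v\<in>V. b u v = b v u) \<and>
    (\<forall>u\<in>V. \<forall>v\<in>V. \<forall>w\<in>V. b (\<lambda>c. u c + v c) w = b u w + b v w) \<and>
    (\<forall>u\<in>V. \<forall>v\<in>V. \<forall>a. b (\<lambda>c. a *\<^sub>R u c) v = a * b u v) \<and>
    (\<forall>u\<in>V. u \<noteq> (\<lambda>c. 0) \<longrightarrow> 0 < b u u)"

definition riemannian_metric ::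
    "('m, 'n::finite) chart set \<Rightarrow> ('m, 'n) metric_tensor \<Rightarrow> bool"
  where "riemannian_metric A g \<longleftrightarrow>
    (\<forall>p. inner_product_on (tangent_space A p) (g p)) \<and>
    (\<forall>c\<in>A. smooth_on (chart_image c) (gram A g c))"

definition tangent_norm :: "('m, 'n) metric_tensor \<Rightarrow> 'm \<Rightarrow> ('m, 'n) tangent \<Rightarrow> real"
  where "tangent_norm g p v = sqrt (g p v v)"


section \<open>Riemannian distance and volume\<close>

definition velocity ::
    "('m, 'n::finite) chart set \<Rightarrow> (real \<Rightarrow> 'm) \<Rightarrow> real \<Rightarrow> ('m, 'n) tangent"
  where "velocity A \<gamma> t = (\<lambda>c.
    if c \<in> A \<and> \<gamma> t \<in> fst c then vector_derivative (snd c \<circ> \<gamma>) (at t) else 0)"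

definition piecewise_C1_curve ::
    "('m::topological_space, 'n::finite) chart set \<Rightarrow> (real \<Rightarrow> 'm) \<Rightarrow> bool"
  where "piecewise_C1_curve A \<gamma> \<longleftrightarrow>
    continuous_on {0..1} \<gamma> \<and>
    (\<exists>S. finite S \<and>
       (\<forall>c\<in>A. (snd c \<circ> \<gamma>) C1_differentiable_on {t \<in> {0..1} - S. \<gamma> t \<in> fst c}))"

definition curve_length ::
    "('m, 'n::finite) chart set \<Rightarrow> ('m, 'n) metric_tensor \<Rightarrow> (real \<Rightarrow> 'm) \<Rightarrow> ennreal"
  where "curve_length A g \<gamma> =
    (\<integral>\<^sup>+t\<in>{0..1}. ennreal (tangent_norm g (\<gamma> t) (velocity A \<gamma> t)) \<partial>lborel)"

text \<open>The infimum is finite when the manifold is connected.\<close>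

definition riemannian_dist ::
    "('m::topological_space, 'n::finite) chart set \<Rightarrow> ('m, 'n) metric_tensor \<Rightarrow> 'm \<Rightarrow> 'm \<Rightarrow> real"
  where "riemannian_dist A g p q =
    enn2real (INF \<gamma>\<in>{\<gamma>. piecewise_C1_curve A \<gamma> \<and> \<gamma> 0 = p \<and> \<gamma> 1 = q}. curve_length A g \<gamma>)"

text \<open>The Borel measure given by \<open>sqrt (det (g\<^sub>i\<^sub>j)) dx\<close> in every chart.\<close>

definition riemannian_volume ::
    "('m::topological_space, 'n::finite) chart set \<Rightarrow> ('m, 'n) metric_tensor \<Rightarrow> 'm measure"
  where "riemannian_volume A g = (THE V. sets V = sets borel \<and>
    (\<forall>c\<in>A. \<forall>B\<in>sets borel. B \<subseteq> fst c \<longrightarrow>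
       emeasure V B = (\<integral>\<^sup>+x\<in>snd c ` B. ennreal (sqrt (det (gram A g c x))) \<partial>lborel)))"


section \<open>Weak gradient, Sobolev space and Dirichlet energy\<close>

definition test_function :: "(real ^ 'n::finite) set \<Rightarrow> (real ^ 'n \<Rightarrow> real) \<Rightarrow> bool"
  where "test_function W \<psi> \<longleftrightarrow>
    smooth_on UNIV \<psi> \<and> (\<exists>K. compact K \<and> K \<subseteq> W \<and> (\<forall>x. x \<notin> K \<longrightarrow> \<psi> x = 0))"

definition locally_integrable_on :: "(real ^ 'n::finite) set \<Rightarrow> (real ^ 'n \<Rightarrow> real) \<Rightarrow> bool"
  where "locally_integrable_on W f \<longleftrightarrow> (\<forall>K. compact K \<and> K \<subseteq> W \<longrightarrow> set_integrable lborel K f)"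

definition weak_partial ::
    "(real ^ 'n::finite) set \<Rightarrow> 'n \<Rightarrow> (real ^ 'n \<Rightarrow> real) \<Rightarrow> (real ^ 'n \<Rightarrow> real) \<Rightarrow> bool"
  where "weak_partial W i f h \<longleftrightarrow>
    locally_integrable_on W f \<and> locally_integrable_on W h \<and>
    (\<forall>\<psi>. test_function W \<psi> \<longrightarrow>
       (LINT x:W|lborel. f x * frechet_derivative \<psi> (at x) (axis i 1)) =
       - (LINT x:W|lborel. h x * \<psi> x))"

text \<open>
  \<open>X\<close> is a weak gradient of \<open>f\<close> if \<open>g(X, \<partial>\<^sub>i)\<close> is the weak \<open>i\<close>-th partial derivative of \<open>f\<close> in
  every chart. The local integrability in \<^const>\<open>weak_partial\<close> makes \<open>X\<close> measurable.
\<close>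

definition weak_gradient ::
    "('m, 'n::finite) chart set \<Rightarrow> ('m, 'n) metric_tensor \<Rightarrow> ('m \<Rightarrow> real) \<Rightarrow>
     ('m \<Rightarrow> ('m, 'n) tangent) \<Rightarrow> bool"
  where "weak_gradient A g f X \<longleftrightarrow>
    (\<forall>p. X p \<in> tangent_space A p) \<and>
    (\<forall>c\<in>A. \<forall>i. weak_partial (chart_image c) i
       (\<lambda>x. f (chart_inv c x))
       (\<lambda>x. g (chart_inv c x) (X (chart_inv c x)) (coord_vector A c i (chart_inv c x))))"

definition square_integrable :: "'x measure \<Rightarrow> ('x \<Rightarrow> real) set"
  where "square_integrable M = {f \<in> borel_measurable M. integrable M (\<lambda>x. (f x)\<^sup>2)}"

definition H1 ::
    "('m::topological_space, 'n::finite) chart set \<Rightarrow> ('m, 'n) metric_tensor \<Rightarrow> ('m \<Rightarrow> real) set"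
  where "H1 A g = {f \<in> square_integrable (riemannian_volume A g).
    \<exists>X. weak_gradient A g f X \<and>
        (\<integral>\<^sup>+p. ennreal ((tangent_norm g p (X p))\<^sup>2) \<partial>riemannian_volume A g) < \<infinity>}"

text \<open>The weak gradient is unique up to a set of volume zero.\<close>

definition grad ::
    "('m, 'n::finite) chart set \<Rightarrow> ('m, 'n) metric_tensor \<Rightarrow> ('m \<Rightarrow> real) \<Rightarrow>
     'm \<Rightarrow> ('m, 'n) tangent"
  where "grad A g f = (SOME X. weak_gradient A g f X)"

definition dirichlet_energy ::
    "('m::topological_space, 'n::finite) chart set \<Rightarrow> ('m, 'n) metric_tensor \<Rightarrow> 'm measure \<Rightarrow>
     ('m \<Rightarrow> real) \<Rightarrow> ennreal"
  where "dirichlet_energy A g \<mu> f =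
    (if f \<in> square_integrable \<mu> \<inter> H1 A g
     then \<integral>\<^sup>+p. ennreal ((tangent_norm g p (grad A g f p))\<^sup>2) \<partial>\<mu>
     else \<infinity>)"

definition poincare_inequality ::
    "('m::topological_space, 'n::finite) chart set \<Rightarrow> ('m, 'n) metric_tensor \<Rightarrow> 'm measure \<Rightarrow>
     real \<Rightarrow> bool"
  where "poincare_inequality A g \<mu> lam \<longleftrightarrow>
    (\<forall>f\<in>square_integrable \<mu>. (\<integral>p. f p \<partial>\<mu>) = 0 \<longrightarrow>
       ennreal (\<integral>p. (f p)\<^sup>2 \<partial>\<mu>) \<le> ennreal (1 / lam) * dirichlet_energy A g \<mu> f)"


section \<open>The metric space of square-integrable functions\<close>

text \<open>Square-integrable functions modulo equality almost everywhere, so that \<open>L2_dist\<close> is a metric.\<close>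

definition ae_equal :: "'x measure \<Rightarrow> (('x \<Rightarrow> real) \<times> ('x \<Rightarrow> real)) set"
  where "ae_equal M = {(f, h). f \<in> square_integrable M \<and> h \<in> square_integrable M \<and>
                              (AE x in M. f x = h x)}"

definition L2 :: "'x measure \<Rightarrow> ('x \<Rightarrow> real) set set"
  where "L2 M = square_integrable M // ae_equal M"

definition rep :: "('x \<Rightarrow> real) set \<Rightarrow> 'x \<Rightarrow> real"
  where "rep F = (SOME f. f \<in> F)"

definition L2_dist :: "'x measure \<Rightarrow> ('x \<Rightarrow> real) set \<Rightarrow> ('x \<Rightarrow> real) set \<Rightarrow> real"
  where "L2_dist M F H = sqrt (\<integral>x. (rep F x - rep H x)\<^sup>2 \<partial>M)"

definition L2_mean_one :: "'x measure \<Rightarrow> ('x \<Rightarrow> real) set set"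
  where "L2_mean_one M = {F \<in> L2 M. (\<integral>x. rep F x \<partial>M) = 1}"

definition dirichlet_functional ::
    "('m::topological_space, 'n::finite) chart set \<Rightarrow> ('m, 'n) metric_tensor \<Rightarrow> 'm measure \<Rightarrow>
     ('m \<Rightarrow> real) set \<Rightarrow> ereal"
  where "dirichlet_functional A g \<mu> F = enn2ereal (dirichlet_energy A g \<mu> (rep F))"


section \<open>Geodesic convexity\<close>

definition constant_speed_geodesic ::
    "'x set \<Rightarrow> ('x \<Rightarrow> 'x \<Rightarrow> real) \<Rightarrow> (real \<Rightarrow> 'x) \<Rightarrow> bool"
  where "constant_speed_geodesic S d \<gamma> \<longleftrightarrow>
    \<gamma> ` {0..1} \<subseteq> S \<and>
    (\<forall>s\<in>{0..1}. \<forall>t\<in>{0..1}. d (\<gamma> s) (\<gamma> t) = \<bar>s - t\<bar> * d (\<gamma> 0) (\<gamma> 1))"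

text \<open>In \<^typ>\<open>ereal\<close>, \<open>0 * \<infinity> = 0\<close>, so at \<open>t = 0\<close> and \<open>t = 1\<close> the inequality is trivial.\<close>

definition geodesically_convex ::
    "'x set \<Rightarrow> ('x \<Rightarrow> 'x \<Rightarrow> real) \<Rightarrow> real \<Rightarrow> ('x \<Rightarrow> ereal) \<Rightarrow> bool"
  where "geodesically_convex S d \<kappa> E \<longleftrightarrow>
    (\<forall>x0\<in>S. \<forall>x1\<in>S. \<exists>\<gamma>. constant_speed_geodesic S d \<gamma> \<and> \<gamma> 0 = x0 \<and> \<gamma> 1 = x1 \<and>
       (\<forall>t\<in>{0..1}. E (\<gamma> t) \<le>
          ereal (1 - t) * E x0 + ereal t * E x1
            - ereal (\<kappa> * (t * (1 - t) / 2) * (d x0 x1)\<^sup>2)))"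

end

theory Submission
  imports Defs
begin

text \<open>
  The Dirichlet energy \<open>D\<close> is a quadratic form, hence
  \<open>D ((1 - t) f + t h) + t (1 - t) D (f - h) = (1 - t) D f + t D h\<close>. The Poincare inequality
  for \<open>f - h\<close>, which has mean zero, is therefore exactly the \<open>2 \<lambda>\<close>-convexity of \<open>D\<close> along the
  segment from \<open>f\<close> to \<open>h\<close>. By the parallelogram law the midpoint of any geodesic in \<open>L2\<close> is the
  midpoint of the segment. Quadraticity needs that weak gradients are unique almost everywhere
  (tested against bump functions approximating boxes), and this needs that the Riemannian volume,
  defined by a definite description, exists (change of variables).
\<close>

section \<open>Change of variables\<close>

text \<open>Convexity provides some geodesic, and its distances are all that is known about it. The
  midpoint is enough: in the quadratic identity and in the convexity inequality the difference term
  carries the same factor \<open>t * (1 - t)\<close>, so \<open>t = 1/2\<close> already returns the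
  full constant. In the converse a mean-zero \<open>k\<close> has to appear as a difference of two
  mean-one functions of finite energy, so one such function must be constructed.

  Three objects come from choice operators: the volume from \<open>THE\<close>, the gradient and the
  representative of a class from \<open>SOME\<close>. Each must first be shown independent of the
  choice, up to null sets. The Sobolev space refers to the volume, while the energy and the classes
  refer to \<open>\<mu>\<close>; the positive density gives both measures the same null sets, which
  lets statements pass between them.

  Energies may be infinite. The quadratic identity is therefore kept as an equality of sums in
  \<open>ennreal\<close>, and is solved for one term only after the infinite cases have been split
  off.\<close>

text \<open>
  The change of variables theorem of the library asks for a well-ordered index type, which
  \<open>'n\<close> need not be; it is transferred along a relabelling of the coordinates.
\<close>

typedef 'a wo = "UNIV :: 'a set" ..

lemma bij_Rep_wo: "bij (Rep_wo :: 'a wo \<Rightarrow> 'a)"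
  by (metis Abs_wo_inverse Rep_wo_inverse UNIV_I bijI')

lemma bij_Abs_wo: "bij (Abs_wo :: 'a \<Rightarrow> 'a wo)"
  by (metis Abs_wo_inverse Rep_wo_inverse UNIV_I bijI')

instance wo :: (finite) finite
proof
  have "finite (range (Abs_wo :: 'a \<Rightarrow> 'a wo))" by simp
  then show "finite (UNIV :: 'a wo set)"
    using bij_is_surj[OF bij_Abs_wo] by metis
qed

text \<open>Any injection will do; it only serves to pull back the well-order of the natural
  numbers.\<close>

definition wo_index :: "'a::finite \<Rightarrow> nat"
  where "wo_index = (SOME h. inj h)"

lemma inj_wo_index: "inj (wo_index :: 'a::finite \<Rightarrow> nat)"
proof -
  have "\<exists>h :: 'a \<Rightarrow> nat. inj h"
    using finite_imp_inj_to_nat_seg[of "UNIV :: 'a set"] by auto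
  then show ?thesis
    unfolding wo_index_def by (rule someI_ex)
qed

instantiation wo :: (finite) wellorder
begin

definition less_eq_wo :: "'a wo \<Rightarrow> 'a wo \<Rightarrow> bool"
  where "less_eq_wo x y \<longleftrightarrow> wo_index (Rep_wo x) \<le> wo_index (Rep_wo y)"

definition less_wo :: "'a wo \<Rightarrow> 'a wo \<Rightarrow> bool"
  where "less_wo x y \<longleftrightarrow> wo_index (Rep_wo x) < wo_index (Rep_wo y)"

instance
proof
  fix x y z :: "'a wo" and P :: "'a wo \<Rightarrow> bool"
  show "(x < y) = (x \<le> y \<and> \<not> y \<le> x)"
    by (auto simp: less_eq_wo_def less_wo_def)
  show "x \<le> x" "x \<le> y \<or> y \<le> x"
    by (auto simp: less_eq_wo_def)
  show "x \<le> y \<Longrightarrow> y \<le> z \<Longrightarrow> x \<le> z"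
    by (auto simp: less_eq_wo_def)
  show "x = y" if "x \<le> y" "y \<le> x"
  proof -
    have "wo_index (Rep_wo x) = wo_index (Rep_wo y)"
      using that by (auto simp: less_eq_wo_def)
    then have "Rep_wo x = Rep_wo y" by (rule injD[OF inj_wo_index])
    then show "x = y" by (simp only: Rep_wo_inject)
  qed
  show "P x" if step: "\<And>x. (\<And>y. y < x \<Longrightarrow> P y) \<Longrightarrow> P x"
  proof (induction "wo_index (Rep_wo x)" arbitrary: x rule: less_induct)
    case less
    then show ?case using step[of x] by (simp add: less_wo_def)
  qed
qed

end

text \<open>Conjugation by \<open>e\<close> carries the permutations of one index set to those of
  the other and keeps their signs; reindexing the product along \<open>e\<close> then matches the
  summands of the Leibniz formula one by one.\<close>

lemma det_reindex:
  fixes A :: "real^'n::finite^'n" and e :: "'m::finite \<Rightarrow> 'n"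
  assumes e: "bij e"
  shows "det (\<chi> i j. A $ e i $ e j) = det A"
proof -
  let ?F = "\<lambda>p. inv e \<circ> p \<circ> e" and ?G = "\<lambda>q. e \<circ> q \<circ> inv e"
  have inv_e: "bij (inv e)" using e by (rule bij_imp_bij_inv)
  have e1: "\<And>x. inv e (e x) = x" and e2: "\<And>x. e (inv e x) = x"
    using e by (auto simp: bij_def surj_f_inv_f)
  have map_eq: "map_permutation UNIV (inv e) p = ?F p" for p
    using e inv_e
    by (auto simp: map_permutation_def restrict_id_def fun_eq_iff e1 e2 bij_is_surj
        inv_inv_eq bij_is_inj)
  have sgn: "sign (?F p) = sign p" if "p permutes (UNIV :: 'n set)" for p
    using sign_map_permutation[of "inv e" UNIV p] that inv_e unfolding map_eq
    by (auto simp: bij_is_inj)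
  have perm: "p permutes UNIV \<longleftrightarrow> bij p" for p :: "'x \<Rightarrow> 'x"
    using permutes_bij bij_imp_permutes[of p UNIV] by auto
  have prod: "(\<Prod>i\<in>UNIV. A $ e i $ e (?F p i)) = (\<Prod>i\<in>UNIV. A $ i $ p i)" for p
    using prod.reindex_bij_betw[OF e, of "\<lambda>i. A $ i $ p i"] by (simp add: e2)
  have "det A = (\<Sum>p | p permutes UNIV. of_int (sign (?F p)) * (\<Prod>i\<in>UNIV. A $ e i $ e (?F p i)))"
    unfolding det_def prod by (intro sum.cong) (auto simp: sgn)
  also have "\<dots> = (\<Sum>q | q permutes UNIV. of_int (sign q) * (\<Prod>i\<in>UNIV. A $ e i $ e (q i)))"
    by (rule sum.reindex_bij_witness[where i = ?G and j = ?F])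
      (auto simp: perm fun_eq_iff e1 e2 e inv_e bij_comp)
  finally show ?thesis by (simp add: det_def)
qed

section \<open>Relabelling the coordinates of Euclidean space\<close>

definition relabel :: "real^'n::finite wo \<Rightarrow> real^'n"
  where "relabel y = (\<chi> i. y $ Abs_wo i)"

definition unlabel :: "real^'n::finite \<Rightarrow> real^'n wo"
  where "unlabel x = (\<chi> i. x $ Rep_wo i)"

lemma relabel_unlabel [simp]: "relabel (unlabel x) = x"
  by (simp add: relabel_def unlabel_def vec_eq_iff Abs_wo_inverse)

lemma unlabel_relabel [simp]: "unlabel (relabel x) = x"
  by (simp add: relabel_def unlabel_def vec_eq_iff Rep_wo_inverse)

lemma bounded_linear_relabel: "bounded_linear relabel"
  by (intro linear_conv_bounded_linear[THEN iffD1] linearI)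
    (simp_all add: relabel_def vec_eq_iff)

lemma bounded_linear_unlabel: "bounded_linear unlabel"
  by (intro linear_conv_bounded_linear[THEN iffD1] linearI)
    (simp_all add: unlabel_def vec_eq_iff)

lemma measurable_relabel [measurable]: "relabel \<in> borel_measurable borel"
  by (intro borel_measurable_continuous_onI linear_continuous_on bounded_linear_relabel)

lemma emeasure_lborel_box_cart:
  fixes l u :: "real^'n"
  assumes "\<And>i. l $ i \<le> u $ i"
  shows "emeasure lborel (box l u) = ennreal (\<Prod>i\<in>UNIV. u $ i - l $ i)"
proof -
  have "(\<Prod>b\<in>Basis. (u - l) \<bullet> b) = (\<Prod>i\<in>UNIV. u $ i - l $ i)"
  proof -
    have "bij_betw (\<lambda>i. axis i (1::real)) UNIV (Basis :: (real^'n) set)"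
      by (auto simp: bij_betw_def inj_on_def axis_eq_axis Basis_vec_def)
    from prod.reindex_bij_betw[OF this, of "\<lambda>b. (u - l) \<bullet> b"]
    show ?thesis by (simp add: inner_axis)
  qed
  moreover have "emeasure lborel (box l u) = (\<Prod>b\<in>Basis. (u - l) \<bullet> b)"
    using assms by (intro emeasure_lborel_box) (auto simp: Basis_vec_def inner_axis)
  ultimately show ?thesis by simp
qed

text \<open>A box is pulled back to a box with the same side lengths in another order, and Lebesgue
  measure is determined by its values on boxes.\<close>

lemma distr_lborel_relabel: "distr lborel borel relabel = (lborel :: (real^'n::finite) measure)"
proof (rule lborel_eqI[symmetric])
  fix l u :: "real^'n" assume le: "\<And>b. b \<in> Basis \<Longrightarrow> l \<bullet> b \<le> u \<bullet> b"
  then have le': "l $ i \<le> u $ i" for i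
    using axis_in_Basis_iff[of i "1::real"] by (fastforce simp: inner_axis)
  have "relabel -` box l u = box (unlabel l) (unlabel u)"
  proof (intro set_eqI iffI)
    show "x \<in> box (unlabel l) (unlabel u)" if "x \<in> relabel -` box l u" for x
      using that by (auto simp: mem_box_cart relabel_def unlabel_def) (metis Rep_wo_inverse)+
    show "x \<in> relabel -` box l u" if "x \<in> box (unlabel l) (unlabel u)" for x
      using that by (auto simp: mem_box_cart relabel_def unlabel_def) (metis Abs_wo_inverse UNIV_I)+
  qed
  then have "emeasure (distr lborel borel relabel) (box l u)
      = (\<Prod>i\<in>UNIV. unlabel u $ i - unlabel l $ i)"
    using emeasure_lborel_box_cart[of "unlabel l" "unlabel u"] le'
    by (subst emeasure_distr) (auto simp: unlabel_def)
  also have "(\<Prod>i\<in>UNIV. unlabel u $ i - unlabel l $ i) = (\<Prod>i\<in>UNIV. u $ i - l $ i)"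
    using prod.reindex_bij_betw[OF bij_Rep_wo, of "\<lambda>i. u $ i - l $ i"]
    by (simp add: unlabel_def)
  also have "ennreal \<dots> = emeasure lborel (box l u)"
    using emeasure_lborel_box_cart le' by metis
  also have "\<dots> = (\<Prod>b\<in>Basis. (u - l) \<bullet> b)"
    using le by (rule emeasure_lborel_box)
  finally show "emeasure (distr lborel borel relabel) (box l u) = (\<Prod>b\<in>Basis. (u - l) \<bullet> b)" .
qed simp

section \<open>Substitution in nonnegative integrals\<close>

lemma nn_integral_lborel_eq:
  fixes h :: "'a::euclidean_space \<Rightarrow> real"
  assumes "h \<in> borel_measurable borel" "\<And>x. 0 \<le> h x"
  shows "(\<integral>\<^sup>+x. ennreal (h x) \<partial>lborel)
    = (if integrable lborel h then ennreal (integral\<^sup>L lborel h) else \<infinity>)"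
proof (cases "integrable lborel h")
  case True
  then show ?thesis using assms by (simp add: nn_integral_eq_integral)
next
  case False
  have "h \<in> borel_measurable lborel" using assms by simp
  then have "\<not> (\<integral>\<^sup>+x. ennreal (h x) \<partial>lborel) < \<infinity>"
    using integrableI_nonneg[of h lborel] assms(2) False by blast
  then show ?thesis using False by (metis infinity_ennreal_def less_top)
qed

text \<open>The known rule is an equivalence about absolute integrability together with the value
  \<open>b\<close> of the integral. Since \<open>b\<close> is free, either both sides are integrable
  with equal integrals, or neither is and both nonnegative integrals are infinite.\<close>

lemma nn_integral_change_of_variables_wellorder:
  fixes \<tau> :: "real^'n::{finite,wellorder} \<Rightarrow> real^'n::_" and f :: "real^'n::_ \<Rightarrow> real"
  assumes S: "S \<in> sets borel"
    and der: "\<And>x. x \<in> S \<Longrightarrow> (\<tau> has_derivative \<tau>' x) (at x within S)"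
    and inj: "inj_on \<tau> S"
    and f: "(\<lambda>x. indicator (\<tau> ` S) x * f x) \<in> borel_measurable borel"
    and m: "(\<lambda>x. indicator S x * (\<bar>det (matrix (\<tau>' x))\<bar> * f (\<tau> x))) \<in> borel_measurable borel"
    and nonneg: "\<And>x. 0 \<le> f x"
  shows "(\<integral>\<^sup>+x\<in>\<tau> ` S. ennreal (f x) \<partial>lborel)
    = (\<integral>\<^sup>+x\<in>S. ennreal (\<bar>det (matrix (\<tau>' x))\<bar> * f (\<tau> x)) \<partial>lborel)"
proof -
  let ?h = "\<lambda>x. indicator S x * (\<bar>det (matrix (\<tau>' x))\<bar> * f (\<tau> x))"
  let ?k = "\<lambda>x. indicator (\<tau> ` S) x * f x"
  let ?D = "\<lambda>x. \<bar>det (matrix (\<tau>' x))\<bar> * f (\<tau> x)"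
  have cv: "?D absolutely_integrable_on S \<and> integral S ?D = b
      \<longleftrightarrow> f absolutely_integrable_on (\<tau> ` S) \<and> integral (\<tau> ` S) f = b" for b
  proof -
    have 1: "S \<in> sets lebesgue" using S by simp
    \<comment> \<open>The rule is about functions with vector values, so a real integrand enters it
      with values in \<open>real^1\<close>.\<close>
    have *: "(\<lambda>x. \<bar>det (matrix (\<tau>' x))\<bar> *\<^sub>R vec (f (\<tau> x)) :: real^1) absolutely_integrable_on S \<and>
           integral S (\<lambda>x. \<bar>det (matrix (\<tau>' x))\<bar> *\<^sub>R vec (f (\<tau> x)) :: real^1) = vec b
     \<longleftrightarrow> (\<lambda>x. vec (f x) :: real^1) absolutely_integrable_on (\<tau> ` S) \<and>
           integral (\<tau> ` S) (\<lambda>x. vec (f x) :: real^1) = vec b"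
      by (rule has_absolute_integral_change_of_variables[OF 1 der inj])
    have **: "(\<lambda>x. \<bar>det (matrix (\<tau>' x))\<bar> *\<^sub>R vec (f (\<tau> x)) :: real^1) = (\<lambda>x. vec (?D x))"
      by (auto simp: vec_eq_iff)
    show ?thesis
      using * unfolding ** absolutely_integrable_on_1_iff integral_on_1_eq by simp
  qed
  \<comment> \<open>Absolute integrability refers to the completed measure. For Borel measurable
    integrands completion changes neither integrability nor the integral; this is the purpose of
    \<open>f\<close> and \<open>m\<close>.\<close>
  have i1: "integrable lborel ?h \<longleftrightarrow> ?D absolutely_integrable_on S"
    using m by (simp add: set_integrable_def integrable_completion)
  have i2: "integrable lborel ?k \<longleftrightarrow> f absolutely_integrable_on (\<tau> ` S)"
    using f by (simp add: set_integrable_def integrable_completion)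
  have e1: "integral\<^sup>L lborel ?h = integral S ?D" if "?D absolutely_integrable_on S"
    using set_lebesgue_integral_eq_integral(2)[OF that] m
    by (simp add: set_lebesgue_integral_def integral_completion)
  have e2: "integral\<^sup>L lborel ?k = integral (\<tau> ` S) f" if "f absolutely_integrable_on (\<tau> ` S)"
    using set_lebesgue_integral_eq_integral(2)[OF that] f
    by (simp add: set_lebesgue_integral_def integral_completion)
  have "(\<integral>\<^sup>+x. ennreal (?k x) \<partial>lborel) = (\<integral>\<^sup>+x. ennreal (?h x) \<partial>lborel)"
  proof -
    have k: "(\<integral>\<^sup>+x. ennreal (?k x) \<partial>lborel)
        = (if integrable lborel ?k then ennreal (integral\<^sup>L lborel ?k) else \<infinity>)"
      by (rule nn_integral_lborel_eq[OF f]) (simp add: nonneg)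
    have h: "(\<integral>\<^sup>+x. ennreal (?h x) \<partial>lborel)
        = (if integrable lborel ?h then ennreal (integral\<^sup>L lborel ?h) else \<infinity>)"
      by (rule nn_integral_lborel_eq[OF m]) (simp add: nonneg)
    show ?thesis
    proof (cases "integrable lborel ?h")
      case True
      then have D: "?D absolutely_integrable_on S" using i1 by blast
      then have fS: "f absolutely_integrable_on (\<tau> ` S)"
        and eq: "integral (\<tau> ` S) f = integral S ?D"
        using cv[of "integral S ?D"] by blast+
      have "integral\<^sup>L lborel ?k = integral\<^sup>L lborel ?h"
        unfolding e1[OF D] e2[OF fS] by (rule eq)
      then show ?thesis unfolding k h using True i2 fS by (simp only: simp_thms if_True)
    next
      case False
      then have "\<not> ?D absolutely_integrable_on S" using i1 by blast
      then have "\<not> f absolutely_integrable_on (\<tau> ` S)"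
        using cv[of "integral (\<tau> ` S) f"] by blast
      then show ?thesis unfolding k h using False i2 by (simp only: simp_thms if_False)
    qed
  qed
  moreover have "ennreal (?k x) = ennreal (f x) * indicator (\<tau> ` S) x" for x
    by (auto simp: indicator_def)
  moreover have "ennreal (?h x) = ennreal (?D x) * indicator S x" for x
    by (auto simp: indicator_def)
  ultimately show ?thesis by simp
qed

lemma nn_integral_relabel:
  fixes h :: "real^'n::finite \<Rightarrow> ennreal"
  assumes "h \<in> borel_measurable borel"
  shows "(\<integral>\<^sup>+x. h x \<partial>lborel) = (\<integral>\<^sup>+y. h (relabel y) \<partial>lborel)"
proof -
  have "(\<integral>\<^sup>+x. h x \<partial>lborel) = (\<integral>\<^sup>+x. h x \<partial>distr lborel borel relabel)"
    by (simp add: distr_lborel_relabel)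
  also have "\<dots> = (\<integral>\<^sup>+y. h (relabel y) \<partial>lborel)"
    using assms by (intro nn_integral_distr) simp_all
  finally show ?thesis .
qed

text \<open>Conjugating \<open>\<tau>\<close> with the relabelling gives a map over a well-ordered
  index type. Its Jacobian determinant is the old one by \<open>det_reindex\<close>, and integrals
  are carried over by \<open>distr_lborel_relabel\<close>.\<close>

theorem nn_integral_change_of_variables:
  fixes \<tau> :: "real^'n::finite \<Rightarrow> real^'n" and f :: "real^'n \<Rightarrow> real"
  assumes S: "S \<in> sets borel"
    and der: "\<And>x. x \<in> S \<Longrightarrow> (\<tau> has_derivative \<tau>' x) (at x within S)"
    and inj: "inj_on \<tau> S"
    and f: "(\<lambda>x. indicator (\<tau> ` S) x * f x) \<in> borel_measurable borel"
    and m: "(\<lambda>x. indicator S x * (\<bar>det (matrix (\<tau>' x))\<bar> * f (\<tau> x))) \<in> borel_measurable borel"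
    and nonneg: "\<And>x. 0 \<le> f x"
  shows "(\<integral>\<^sup>+x\<in>\<tau> ` S. ennreal (f x) \<partial>lborel)
    = (\<integral>\<^sup>+x\<in>S. ennreal (\<bar>det (matrix (\<tau>' x))\<bar> * f (\<tau> x)) \<partial>lborel)"
proof -
  define T where "T = relabel -` S"
  define \<sigma> where "\<sigma> = unlabel \<circ> \<tau> \<circ> relabel"
  define \<sigma>' where "\<sigma>' y = unlabel \<circ> \<tau>' (relabel y) \<circ> relabel" for y
  have T: "T \<in> sets borel"
    using measurable_sets[OF measurable_relabel S] by (simp add: T_def)
  have rT: "relabel ` T = S"
    unfolding T_def by (auto intro!: image_eqI[where x = "unlabel _"])
  have img: "\<sigma> ` T = relabel -` (\<tau> ` S)"
  proof (intro set_eqI iffI)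
    show "y \<in> \<sigma> ` T" if y: "y \<in> relabel -` (\<tau> ` S)" for y
    proof -
      obtain x where x: "x \<in> S" "relabel y = \<tau> x" using y by auto
      then have "y = \<sigma> (unlabel x)" "unlabel x \<in> T"
        by (metis \<sigma>_def comp_apply relabel_unlabel unlabel_relabel) (simp add: T_def x)
      then show ?thesis by blast
    qed
  qed (auto simp: \<sigma>_def T_def)
  have dT: "(\<sigma> has_derivative \<sigma>' y) (at y within T)" if "y \<in> T" for y
  proof -
    have "(\<tau> has_derivative \<tau>' (relabel y)) (at (relabel y) within relabel ` T)"
      unfolding rT using that by (intro der) (simp add: T_def)
    then have "(unlabel \<circ> \<tau> has_derivative unlabel \<circ> \<tau>' (relabel y))
        (at (relabel y) within relabel ` T)"
      by (rule diff_chain_within)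
        (rule bounded_linear_imp_has_derivative[OF bounded_linear_unlabel])
    then show ?thesis
      unfolding \<sigma>_def \<sigma>'_def
      by (rule diff_chain_within[OF bounded_linear_imp_has_derivative[OF bounded_linear_relabel]])
  qed
  have iT: "inj_on \<sigma> T"
  proof (rule inj_onI)
    fix x y assume xy: "x \<in> T" "y \<in> T" "\<sigma> x = \<sigma> y"
    then have "\<tau> (relabel x) = \<tau> (relabel y)"
      unfolding \<sigma>_def by (metis comp_apply relabel_unlabel)
    then have "relabel x = relabel y"
      using inj xy by (auto simp: T_def dest: inj_onD)
    then show "x = y" by (metis unlabel_relabel)
  qed
  have det: "det (matrix (\<sigma>' y)) = det (matrix (\<tau>' (relabel y)))" for y
  proof -
    have ax: "relabel (axis j 1) = (axis (Rep_wo j) 1 :: real^'n)" for j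
      by (auto simp: relabel_def axis_def vec_eq_iff Abs_wo_inverse Rep_wo_inverse)
    have "matrix (\<sigma>' y) = (\<chi> i j. matrix (\<tau>' (relabel y)) $ Rep_wo i $ Rep_wo j)"
      by (simp add: matrix_def \<sigma>'_def unlabel_def ax)
    then show ?thesis
      by (simp only: det_reindex[OF bij_Rep_wo])
  qed
  have "(\<integral>\<^sup>+x\<in>\<tau> ` S. ennreal (f x) \<partial>lborel)
      = (\<integral>\<^sup>+x. ennreal (indicator (\<tau> ` S) x * f x) \<partial>lborel)"
    by (intro nn_integral_cong) (auto simp: indicator_def)
  also have "\<dots> = (\<integral>\<^sup>+y. ennreal (indicator (\<tau> ` S) (relabel y) * f (relabel y)) \<partial>lborel)"
    using f by (intro nn_integral_relabel) simp
  also have "\<dots> = (\<integral>\<^sup>+y\<in>\<sigma> ` T. ennreal (f (relabel y)) \<partial>lborel)"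
    unfolding img by (intro nn_integral_cong) (auto simp: indicator_def)
  also have "\<dots> = (\<integral>\<^sup>+y\<in>T. ennreal (\<bar>det (matrix (\<sigma>' y))\<bar> * f (relabel (\<sigma> y))) \<partial>lborel)"
  proof (rule nn_integral_change_of_variables_wellorder[OF T dT iT])
    have "(\<lambda>y. indicator (\<sigma> ` T) y * f (relabel y))
        = (\<lambda>x. indicator (\<tau> ` S) x * f x) \<circ> relabel"
      unfolding img by (auto simp: indicator_def fun_eq_iff)
    then show "(\<lambda>y. indicator (\<sigma> ` T) y * f (relabel y)) \<in> borel_measurable borel"
      using measurable_comp[OF measurable_relabel f] by simp
    have "(\<lambda>y. indicator T y * (\<bar>det (matrix (\<sigma>' y))\<bar> * f (relabel (\<sigma> y))))
        = (\<lambda>x. indicator S x * (\<bar>det (matrix (\<tau>' x))\<bar> * f (\<tau> x))) \<circ> relabel"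
      unfolding det by (auto simp: indicator_def T_def \<sigma>_def fun_eq_iff)
    then show "(\<lambda>y. indicator T y * (\<bar>det (matrix (\<sigma>' y))\<bar> * f (relabel (\<sigma> y)))) \<in> borel_measurable borel"
      using measurable_comp[OF measurable_relabel m] by simp
  qed (use nonneg in auto)
  also have "\<dots> = (\<integral>\<^sup>+y. ennreal (indicator S (relabel y) *
      (\<bar>det (matrix (\<tau>' (relabel y)))\<bar> * f (\<tau> (relabel y)))) \<partial>lborel)"
    unfolding det by (intro nn_integral_cong) (auto simp: indicator_def T_def \<sigma>_def)
  also have "\<dots> = (\<integral>\<^sup>+x. ennreal (indicator S x * (\<bar>det (matrix (\<tau>' x))\<bar> * f (\<tau> x))) \<partial>lborel)"
    using m by (intro nn_integral_relabel[symmetric]) simp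
  also have "\<dots> = (\<integral>\<^sup>+x\<in>S. ennreal (\<bar>det (matrix (\<tau>' x))\<bar> * f (\<tau> x)) \<partial>lborel)"
    by (intro nn_integral_cong) (auto simp: indicator_def)
  finally show ?thesis .
qed

section \<open>Smooth functions and test functions\<close>

lemma C_k_on_SucI:
  assumes "\<And>x. (f has_derivative f' x) (at x)" "\<And>v. C_k_on k UNIV (\<lambda>x. f' x v)"
  shows "C_k_on (Suc k) UNIV f"
proof -
  have "f' x = frechet_derivative f (at x)" for x
    using assms(1) by (rule frechet_derivative_at)
  then show ?thesis
    using assms by (auto simp: differentiable_def)
qed

lemma C_k_on_Suc_derivative:
  assumes "C_k_on (Suc k) UNIV f"
  shows "(f has_derivative frechet_derivative f (at x)) (at x)"
  using assms by (simp add: frechet_derivative_works)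

lemma C_k_on_Suc_imp: "C_k_on (Suc k) S f \<Longrightarrow> C_k_on k S f"
proof (induction k arbitrary: f)
  case 0
  then show ?case
    by (auto intro!: continuous_at_imp_continuous_on differentiable_imp_continuous_within)
next
  case (Suc k)
  have "C_k_on k S (\<lambda>x. frechet_derivative f (at x) v)" for v
    by (rule Suc.IH) (use Suc.prems in simp)
  then show ?case using Suc.prems by simp
qed

lemma C_k_on_const: "C_k_on k UNIV (\<lambda>x. c)"
proof (induction k arbitrary: c)
  case (Suc k)
  then show ?case by (intro C_k_on_SucI[where f' = "\<lambda>x v. 0"]) auto
qed (simp add: continuous_on_const)

lemma C_k_on_add:
  assumes "C_k_on k UNIV f" "C_k_on k UNIV g"
  shows "C_k_on k UNIV (\<lambda>x. f x + g x)"
  using assms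
proof (induction k arbitrary: f g)
  case (Suc k)
  show ?case
    by (rule C_k_on_SucI[OF has_derivative_add[OF Suc.prems(1)[THEN C_k_on_Suc_derivative]
            Suc.prems(2)[THEN C_k_on_Suc_derivative]]])
      (rule Suc.IH, use Suc.prems in simp_all)
qed (simp add: continuous_on_add)

lemma C_k_on_mult:
  fixes f g :: "'a::real_normed_vector \<Rightarrow> real"
  assumes "C_k_on k UNIV f" "C_k_on k UNIV g"
  shows "C_k_on k UNIV (\<lambda>x. f x * g x)"
  using assms
proof (induction k arbitrary: f g)
  case (Suc k)
  note prems = Suc.prems
  show ?case
  proof (rule C_k_on_SucI[OF has_derivative_mult[OF prems(1)[THEN C_k_on_Suc_derivative]
            prems(2)[THEN C_k_on_Suc_derivative]]])
    fix v
    show "C_k_on k UNIV (\<lambda>x. f x * frechet_derivative g (at x) v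
        + frechet_derivative f (at x) v * g x)"
      using prems C_k_on_Suc_imp[OF prems(1)] C_k_on_Suc_imp[OF prems(2)]
      by (intro C_k_on_add Suc.IH) auto
  qed
qed (simp add: continuous_on_mult)

text \<open>The outer function lives on the reals, so its derivative at \<open>p x\<close> is
  multiplication by a number. The chain rule thus yields a product, to which
  \<open>C_k_on_mult\<close> and the induction hypothesis for the derivative of \<open>f\<close>
  apply.\<close>

lemma C_k_on_compose:
  fixes f :: "real \<Rightarrow> real" and p :: "'a::real_normed_vector \<Rightarrow> real"
  assumes "C_k_on k UNIV f" "C_k_on k UNIV p"
  shows "C_k_on k UNIV (\<lambda>x. f (p x))"
  using assms
proof (induction k arbitrary: f)
  case 0
  then show ?case
    by (auto intro!: continuous_on_compose2[of UNIV f])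
next
  case (Suc k)
  note prems = Suc.prems
  show ?case
  proof (rule C_k_on_SucI)
    fix x
    show "((\<lambda>x. f (p x)) has_derivative
        (\<lambda>v. frechet_derivative f (at (p x)) (frechet_derivative p (at x) v))) (at x)"
      by (rule has_derivative_compose[OF C_k_on_Suc_derivative[OF prems(2)]
            C_k_on_Suc_derivative[OF prems(1)]])
  next
    fix v
    have "frechet_derivative f (at (p x)) (frechet_derivative p (at x) v)
        = frechet_derivative p (at x) v * frechet_derivative f (at (p x)) 1" for x
      using linear_scale[OF has_derivative_linear[OF C_k_on_Suc_derivative[OF prems(1), of "p x"]],
          of "frechet_derivative p (at x) v" 1]
      by simp
    moreover have "C_k_on k UNIV
        (\<lambda>x. frechet_derivative p (at x) v * frechet_derivative f (at (p x)) 1)"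
    proof (rule C_k_on_mult)
      show "C_k_on k UNIV (\<lambda>x. frechet_derivative p (at x) v)"
        using prems(2) by simp
      show "C_k_on k UNIV (\<lambda>x. frechet_derivative f (at (p x)) 1)"
        by (rule Suc.IH[OF _ C_k_on_Suc_imp[OF prems(2)]]) (use prems(1) in simp)
    qed
    ultimately show "C_k_on k UNIV
        (\<lambda>x. frechet_derivative f (at (p x)) (frechet_derivative p (at x) v))"
      by simp
  qed
qed

lemma C_k_on_linear:
  assumes "bounded_linear f"
  shows "C_k_on k UNIV f"
proof (cases k)
  case (Suc n)
  show ?thesis
    unfolding Suc
    by (rule C_k_on_SucI[OF bounded_linear_imp_has_derivative[OF assms]]) (rule C_k_on_const)
qed (use assms in \<open>simp add: linear_continuous_on\<close>)

lemma C_k_on_prod: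
  fixes f :: "'i \<Rightarrow> 'a::real_normed_vector \<Rightarrow> real"
  assumes "\<And>i. i \<in> I \<Longrightarrow> C_k_on k UNIV (f i)"
  shows "C_k_on k UNIV (\<lambda>x. \<Prod>i\<in>I. f i x)"
  using assms
  by (induction I rule: infinite_finite_induct) (auto intro: C_k_on_const C_k_on_mult)

section \<open>A smooth bump function on a box\<close>

definition exp_flat :: "nat \<Rightarrow> real \<Rightarrow> real"
  where "exp_flat j s = (if 0 < s then exp (- 1 / s) / s ^ j else 0)"

lemma exp_flat_tendsto_0: "(exp_flat j \<longlongrightarrow> 0) (at 0)"
proof (rule filterlim_split_at)
  show "(exp_flat j \<longlongrightarrow> 0) (at_left 0)"
    by (rule tendsto_eventually) (auto simp: eventually_at_filter exp_flat_def)
  have "((\<lambda>s. inverse s ^ j / exp (inverse s)) \<longlongrightarrow> (0::real)) (at_right 0)"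
    by (rule filterlim_compose[OF tendsto_power_div_exp_0 filterlim_inverse_at_top_right])
  then show "(exp_flat j \<longlongrightarrow> 0) (at_right 0)"
    by (rule Lim_transform_eventually)
      (auto simp: eventually_at_filter exp_flat_def field_simps exp_minus)
qed

text \<open>The powers of \<open>s\<close> in the denominator close the family under
  differentiation, which is what the induction in \<open>C_k_on_exp_flat\<close> needs. At
  \<open>s = 0\<close> the difference quotient of \<open>exp_flat j\<close> is
  \<open>exp_flat (Suc j)\<close>, which tends to 0.\<close>

lemma exp_flat_has_derivative:
  "(exp_flat j has_real_derivative (exp_flat (j + 2) s - real j * exp_flat (j + 1) s)) (at s)"
proof -
  consider "s < 0" | "s = 0" | "0 < s" by linarith
  then show ?thesis
  proof cases
    case 1
    have "((\<lambda>s. 0) has_real_derivative (exp_flat (j + 2) s - real j * exp_flat (j + 1) s)) (at s)"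
      using 1 by (simp add: exp_flat_def)
    then show ?thesis
      by (rule has_field_derivative_transform_within_open[where S = "{..<0}"])
        (use 1 in \<open>auto simp: exp_flat_def\<close>)
  next
    case 2
    have "((\<lambda>h. (exp_flat j (0 + h) - exp_flat j 0) / h) \<longlongrightarrow> 0) (at 0)"
      by (rule Lim_transform_eventually[OF exp_flat_tendsto_0[of "Suc j"]])
        (auto simp: eventually_at_filter exp_flat_def field_simps)
    then show ?thesis
      using 2 by (simp add: DERIV_def exp_flat_def)
  next
    case 3
    have "((\<lambda>s. exp (- 1 / s) * inverse s ^ j) has_real_derivative
        (exp_flat (j + 2) s - real j * exp_flat (j + 1) s)) (at s)"
      using 3
      apply (auto intro!: derivative_eq_intros simp: exp_flat_def)
      apply (cases j)
       apply (auto simp: field_simps power2_eq_square)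
      done
    then show ?thesis
      by (rule has_field_derivative_transform_within_open[where S = "{0<..}"])
        (use 3 in \<open>auto simp: exp_flat_def field_simps\<close>)
  qed
qed

lemma C_k_on_exp_flat: "C_k_on k UNIV (exp_flat j)"
proof (induction k arbitrary: j)
  case 0
  have "isCont (exp_flat j) x" for x
    using exp_flat_has_derivative by (rule DERIV_isCont)
  then show ?case by (simp add: continuous_at_imp_continuous_on)
next
  case (Suc k)
  show ?case
  proof (rule C_k_on_SucI)
    show "(exp_flat j has_derivative (\<lambda>v. (exp_flat (j + 2) x + - real j * exp_flat (j + 1) x) * v)) (at x)" for x
      using exp_flat_has_derivative[of j x] by (simp add: has_field_derivative_def)
    show "C_k_on k UNIV (\<lambda>x. (exp_flat (j + 2) x + - real j * exp_flat (j + 1) x) * v)" for v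
      by (intro C_k_on_mult C_k_on_add C_k_on_const Suc.IH)
  qed
qed

text \<open>The parameter \<open>r\<close> sharpens the bump: on the open box each factor is
  \<open>exp (- 1 / (r * c))\<close> for some \<open>c > 0\<close> and tends to 1 as
  \<open>r\<close> grows.\<close>

definition bump :: "real^'n::finite \<Rightarrow> real^'n \<Rightarrow> real \<Rightarrow> real^'n \<Rightarrow> real"
  where "bump a b r x = (\<Prod>i\<in>UNIV. exp_flat 0 (r * ((x $ i - a $ i) * (b $ i - x $ i))))"

lemma smooth_on_bump:
  fixes a b :: "real^'n::finite"
  shows "smooth_on UNIV (bump a b r)"
proof -
  have coord: "C_k_on k UNIV (\<lambda>x::real^'n. x $ i)" for k i
    by (rule C_k_on_linear) (rule bounded_linear_vec_nth)
  have "C_k_on k UNIV (\<lambda>x. r * ((x $ i + - a $ i) * (b $ i + - 1 * x $ i)))" for k and i :: 'n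
    by (intro C_k_on_mult C_k_on_add C_k_on_const coord)
  then have "C_k_on k UNIV (\<lambda>x. r * ((x $ i - a $ i) * (b $ i - x $ i)))" for k and i :: 'n
    by simp
  then have "C_k_on k UNIV (\<lambda>x. \<Prod>i\<in>UNIV. exp_flat 0 (r * ((x $ i - a $ i) * (b $ i - x $ i))))" for k
    by (intro C_k_on_prod C_k_on_compose[where f = "exp_flat 0", OF C_k_on_exp_flat])
  then show ?thesis
    by (simp add: smooth_on_def bump_def[abs_def])
qed

lemma exp_flat_0_bounds: "0 \<le> exp_flat 0 s" "exp_flat 0 s \<le> 1"
  by (auto simp: exp_flat_def)

lemma bump_bounds: "0 \<le> bump a b r x" "bump a b r x \<le> 1"
  unfolding bump_def by (auto intro!: prod_nonneg prod_le_1 simp: exp_flat_0_bounds)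

text \<open>If \<open>b $ i < a $ i\<close>, both differences could be negative and their product
  positive; the assumption on \<open>a\<close> and \<open>b\<close> excludes this.\<close>

lemma bump_eq_0:
  assumes "\<And>i. a $ i \<le> b $ i" "0 \<le> r" "x \<notin> box a b"
  shows "bump a b r x = 0"
proof -
  obtain i where i: "\<not> (a $ i < x $ i \<and> x $ i < b $ i)"
    using assms(3) by (auto simp: mem_box_cart)
  then have "(x $ i - a $ i) * (b $ i - x $ i) \<le> 0"
    using assms(1)[of i] by (smt (verit) mult_nonneg_nonpos mult_nonpos_nonneg)
  then have "r * ((x $ i - a $ i) * (b $ i - x $ i)) \<le> 0"
    by (rule mult_nonneg_nonpos[OF assms(2)])
  then have "exp_flat 0 (r * ((x $ i - a $ i) * (b $ i - x $ i))) = 0"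
    by (simp add: exp_flat_def)
  then show ?thesis by (auto simp: bump_def)
qed

lemma bump_pos:
  assumes "0 < r" "x \<in> box a b"
  shows "0 < bump a b r x"
  unfolding bump_def using assms
  by (intro prod_pos) (auto simp: exp_flat_def mem_box_cart)

lemma bump_tendsto_indicator:
  fixes a b x :: "real^'n::finite"
  assumes "\<And>i. a $ i \<le> b $ i"
  shows "(\<lambda>n. bump a b (real n) x) \<longlonglongrightarrow> indicator (box a b) x"
proof (cases "x \<in> box a b")
  case True
  have "(\<lambda>n. exp_flat 0 (real n * c)) \<longlonglongrightarrow> 1" if "0 < c" for c
  proof -
    have "(\<lambda>n. exp (- (inverse c) * (1 / real n))) \<longlonglongrightarrow> exp (- (inverse c) * 0)"
      by (intro tendsto_intros lim_1_over_n)
    then have "(\<lambda>n. exp (- (inverse c) * (1 / real n))) \<longlonglongrightarrow> 1" by simp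
    then show ?thesis
      by (rule Lim_transform_eventually)
        (use that in \<open>auto simp: exp_flat_def field_simps eventually_at_top_linorder intro!: exI[of _ 1]\<close>)
  qed
  then have "(\<lambda>n. bump a b (real n) x) \<longlonglongrightarrow> (\<Prod>i\<in>(UNIV :: 'n set). 1)"
    unfolding bump_def using True by (intro tendsto_prod) (auto simp: mem_box_cart)
  then show ?thesis using True by simp
next
  case False
  then show ?thesis using bump_eq_0[OF assms] by simp
qed

lemma test_function_bump:
  assumes "\<And>i. a $ i \<le> b $ i" "0 \<le> r" "cbox a b \<subseteq> W"
  shows "test_function W (bump a b r)"
  unfolding test_function_def
  using smooth_on_bump bump_eq_0[OF assms(1,2)] assms(3) box_subset_cbox[of a b]
  by (intro conjI exI[of _ "cbox a b"]) (blast intro: compact_cbox)+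

lemma test_function_continuous:
  assumes "test_function W \<psi>"
  shows "continuous_on UNIV \<psi>"
proof -
  have "C_k_on 0 UNIV \<psi>"
    using assms unfolding test_function_def smooth_on_def by blast
  then show ?thesis by simp
qed

lemma test_function_derivative:
  assumes "test_function W \<psi>"
  shows "(\<psi> has_derivative frechet_derivative \<psi> (at x)) (at x)"
    and "continuous_on UNIV (\<lambda>x. frechet_derivative \<psi> (at x) v)"
proof -
  have "C_k_on (Suc 0) UNIV \<psi>"
    using assms by (simp add: test_function_def smooth_on_def del: C_k_on.simps)
  then show "(\<psi> has_derivative frechet_derivative \<psi> (at x)) (at x)"
    "continuous_on UNIV (\<lambda>x. frechet_derivative \<psi> (at x) v)"
    by (simp_all add: frechet_derivative_works)
qed

section \<open>Weak derivatives\<close>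

text \<open>Only continuity and vanishing off \<open>K\<close> are asked of \<open>\<psi>\<close>,
  so that the lemma covers a test function and its partial derivatives alike.\<close>

lemma locally_integrable_on_mult_bounded:
  assumes h: "locally_integrable_on W h" and K: "compact K" "K \<subseteq> W"
    and \<psi>: "continuous_on UNIV \<psi>" "\<And>x. x \<notin> K \<Longrightarrow> \<psi> x = 0"
  shows "set_integrable lborel W (\<lambda>x. h x * \<psi> x)"
proof -
  have hK: "integrable lborel (\<lambda>x. indicator K x * h x)"
    using h K unfolding locally_integrable_on_def set_integrable_def by simp
  have "compact (\<psi> ` K)"
    using \<psi>(1) K(1) by (meson compact_continuous_image continuous_on_subset subset_UNIV)
  then obtain B where B: "\<And>x. x \<in> K \<Longrightarrow> \<bar>\<psi> x\<bar> \<le> B"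
    using compact_imp_bounded[of "\<psi> ` K"] by (auto simp: bounded_iff)
  have [measurable]: "\<psi> \<in> borel_measurable borel"
    using \<psi>(1) by (rule borel_measurable_continuous_onI)
  have "integrable lborel (\<lambda>x. \<psi> x * (indicator K x * h x))"
  proof (rule Bochner_Integration.integrable_bound[OF integrable_mult_right[OF hK, of B]])
    show "(\<lambda>x. \<psi> x * (indicator K x * h x)) \<in> borel_measurable lborel"
      by (rule borel_measurable_times[OF _ borel_measurable_integrable[OF hK]]) simp
    show "AE x in lborel. norm (\<psi> x * (indicator K x * h x)) \<le> norm (B * (indicator K x * h x))"
    proof (intro AE_I2)
      fix x
      show "norm (\<psi> x * (indicator K x * h x)) \<le> norm (B * (indicator K x * h x))"
        using B[of x] by (auto simp: indicator_def abs_mult intro!: mult_right_mono)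
    qed
  qed
  moreover have "\<psi> x * (indicator K x * h x) = indicator W x *\<^sub>R (h x * \<psi> x)" for x
    using K(2) \<psi>(2)[of x] by (auto simp: indicator_def)
  ultimately show ?thesis by (simp add: set_integrable_def)
qed

section \<open>The fundamental lemma of the calculus of variations\<close>

lemma integral_box_eq_0:
  assumes h: "locally_integrable_on W h"
    and zero: "\<And>\<psi>. test_function W \<psi> \<Longrightarrow> (LINT x:W|lborel. h x * \<psi> x) = 0"
    and ab: "cbox a b \<subseteq> W"
  shows "(LINT x:box a b|lborel. h x) = 0"
proof (cases "\<forall>i. a $ i \<le> b $ i")
  case False
  then have "box a b = {}" by (meson mem_box_cart(1) equals0I less_imp_le order.trans)
  then show ?thesis by (simp add: set_lebesgue_integral_def)
next
  case True
  have hK: "integrable lborel (\<lambda>x. indicator (cbox a b) x * h x)"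
    using h ab unfolding locally_integrable_on_def set_integrable_def by simp
  have eq: "indicator W x *\<^sub>R (h x * bump a b (real n) x)
      = bump a b (real n) x * (indicator (cbox a b) x * h x)" for n x
    using ab bump_eq_0[of a b "real n" x] True box_subset_cbox[of a b]
    by (auto simp: indicator_def)
  \<comment> \<open>The bumps tend to the indicator of the open box and stay between 0 and 1, so
    \<open>h\<close> cut off to the closed box, where it is integrable, dominates.\<close>
  have "(\<lambda>n. LINT x|lborel. bump a b (real n) x * (indicator (cbox a b) x * h x))
      \<longlonglongrightarrow> (LINT x|lborel. indicator (box a b) x * (indicator (cbox a b) x * h x))"
  proof (rule integral_dominated_convergence[where w = "\<lambda>x. norm (indicator (cbox a b) x * h x)"])
    have hm: "(\<lambda>x. indicator (cbox a b) x * h x) \<in> borel_measurable lborel"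
      using hK by (rule borel_measurable_integrable)
    show "(\<lambda>x. indicator (box a b) x * (indicator (cbox a b) x * h x)) \<in> borel_measurable lborel"
      by (rule borel_measurable_times[OF _ hm]) simp
    show "(\<lambda>x. bump a b (real n) x * (indicator (cbox a b) x * h x)) \<in> borel_measurable lborel" for n
    proof (rule borel_measurable_times[OF _ hm])
      have "continuous_on UNIV (bump a b (real n))"
        by (rule test_function_continuous[OF test_function_bump[OF _ _ ab]]) (use True in auto)
      then show "bump a b (real n) \<in> borel_measurable lborel"
        by (simp add: borel_measurable_continuous_onI)
    qed
    show "integrable lborel (\<lambda>x. norm (indicator (cbox a b) x * h x))"
      using hK by (rule integrable_norm)
    show "AE x in lborel. (\<lambda>n. bump a b (real n) x * (indicator (cbox a b) x * h x))
        \<longlonglongrightarrow> indicator (box a b) x * (indicator (cbox a b) x * h x)"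
      using True by (intro AE_I2 tendsto_mult_right bump_tendsto_indicator) auto
    show "AE x in lborel. norm (bump a b (real n) x * (indicator (cbox a b) x * h x))
        \<le> norm (indicator (cbox a b) x * h x)" for n
      using bump_bounds[of a b "real n"] by (intro AE_I2) (auto simp: abs_mult intro!: mult_left_le_one_le)
  qed
  moreover have "(LINT x|lborel. bump a b (real n) x * (indicator (cbox a b) x * h x)) = 0" for n
    using zero[OF test_function_bump[OF _ _ ab], of "real n"] True
    unfolding set_lebesgue_integral_def eq by simp
  ultimately have "(LINT x|lborel. indicator (box a b) x * (indicator (cbox a b) x * h x)) = 0"
    by (simp add: LIMSEQ_const_iff)
  moreover have "indicator (box a b) x * (indicator (cbox a b) x * h x) = indicator (box a b) x *\<^sub>R h x" for x
    using box_subset_cbox[of a b] by (auto simp: indicator_def)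
  ultimately show ?thesis by (simp add: set_lebesgue_integral_def)
qed

text \<open>The positive and the negative part of \<open>k\<close> are densities of two measures
  that agree, with finite values, on open boxes. These are stable under intersection and generate
  the Borel sets, so the measures are equal, and then so are the densities almost
  everywhere.\<close>

lemma AE_zero_if_integral_boxes_zero:
  fixes k :: "'a::euclidean_space \<Rightarrow> real"
  assumes k: "integrable lborel k"
    and zero: "\<And>c d. (LINT x:box c d|lborel. k x) = 0"
  shows "AE x in lborel. k x = 0"
proof -
  let ?p = "\<lambda>x. ennreal (max 0 (k x))" and ?m = "\<lambda>x. ennreal (max 0 (- k x))"
  have km [measurable]: "k \<in> borel_measurable borel"
    using borel_measurable_integrable[OF k] by simp
  have val: "emeasure (density lborel (\<lambda>x. ennreal (max 0 (u x)))) (box c d)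
      = ennreal (LINT x:box c d|lborel. max 0 (u x))"
    if u: "integrable lborel u" for u :: "'a \<Rightarrow> real" and c d
  proof -
    have um [measurable]: "u \<in> borel_measurable borel"
      using borel_measurable_integrable[OF u] by simp
    have i: "integrable lborel (\<lambda>x. indicator (box c d) x *\<^sub>R max 0 (u x))"
      by (rule Bochner_Integration.integrable_bound[OF u]) (auto simp: indicator_def)
    have "emeasure (density lborel (\<lambda>x. ennreal (max 0 (u x)))) (box c d)
        = (\<integral>\<^sup>+x. ennreal (indicator (box c d) x *\<^sub>R max 0 (u x)) \<partial>lborel)"
      by (subst emeasure_density) (auto intro!: nn_integral_cong simp: indicator_def)
    also have "\<dots> = ennreal (LINT x:box c d|lborel. max 0 (u x))"
      unfolding set_lebesgue_integral_def
      by (rule nn_integral_eq_integral[OF i]) simp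
    finally show ?thesis .
  qed
  have "density lborel ?p = density lborel ?m"
  proof (rule measure_eqI_generator_eq)
    let ?E = "range (\<lambda>(a, b). box a b :: 'a set)"
    show "Int_stable ?E"
      by (auto simp: Int_stable_def box_Int_box)
    show "?E \<subseteq> Pow UNIV" by auto
    show "sets (density lborel ?p) = sigma_sets UNIV ?E"
      "sets (density lborel ?m) = sigma_sets UNIV ?E"
      by (simp_all add: borel_eq_box)
    let ?A = "\<lambda>i::nat. box (- (real i *\<^sub>R One)) (real i *\<^sub>R One) :: 'a set"
    show "range ?A \<subseteq> ?E" by auto
    show "(\<Union>i. ?A i) = UNIV" by (rule UN_box_eq_UNIV)
    show "emeasure (density lborel ?p) (?A i) \<noteq> \<infinity>" for i
      using val[OF k] by simp
    fix X assume "X \<in> ?E"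
    then obtain c d where X: "X = box c d" by auto
    have i: "set_integrable lborel (box c d) (\<lambda>x. max 0 (u x))"
      if u: "integrable lborel u" for u :: "'a \<Rightarrow> real"
      unfolding set_integrable_def
      by (rule Bochner_Integration.integrable_bound[OF u])
        (use borel_measurable_integrable[OF u] in \<open>auto simp: indicator_def\<close>)
    have "(LINT x:box c d|lborel. max 0 (k x)) - (LINT x:box c d|lborel. max 0 (- k x))
        = (LINT x:box c d|lborel. max 0 (k x) - max 0 (- k x))"
      using i[OF k] i[of "\<lambda>x. - k x"] k by (intro set_integral_diff(2)[symmetric]) auto
    also have "(\<lambda>x. max 0 (k x) - max 0 (- k x)) = k" by (auto simp: max_def)
    finally show "emeasure (density lborel ?p) X = emeasure (density lborel ?m) X"
      using zero val[OF k] val[of "\<lambda>x. - k x"] k by (simp add: X)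
  qed
  then have "AE x in lborel. ?p x = ?m x"
    by (intro sigma_finite_measure.density_unique[OF sigma_finite_lborel]) auto
  then show ?thesis
    by eventually_elim (auto simp: max_def split: if_splits)
qed

text \<open>On a closed box inside \<open>W\<close> the function is integrable, and the preceding
  lemmas make it vanish on the interior. The boundary of a box is null, and countably many closed
  boxes exhaust \<open>W\<close>.\<close>

lemma weak_zero_imp_AE_zero:
  fixes h :: "real^'n::finite \<Rightarrow> real"
  assumes W: "open W" and h: "locally_integrable_on W h"
    and zero: "\<And>\<psi>. test_function W \<psi> \<Longrightarrow> (LINT x:W|lborel. h x * \<psi> x) = 0"
  shows "AE x in lborel. x \<in> W \<longrightarrow> h x = 0"
proof -
  have box: "AE x in lborel. x \<in> cbox a b \<longrightarrow> h x = 0" if ab: "cbox a b \<subseteq> W" for a b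
  proof -
    let ?k = "\<lambda>x. indicator (box a b) x *\<^sub>R h x"
    have "set_integrable lborel (cbox a b) h"
      using h ab by (auto simp: locally_integrable_on_def)
    then have "set_integrable lborel (box a b) h"
      by (rule set_integrable_subset) (auto simp: box_subset_cbox)
    then have k: "integrable lborel ?k" by (simp add: set_integrable_def)
    have "(LINT x:box c d|lborel. ?k x) = 0" for c d
    proof -
      \<comment> \<open>With the coordinatewise maximum and minimum of the corners the closed box
        too stays in \<open>cbox a b\<close>, hence in \<open>W\<close>, as
        \<open>integral_box_eq_0\<close> demands.\<close>
      obtain c' d' where cd: "box a b \<inter> box c d = box c' d'" "cbox c' d' \<subseteq> cbox a b"
        by (rule that[of "\<Sum>i\<in>Basis. max (a \<bullet> i) (c \<bullet> i) *\<^sub>R i" "\<Sum>i\<in>Basis. min (b \<bullet> i) (d \<bullet> i) *\<^sub>R i"])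
          (auto simp: box_Int_box mem_box)
      have "(LINT x:box c d|lborel. ?k x) = (LINT x:box c' d'|lborel. h x)"
        unfolding set_lebesgue_integral_def cd(1)[symmetric]
        by (intro Bochner_Integration.integral_cong) (auto simp: indicator_def)
      also have "\<dots> = 0"
        using cd(2) ab by (intro integral_box_eq_0[OF h zero]) auto
      finally show ?thesis .
    qed
    then have 1: "AE x in lborel. ?k x = 0"
      using k by (intro AE_zero_if_integral_boxes_zero) auto
    have "cbox a b - box a b \<in> null_sets lborel"
      using negligible_frontier_interval[of a b]
      by (simp add: negligible_iff_null_sets null_sets_completion_iff)
    then have "AE x in lborel. x \<notin> cbox a b - box a b" by (rule AE_not_in)
    with 1 show ?thesis by eventually_elim auto
  qed
  obtain \<D> where D: "countable \<D>" "\<D> \<subseteq> Pow W" "\<And>X. X \<in> \<D> \<Longrightarrow> \<exists>a b. X = cbox a b" "\<Union>\<D> = W"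
    using open_countable_Union_open_cbox[OF W] by blast
  have "AE x in lborel. x \<in> X \<longrightarrow> h x = 0" if "X \<in> \<D>" for X
    using D(2,3) that box by blast
  then have "AE x in lborel. \<forall>X\<in>\<D>. x \<in> X \<longrightarrow> h x = 0"
    using D(1) by (subst AE_ball_countable) auto
  then show ?thesis
    by eventually_elim (use D(4) in auto)
qed

text \<open>By translation invariance every difference quotient of \<open>P\<close> in direction
  \<open>e\<close> has integral zero. The mean value theorem bounds the quotients by a multiple of
  the indicator of one compact set, so dominated convergence passes to the derivative.\<close>

lemma integral_directional_derivative_eq_0:
  fixes P :: "'a::euclidean_space \<Rightarrow> real"
  assumes der: "\<And>x. (P has_derivative P' x) (at x)"
    and cont: "continuous_on UNIV (\<lambda>x. P' x e)"
    and K: "compact K" and zero: "\<And>x. x \<notin> K \<Longrightarrow> P x = 0"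
  shows "(LINT x|lborel. P' x e) = 0"
proof -
  let ?Q = "\<lambda>x. P' x e"
  have Q0: "?Q x = 0" if "x \<notin> K" for x
  proof -
    have "((\<lambda>x. 0) has_derivative (\<lambda>v. 0)) (at x)" by simp
    then have "(P has_derivative (\<lambda>v. 0)) (at x)"
      by (rule has_derivative_transform_within_open[where s = "- K"])
        (use that K zero in \<open>auto simp: compact_imp_closed\<close>)
    then show ?thesis using der[of x] has_derivative_unique by metis
  qed
  have contP: "continuous_on UNIV P"
    using der by (meson continuous_at_imp_continuous_on has_derivative_continuous)
  have [measurable]: "P \<in> borel_measurable borel" "?Q \<in> borel_measurable borel"
    using contP cont by (auto intro: borel_measurable_continuous_onI)
  have "compact (?Q ` K)"
    using cont K by (meson compact_continuous_image continuous_on_subset subset_UNIV)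
  then obtain B where "\<And>x. x \<in> K \<Longrightarrow> \<bar>?Q x\<bar> \<le> B"
    using compact_imp_bounded[of "?Q ` K"] by (auto simp: bounded_iff)
  then have B: "\<bar>?Q x\<bar> \<le> max 0 B" for x
    using Q0[of x] by (cases "x \<in> K") (auto simp: le_max_iff_disj)
  \<comment> \<open>If \<open>x + t *\<^sub>R e\<close> lies in \<open>K\<close> for some
    \<open>t\<close> in the unit interval, then \<open>x\<close> lies in \<open>K'\<close>. Hence
    the difference quotients with step at most 1 all vanish off \<open>K'\<close>.\<close>
  define K' where "K' = (\<lambda>(x, t). x - t *\<^sub>R e) ` (K \<times> {0..1})"
  have K': "compact K'"
    unfolding K'_def using K
    by (intro compact_continuous_image compact_Times)
      (auto simp: case_prod_unfold intro!: continuous_intros)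
  define t where "t n = 1 / real (Suc n)" for n
  have t: "0 < t n" "t n \<le> 1" for n by (auto simp: t_def)
  have tlim: "t \<longlonglongrightarrow> 0" unfolding t_def by (rule LIMSEQ_Suc[OF lim_1_over_n])
  define s where "s n x = (P (t n *\<^sub>R e + x) - P x) / t n" for n x
  have line: "((\<lambda>r. P (r *\<^sub>R e + x)) has_real_derivative ?Q (r *\<^sub>R e + x)) (at r)" for r x
  proof -
    have "((\<lambda>r. P (r *\<^sub>R e + x)) has_derivative (\<lambda>v. P' (r *\<^sub>R e + x) (v *\<^sub>R e))) (at r)"
      by (rule has_derivative_compose[where g = P, OF _ der]) (auto intro!: derivative_eq_intros)
    moreover have "(\<lambda>v. P' (r *\<^sub>R e + x) (v *\<^sub>R e)) = (*) (?Q (r *\<^sub>R e + x))"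
      using linear_scale[OF has_derivative_linear[OF der]] by (auto simp: mult.commute)
    ultimately show ?thesis by (simp add: has_field_derivative_def)
  qed
  have slim: "(\<lambda>n. s n x) \<longlonglongrightarrow> ?Q x" for x
  proof -
    have "((\<lambda>h. (P (h *\<^sub>R e + x) - P x) / h) \<longlongrightarrow> ?Q x) (at 0)"
      using line[of x 0] by (simp add: DERIV_def)
    then show ?thesis
      unfolding s_def
      by (rule filterlim_compose) (use t tlim in \<open>auto simp: filterlim_at less_imp_neq[symmetric]\<close>)
  qed
  have sB: "\<bar>s n x\<bar> \<le> max 0 B * indicator K' x" for n x
  proof (cases "x \<in> K'")
    case True
    obtain z where "P (t n *\<^sub>R e + x) - P (0 *\<^sub>R e + x) = (t n - 0) * ?Q (z *\<^sub>R e + x)"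
      using MVT2[OF t(1)[of n], of "\<lambda>r. P (r *\<^sub>R e + x)" "\<lambda>r. ?Q (r *\<^sub>R e + x)"] line by blast
    then have "s n x = ?Q (z *\<^sub>R e + x)" using t(1)[of n] by (simp add: s_def)
    then show ?thesis using B True by simp
  next
    case False
    have K'I: "x \<in> K'" if "r *\<^sub>R e + x \<in> K" "0 \<le> r" "r \<le> 1" for r
      unfolding K'_def image_iff using that by (intro bexI[of _ "(r *\<^sub>R e + x, r)"]) auto
    have "x \<notin> K"
      using False K'I[of 0] by auto
    moreover have "t n *\<^sub>R e + x \<notin> K"
      using False K'I[of "t n"] t[of n] by auto
    ultimately show ?thesis using zero by (simp add: s_def)
  qed
  have iP: "integrable lborel P"
  proof -
    have "integrable lborel (\<lambda>x. indicator K x *\<^sub>R P x)"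
      using K contP by (intro borel_integrable_compact) (auto intro: continuous_on_subset)
    moreover have "(\<lambda>x. indicator K x *\<^sub>R P x) = P" using zero by (auto simp: indicator_def fun_eq_iff)
    ultimately show ?thesis by simp
  qed
  have int_s: "(LINT x|lborel. s n x) = 0" for n
  proof -
    have "integrable (distr lborel borel ((+) (t n *\<^sub>R e))) P"
      using iP by (simp add: lborel_distr_plus)
    then have i: "integrable lborel (\<lambda>x. P (t n *\<^sub>R e + x))"
      by (subst (asm) integrable_distr_eq) auto
    have "(LINT x|lborel. P (t n *\<^sub>R e + x)) = (LINT x|distr lborel borel ((+) (t n *\<^sub>R e)). P x)"
      by (subst integral_distr) auto
    then have "(LINT x|lborel. P (t n *\<^sub>R e + x)) = (LINT x|lborel. P x)"
      by (simp add: lborel_distr_plus)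
    then show ?thesis using i iP by (simp add: s_def)
  qed
  have "(\<lambda>n. LINT x|lborel. s n x) \<longlonglongrightarrow> (LINT x|lborel. ?Q x)"
  proof (rule integral_dominated_convergence[where w = "\<lambda>x. max 0 B * indicator K' x"])
    show "integrable lborel (\<lambda>x. max 0 B * indicator K' x :: real)"
      using K' emeasure_bounded_finite[OF compact_imp_bounded[OF K']]
      by (intro integrable_mult_right integrable_real_indicator)
        (auto simp: compact_imp_closed)
    show "s n \<in> borel_measurable lborel" for n unfolding s_def by measurable
  qed (use slim sB in auto)
  then show ?thesis by (simp add: int_s LIMSEQ_const_iff)
qed

text \<open>Integration by parts without boundary term: the product of \<open>F\<close> with a test
  function has compact support in \<open>W\<close>, so its derivative integrates to zero.\<close>

lemma weak_partial_classical:
  fixes F :: "real^'n::finite \<Rightarrow> real"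
  assumes W: "open W"
    and der: "\<And>x. x \<in> W \<Longrightarrow> (F has_derivative F' x) (at x)"
    and cont: "continuous_on W (\<lambda>x. F' x (axis i 1))"
  shows "weak_partial W i F (\<lambda>x. F' x (axis i 1))"
proof -
  let ?e = "axis i 1 :: real^'n"
  have contF: "continuous_on W F"
    using der by (meson continuous_at_imp_continuous_on has_derivative_continuous)
  have loc: "locally_integrable_on W u" if "continuous_on W u" for u :: "real^'n \<Rightarrow> real"
    using that borel_integrable_compact[where f = u]
    by (auto simp: locally_integrable_on_def set_integrable_def intro: continuous_on_subset)
  have "(LINT x:W|lborel. F x * frechet_derivative \<psi> (at x) ?e) = - (LINT x:W|lborel. F' x ?e * \<psi> x)"
    if \<psi>: "test_function W \<psi>" for \<psi>
  proof -
    obtain K where K: "compact K" "K \<subseteq> W" and \<psi>0: "\<And>x. x \<notin> K \<Longrightarrow> \<psi> x = 0"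
      using \<psi> by (auto simp: test_function_def)
    note d\<psi> = test_function_derivative[OF \<psi>]
    have clK: "open (- K)" using K(1) by (simp add: compact_imp_closed open_Compl)
    have d\<psi>0: "frechet_derivative \<psi> (at x) v = 0" if "x \<notin> K" for x v
    proof -
      have "((\<lambda>x. 0) has_derivative (\<lambda>v. 0)) (at x)" by simp
      then have "(\<psi> has_derivative (\<lambda>v. 0)) (at x)"
        by (rule has_derivative_transform_within_open[where s = "- K"])
          (use that clK \<psi>0 in auto)
      then show ?thesis using frechet_derivative_at by metis
    qed
    \<comment> \<open>The product is extended by 0. The open sets \<open>W\<close> and
      \<open>- K\<close> cover the space, and on \<open>- K\<close> the extension is 0, so it
      remains differentiable across the boundary of \<open>W\<close>.\<close>
    define P where "P x = (if x \<in> W then F x * \<psi> x else 0)" for x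
    define P' where "P' x = (\<lambda>v. if x \<in> W then F x * frechet_derivative \<psi> (at x) v + F' x v * \<psi> x else 0)" for x
    have dP: "(P has_derivative P' x) (at x)" for x
    proof (cases "x \<in> W")
      case True
      have "((\<lambda>x. F x * \<psi> x) has_derivative (\<lambda>v. F x * frechet_derivative \<psi> (at x) v + F' x v * \<psi> x)) (at x)"
        by (rule has_derivative_mult[OF der[OF True] d\<psi>(1)])
      then have "(P has_derivative (\<lambda>v. F x * frechet_derivative \<psi> (at x) v + F' x v * \<psi> x)) (at x)"
        by (rule has_derivative_transform_within_open[OF _ W True]) (simp add: P_def)
      then show ?thesis using True by (simp add: P'_def)
    next
      case False
      have "((\<lambda>x. 0) has_derivative (\<lambda>v. 0)) (at x)" by simp
      then have "(P has_derivative (\<lambda>v. 0)) (at x)"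
        by (rule has_derivative_transform_within_open[where s = "- K"])
          (use False K clK \<psi>0 in \<open>auto simp: P_def\<close>)
      then show ?thesis using False by (simp add: P'_def)
    qed
    have cP: "continuous_on UNIV (\<lambda>x. P' x ?e)"
    proof -
      have "continuous_on W (\<lambda>x. F x * frechet_derivative \<psi> (at x) ?e + F' x ?e * \<psi> x)"
        using contF cont continuous_on_subset[OF d\<psi>(2)]
          continuous_on_subset[OF test_function_continuous[OF \<psi>]]
        by (intro continuous_intros) auto
      then have 1: "continuous_on W (\<lambda>x. P' x ?e)"
        by (rule continuous_on_eq) (simp add: P'_def)
      have 2: "continuous_on (- K) (\<lambda>x. P' x ?e)"
        by (rule continuous_on_eq[OF continuous_on_const[of _ 0]]) (auto simp: P'_def \<psi>0 d\<psi>0)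
      have "W \<union> - K = UNIV" using K(2) by auto
      then show ?thesis using continuous_on_open_Un[OF W clK 1 2] by simp
    qed
    have "(LINT x|lborel. P' x ?e) = 0"
      by (rule integral_directional_derivative_eq_0[OF dP cP K(1)])
        (simp add: P_def \<psi>0)
    moreover have "(LINT x|lborel. P' x ?e)
        = (LINT x:W|lborel. F x * frechet_derivative \<psi> (at x) ?e + F' x ?e * \<psi> x)"
      unfolding set_lebesgue_integral_def
      by (intro Bochner_Integration.integral_cong) (auto simp: P'_def indicator_def)
    moreover have "\<dots> = (LINT x:W|lborel. F x * frechet_derivative \<psi> (at x) ?e)
        + (LINT x:W|lborel. F' x ?e * \<psi> x)"
      by (intro set_integral_add locally_integrable_on_mult_bounded[OF _ K] loc contF cont d\<psi>(2)
          test_function_continuous[OF \<psi>] d\<psi>0 \<psi>0)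
    ultimately show ?thesis by simp
  qed
  then show ?thesis
    using loc contF cont by (auto simp: weak_partial_def)
qed

section \<open>Charts and tangent vectors\<close>

lemma linear_real_vec_sum:
  fixes f :: "real^'n::finite \<Rightarrow> 'b::real_vector"
  assumes "linear f"
  shows "f u = (\<Sum>i\<in>UNIV. u $ i *\<^sub>R f (axis i 1))"
proof -
  have "f u = f (\<Sum>i\<in>UNIV. u $ i *\<^sub>R axis i 1)"
    using basis_expansion[of u] by (simp add: scalar_mult_eq_scaleR)
  then show ?thesis
    using assms by (simp add: linear_sum linear_scale)
qed

text \<open>Every matrix on the segment from the identity to \<open>M\<close> is positive definite,
  hence injective, so its determinant is not zero. Starting from the value 1, the determinant cannot
  change sign along the segment.\<close>

lemma det_pos_if_pos_definite:
  fixes M :: "real^'n::finite^'n"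
  assumes pos: "\<And>v. v \<noteq> 0 \<Longrightarrow> 0 < v \<bullet> (M *v v)"
  shows "0 < det M"
proof (rule ccontr)
  assume neg: "\<not> 0 < det M"
  define N where "N t = (\<chi> i j. (1 - t) * mat 1 $ i $ j + t * M $ i $ j)" for t :: real
  have Nv: "N t *v v = (1 - t) *\<^sub>R v + t *\<^sub>R (M *v v)" for t v
  proof -
    have "N t = (1 - t) *\<^sub>R mat 1 + t *\<^sub>R M" by (simp add: N_def vec_eq_iff)
    then show ?thesis
      by (simp add: matrix_vector_mult_add_rdistrib scaleR_matrix_vector_assoc[symmetric])
  qed
  have nz: "det (N t) \<noteq> 0" if t: "t \<in> {0..1}" for t
  proof -
    have "v = 0" if "N t *v v = 0" for v
    proof (rule ccontr)
      assume v: "v \<noteq> 0"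
      have "v \<bullet> (N t *v v) = (1 - t) * (v \<bullet> v) + t * (v \<bullet> (M *v v))"
        by (simp add: Nv inner_add_right)
      moreover have "0 < (1 - t) * (v \<bullet> v) + t * (v \<bullet> (M *v v))"
      proof (cases "t = 0")
        case False
        then show ?thesis using t v pos[OF v] by (intro add_nonneg_pos mult_nonneg_nonneg) auto
      qed (use v in simp)
      ultimately show False using that by simp
    qed
    then have "inj ((*v) (N t))"
      by (intro matrix_left_invertible_injective[THEN iffD1] matrix_left_invertible_ker[THEN iffD2]) auto
    then show ?thesis
      by (metis invertible_det_nz invertible_left_inverse matrix_left_invertible_injective)
  qed
  have N01: "N 0 = mat 1" "N 1 = M" by (simp_all add: N_def vec_eq_iff)
  have "continuous_on {0..1} (\<lambda>t. det (N t))"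
    unfolding det_def N_def by (auto intro!: continuous_intros)
  then obtain t where "0 \<le> t" "t \<le> 1" "det (N t) = 0"
    using IVT2'[of "\<lambda>t. det (N t)" 1 0 0] neg by (auto simp: N01)
  then show False using nz by auto
qed

locale riemannian =
  fixes A :: "('m::{t2_space, second_countable_topology}, 'n::finite) chart set"
    and g :: "('m, 'n) metric_tensor"
  assumes atlas: "smooth_atlas A" and metric: "riemannian_metric A g"
begin

lemma chart_open:
  assumes "c \<in> A"
  shows "open (fst c)" "open (chart_image c)"
  using atlas assms unfolding smooth_atlas_def by blast+

lemma chart_homeomorphism:
  assumes "c \<in> A"
  shows "homeomorphism (fst c) (chart_image c) (snd c) (chart_inv c)"
  using atlas assms unfolding smooth_atlas_def by blast+

lemma chart_inv_in: "c \<in> A \<Longrightarrow> x \<in> chart_image c \<Longrightarrow> chart_inv c x \<in> fst c"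
  and chart_chart_inv: "c \<in> A \<Longrightarrow> x \<in> chart_image c \<Longrightarrow> snd c (chart_inv c x) = x"
  and chart_in: "c \<in> A \<Longrightarrow> p \<in> fst c \<Longrightarrow> snd c p \<in> chart_image c"
  and chart_inv_chart: "c \<in> A \<Longrightarrow> p \<in> fst c \<Longrightarrow> chart_inv c (snd c p) = p"
  and continuous_on_chart: "c \<in> A \<Longrightarrow> continuous_on (fst c) (snd c)"
  and continuous_on_chart_inv: "c \<in> A \<Longrightarrow> continuous_on (chart_image c) (chart_inv c)"
  using chart_homeomorphism[of c] unfolding homeomorphism_def by blast+

lemma chart_covers: obtains c where "c \<in> A" "p \<in> fst c"
  using atlas unfolding smooth_atlas_def by blast

definition overlap :: "('m, 'n) chart \<Rightarrow> ('m, 'n) chart \<Rightarrow> (real^'n) set"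
  where "overlap c c' = snd c ` (fst c \<inter> fst c')"

lemma overlap_eq: "c \<in> A \<Longrightarrow> overlap c c' = chart_image c \<inter> chart_inv c -` fst c'"
proof (intro set_eqI iffI)
  show "x \<in> overlap c c'" if "c \<in> A" "x \<in> chart_image c \<inter> chart_inv c -` fst c'" for x
    unfolding overlap_def using that chart_chart_inv[of c x] chart_inv_in[of c x]
    by (intro image_eqI[where x = "chart_inv c x"]) simp_all
qed (auto simp: overlap_def chart_in chart_inv_chart)

lemma open_overlap:
  assumes "c \<in> A" "c' \<in> A"
  shows "open (overlap c c')"
  unfolding overlap_eq[OF assms(1)]
  using assms by (intro continuous_open_preimage continuous_on_chart_inv chart_open)

lemma chart_in_overlap: "p \<in> fst c \<Longrightarrow> p \<in> fst c' \<Longrightarrow> snd c p \<in> overlap c c'"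
  by (auto simp: overlap_def)

definition dtrans :: "('m, 'n) chart \<Rightarrow> ('m, 'n) chart \<Rightarrow> real^'n \<Rightarrow> real^'n \<Rightarrow> real^'n"
  where "dtrans c c' x = frechet_derivative (transition c c') (at x)"

lemma transition_derivative:
  assumes "c \<in> A" "c' \<in> A" "x \<in> overlap c c'"
  shows "(transition c c' has_derivative dtrans c c' x) (at x)"
proof -
  have "C_k_on (Suc 0) (overlap c c') (transition c c')"
    using atlas assms(1,2) unfolding smooth_atlas_def smooth_on_def overlap_def by blast
  then show ?thesis
    using assms(3) by (simp add: dtrans_def frechet_derivative_works)
qed

lemma continuous_on_dtrans:
  assumes "c \<in> A" "c' \<in> A"
  shows "continuous_on (overlap c c') (\<lambda>x. dtrans c c' x v)"
proof -
  have "C_k_on (Suc 0) (overlap c c') (transition c c')"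
    using atlas assms(1,2) unfolding smooth_atlas_def smooth_on_def overlap_def by blast
  then show ?thesis by (simp add: dtrans_def)
qed

lemma linear_dtrans:
  assumes "c \<in> A" "c' \<in> A" "x \<in> overlap c c'"
  shows "linear (dtrans c c' x)"
  using transition_derivative[OF assms] by (rule has_derivative_linear)

lemma transition_chart: "c \<in> A \<Longrightarrow> p \<in> fst c \<Longrightarrow> transition c c' (snd c p) = snd c' p"
  by (simp add: transition_def chart_inv_chart)

lemma dtrans_self:
  assumes "c \<in> A" "p \<in> fst c"
  shows "dtrans c c (snd c p) v = v"
proof -
  have "((\<lambda>x. x) has_derivative (\<lambda>v. v)) (at (snd c p))" by simp
  then have "(transition c c has_derivative (\<lambda>v. v)) (at (snd c p))"
    by (rule has_derivative_transform_within_open[OF _ chart_open(2)[OF assms(1)]])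
      (use assms in \<open>auto simp: transition_def chart_chart_inv chart_in\<close>)
  then show ?thesis unfolding dtrans_def using frechet_derivative_at by metis
qed

text \<open>The chain rule for the cocycle identity of transition maps. The identity holds only
  where the three charts overlap, so that set must be open around the point.\<close>

lemma dtrans_dtrans:
  assumes c: "c \<in> A" "c' \<in> A" "c'' \<in> A" and p: "p \<in> fst c" "p \<in> fst c'" "p \<in> fst c''"
  shows "dtrans c' c'' (snd c' p) (dtrans c c' (snd c p) v) = dtrans c c'' (snd c p) v"
proof -
  have "(transition c' c'' \<circ> transition c c' has_derivative
      dtrans c' c'' (snd c' p) \<circ> dtrans c c' (snd c p)) (at (snd c p))"
    using c p transition_derivative chart_in_overlap transition_chart
    by (intro diff_chain_at) auto
  then have "(transition c c'' has_derivative
      dtrans c' c'' (snd c' p) \<circ> dtrans c c' (snd c p)) (at (snd c p))"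
  proof (rule has_derivative_transform_within_open)
    show "open (overlap c c' \<inter> overlap c c'')"
      using c by (intro open_Int open_overlap)
    show "snd c p \<in> overlap c c' \<inter> overlap c c''"
      using p by (simp add: chart_in_overlap)
    fix x assume "x \<in> overlap c c' \<inter> overlap c c''"
    then show "(transition c' c'' \<circ> transition c c') x = transition c c'' x"
      using c by (simp add: overlap_eq transition_def chart_inv_chart)
  qed
  then have "dtrans c' c'' (snd c' p) \<circ> dtrans c c' (snd c p) = dtrans c c'' (snd c p)"
    unfolding dtrans_def by (rule frechet_derivative_at)
  then show ?thesis by (metis comp_apply)
qed

text \<open>For \<open>c\<close> in \<open>A\<close> around \<open>p\<close> this inverts the
  evaluation of tangent vectors at \<open>c\<close>, by \<open>tvec_self\<close> and
  \<open>tvec_component\<close>; it reduces questions on \<open>tangent_space A p\<close> to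
  \<open>real^'n\<close>.\<close>

definition tvec :: "('m, 'n) chart \<Rightarrow> 'm \<Rightarrow> real^'n \<Rightarrow> ('m, 'n) tangent"
  where "tvec c p v = (\<lambda>c'. if c' \<in> A \<and> p \<in> fst c' then dtrans c c' (snd c p) v else 0)"

lemma coord_vector_eq: "coord_vector A c i p = tvec c p (axis i 1)"
  by (auto simp: coord_vector_def tvec_def dtrans_def fun_eq_iff)

lemma tvec_in_tangent_space:
  assumes "c \<in> A" "p \<in> fst c"
  shows "tvec c p v \<in> tangent_space A p"
  unfolding tangent_space_def mem_Collect_eq
proof (intro conjI allI ballI impI)
  show "tvec c p v c' = 0" if "\<not> (c' \<in> A \<and> p \<in> fst c')" for c'
    unfolding tvec_def using that by (rule if_not_P)
  fix c1 c2 assume c: "c1 \<in> A" "c2 \<in> A" and p: "p \<in> fst c1 \<inter> fst c2"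
  then have "tvec c p v c2 = dtrans c1 c2 (snd c1 p) (tvec c p v c1)"
    using dtrans_dtrans[OF assms(1) c assms(2)] by (simp add: tvec_def)
  then show "tvec c p v c2 = frechet_derivative (transition c1 c2) (at (snd c1 p)) (tvec c p v c1)"
    by (simp only: dtrans_def)
qed

lemma tvec_self: "c \<in> A \<Longrightarrow> p \<in> fst c \<Longrightarrow> tvec c p v c = v"
  by (simp add: tvec_def dtrans_self)

lemma tvec_component:
  assumes "c \<in> A" "p \<in> fst c" "X \<in> tangent_space A p"
  shows "tvec c p (X c) = X"
proof
  fix c'
  show "tvec c p (X c) c' = X c'"
  proof (cases "c' \<in> A \<and> p \<in> fst c'")
    case True
    then have "X c' = dtrans c c' (snd c p) (X c)"
      using assms unfolding tangent_space_def dtrans_def by blast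
    then show ?thesis using True by (simp add: tvec_def)
  next
    case False
    then have "X c' = 0" using assms(3) unfolding tangent_space_def by blast
    then show ?thesis unfolding tvec_def using False by (simp only: if_False simp_thms)
  qed
qed

lemma tvec_add:
  assumes "c \<in> A" "p \<in> fst c"
  shows "tvec c p (u + v) = (\<lambda>c'. tvec c p u c' + tvec c p v c')"
proof
  fix c'
  show "tvec c p (u + v) c' = (tvec c p u c' + tvec c p v c')"
    using assms linear_add[OF linear_dtrans[OF assms(1) _ chart_in_overlap[OF assms(2)], of c']]
    by (simp add: tvec_def)
qed

lemma tvec_scale:
  assumes "c \<in> A" "p \<in> fst c"
  shows "tvec c p (a *\<^sub>R v) = (\<lambda>c'. a *\<^sub>R tvec c p v c')"
proof
  fix c'
  show "tvec c p (a *\<^sub>R v) c' = (a *\<^sub>R tvec c p v c')"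
    using assms linear_scale[OF linear_dtrans[OF assms(1) _ chart_in_overlap[OF assms(2)], of c']]
    by (simp add: tvec_def)
qed

lemma tvec_change:
  assumes "c \<in> A" "c' \<in> A" "p \<in> fst c" "p \<in> fst c'"
  shows "tvec c p v = tvec c' p (dtrans c c' (snd c p) v)"
proof
  fix c''
  show "tvec c p v c'' = tvec c' p (dtrans c c' (snd c p) v) c''"
    using dtrans_dtrans[OF assms(1,2) _ assms(3,4), of c''] by (simp add: tvec_def)
qed

section \<open>Tangent spaces as inner product spaces\<close>

lemma tangent_space_add:
  assumes "X \<in> tangent_space A p" "Y \<in> tangent_space A p"
  shows "(\<lambda>c. X c + Y c) \<in> tangent_space A p"
proof -
  obtain c where c: "c \<in> A" "p \<in> fst c" by (rule chart_covers)
  have "(\<lambda>c. X c + Y c) = tvec c p (X c + Y c)"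
    unfolding tvec_add[OF c] tvec_component[OF c assms(1)] tvec_component[OF c assms(2)] ..
  then show ?thesis using tvec_in_tangent_space[OF c] by metis
qed

lemma tangent_space_scale:
  assumes "X \<in> tangent_space A p"
  shows "(\<lambda>c. a *\<^sub>R X c) \<in> tangent_space A p"
proof -
  obtain c where c: "c \<in> A" "p \<in> fst c" by (rule chart_covers)
  have "(\<lambda>c. a *\<^sub>R X c) = tvec c p (a *\<^sub>R X c)"
    unfolding tvec_scale[OF c] tvec_component[OF c assms] ..
  then show ?thesis using tvec_in_tangent_space[OF c] by metis
qed

lemma tangent_space_zero: "(\<lambda>c. 0) \<in> tangent_space A p"
proof -
  obtain c where c: "c \<in> A" "p \<in> fst c" by (rule chart_covers)
  show ?thesis
    using tangent_space_scale[OF tvec_in_tangent_space[OF c], of 0] by simp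
qed

lemma tangent_space_lincomb:
  assumes "X \<in> tangent_space A p" "Y \<in> tangent_space A p"
  shows "(\<lambda>c. a *\<^sub>R X c + b *\<^sub>R Y c) \<in> tangent_space A p"
  using tangent_space_add[OF tangent_space_scale[OF assms(1)] tangent_space_scale[OF assms(2)]] .

lemma inner_sym: "X \<in> tangent_space A p \<Longrightarrow> Y \<in> tangent_space A p \<Longrightarrow> g p X Y = g p Y X"
  and inner_add: "X \<in> tangent_space A p \<Longrightarrow> Y \<in> tangent_space A p \<Longrightarrow> Z \<in> tangent_space A p \<Longrightarrow>
    g p (\<lambda>c. X c + Y c) Z = g p X Z + g p Y Z"
  and inner_scale: "X \<in> tangent_space A p \<Longrightarrow> Y \<in> tangent_space A p \<Longrightarrow>
    g p (\<lambda>c. a *\<^sub>R X c) Y = a * g p X Y"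
  and inner_pos: "X \<in> tangent_space A p \<Longrightarrow> X \<noteq> (\<lambda>c. 0) \<Longrightarrow> 0 < g p X X"
  using metric unfolding riemannian_metric_def inner_product_on_def by blast+

lemma inner_lincomb:
  assumes "X \<in> tangent_space A p" "Y \<in> tangent_space A p" "Z \<in> tangent_space A p"
  shows "g p (\<lambda>c. a *\<^sub>R X c + b *\<^sub>R Y c) Z = a * g p X Z + b * g p Y Z"
  using assms by (simp add: inner_add inner_scale tangent_space_scale)

lemma inner_zero: "Y \<in> tangent_space A p \<Longrightarrow> g p (\<lambda>c. 0) Y = 0"
  using inner_scale[of Y p Y 0] by simp

lemma inner_nonneg:
  assumes "X \<in> tangent_space A p"
  shows "0 \<le> g p X X"
  using inner_pos[OF assms] inner_zero[OF assms] by fastforce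

text \<open>The pointwise source of everything quadratic about the energy: the bound
  \<open>norm_lincomb_le\<close> and the identity in \<open>energy_segment\<close> both come from
  this expansion.\<close>

lemma norm_lincomb:
  assumes X: "X \<in> tangent_space A p" and Y: "Y \<in> tangent_space A p"
  shows "g p (\<lambda>c. a *\<^sub>R X c + b *\<^sub>R Y c) (\<lambda>c. a *\<^sub>R X c + b *\<^sub>R Y c)
    = a\<^sup>2 * g p X X + 2 * a * b * g p X Y + b\<^sup>2 * g p Y Y"
proof -
  let ?Z = "\<lambda>c. a *\<^sub>R X c + b *\<^sub>R Y c"
  have Z: "?Z \<in> tangent_space A p" by (rule tangent_space_lincomb[OF X Y])
  have "g p X ?Z = a * g p X X + b * g p X Y" "g p Y ?Z = a * g p X Y + b * g p Y Y"
    using inner_lincomb[OF X Y X, of a b] inner_lincomb[OF X Y Y, of a b]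
      inner_sym[OF X Z] inner_sym[OF Y Z] inner_sym[OF X Y] by auto
  then show ?thesis
    using inner_lincomb[OF X Y Z, of a b] by (simp add: algebra_simps power2_eq_square)
qed

lemma tangent_norm_sq: "X \<in> tangent_space A p \<Longrightarrow> (tangent_norm g p X)\<^sup>2 = g p X X"
  by (simp add: tangent_norm_def inner_nonneg)

section \<open>The metric in coordinates\<close>

lemma inner_tvec_left:
  assumes c: "c \<in> A" "x \<in> chart_image c" and Y: "Y \<in> tangent_space A (chart_inv c x)"
  shows "g (chart_inv c x) (tvec c (chart_inv c x) u) Y
    = (\<Sum>i\<in>UNIV. u $ i * g (chart_inv c x) (coord_vector A c i (chart_inv c x)) Y)"
proof -
  note p = c(1) chart_inv_in[OF c]
  have "linear (\<lambda>u. g (chart_inv c x) (tvec c (chart_inv c x) u) Y)"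
    using Y by (intro linearI)
      (simp_all add: tvec_add[OF p] tvec_scale[OF p] inner_add inner_scale tvec_in_tangent_space[OF p])
  from linear_real_vec_sum[OF this, of u] show ?thesis
    by (simp add: coord_vector_eq)
qed

lemma inner_tvec:
  assumes c: "c \<in> A" "x \<in> chart_image c"
  shows "g (chart_inv c x) (tvec c (chart_inv c x) u) (tvec c (chart_inv c x) v)
    = u \<bullet> (gram A g c x *v v)"
proof -
  note p = c(1) chart_inv_in[OF c]
  note t = tvec_in_tangent_space[OF p]
  have "g (chart_inv c x) (coord_vector A c i (chart_inv c x)) (tvec c (chart_inv c x) v)
      = (gram A g c x *v v) $ i" for i
  proof -
    have "g (chart_inv c x) (coord_vector A c i (chart_inv c x)) (tvec c (chart_inv c x) v)
        = g (chart_inv c x) (tvec c (chart_inv c x) v) (coord_vector A c i (chart_inv c x))"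
      unfolding coord_vector_eq by (rule inner_sym[OF t t])
    also have "\<dots> = (\<Sum>j\<in>UNIV. v $ j * g (chart_inv c x) (coord_vector A c j (chart_inv c x)) (coord_vector A c i (chart_inv c x)))"
      by (rule inner_tvec_left[OF c]) (simp add: coord_vector_eq t)
    also have "\<dots> = (gram A g c x *v v) $ i"
      by (auto simp: matrix_vector_mult_def gram_def coord_vector_eq mult.commute
          intro!: sum.cong inner_sym t)
    finally show ?thesis .
  qed
  then show ?thesis
    using inner_tvec_left[OF c t, of u v] by (simp add: inner_vec_def)
qed

lemma gram_pos:
  assumes c: "c \<in> A" "x \<in> chart_image c" and v: "v \<noteq> 0"
  shows "0 < v \<bullet> (gram A g c x *v v)"
proof -
  note p = c(1) chart_inv_in[OF c]
  have "tvec c (chart_inv c x) v \<noteq> (\<lambda>c. 0)"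
    using v tvec_self[OF p, of v] by metis
  then show ?thesis
    using inner_pos[OF tvec_in_tangent_space[OF p]] by (simp add: inner_tvec[OF c, symmetric])
qed

lemma det_gram_pos: "c \<in> A \<Longrightarrow> x \<in> chart_image c \<Longrightarrow> 0 < det (gram A g c x)"
  by (intro det_pos_if_pos_definite gram_pos)

lemma continuous_on_gram:
  assumes "c \<in> A"
  shows "continuous_on (chart_image c) (\<lambda>x. gram A g c x $ i $ j)"
proof -
  have "C_k_on 0 (chart_image c) (gram A g c)"
    using metric assms unfolding riemannian_metric_def smooth_on_def by blast
  then show ?thesis by (auto intro!: continuous_intros)
qed

lemma continuous_on_det_gram:
  assumes "c \<in> A"
  shows "continuous_on (chart_image c) (\<lambda>x. det (gram A g c x))"
  unfolding det_def by (intro continuous_intros continuous_on_gram assms)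

text \<open>The Gram matrix pulls back as \<open>transpose J ** G ** J\<close> with the Jacobian
  matrix \<open>J\<close>. After taking square roots, the factor is the absolute value of
  \<open>det J\<close>, precisely the one in the substitution rule.\<close>

lemma det_gram_transition:
  assumes c: "c \<in> A" "c' \<in> A" and x: "x \<in> overlap c c'"
  shows "det (gram A g c x) = (det (matrix (dtrans c c' x)))\<^sup>2 * det (gram A g c' (transition c c' x))"
proof -
  let ?J = "matrix (dtrans c c' x)" and ?y = "transition c c' x"
  define p where "p = chart_inv c x"
  have xc: "x \<in> chart_image c" and p: "p \<in> fst c" "p \<in> fst c'"
    using x c chart_inv_in by (auto simp: overlap_eq p_def)
  have y: "?y \<in> chart_image c'" "chart_inv c' ?y = p" "snd c p = x"
    using c p xc by (auto simp: transition_def p_def[symmetric] chart_in chart_inv_chart)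
      (simp add: p_def chart_chart_inv)
  have J: "?J *v v = dtrans c c' x v" for v
    using matrix_works[of "dtrans c c' x" v] linear_dtrans[OF c x]
    by (simp add: linear_matrix_vector_mul_eq)
  have adj: "(?J *v u) \<bullet> w = u \<bullet> (transpose ?J *v w)" for u w
    using dot_lmul_matrix[of w ?J u] by (simp add: transpose_matrix_vector inner_commute)
  have "gram A g c x = transpose ?J ** gram A g c' ?y ** ?J"
  proof -
    have "u \<bullet> (gram A g c x *v v) = u \<bullet> ((transpose ?J ** gram A g c' ?y ** ?J) *v v)" for u v
    proof -
      have "u \<bullet> (gram A g c x *v v) = g p (tvec c p u) (tvec c p v)"
        using inner_tvec[OF c(1) xc] by (simp add: p_def)
      also have "\<dots> = g p (tvec c' p (?J *v u)) (tvec c' p (?J *v v))"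
        using tvec_change[OF c p] by (simp add: J y)
      also have "\<dots> = (?J *v u) \<bullet> (gram A g c' ?y *v (?J *v v))"
        using inner_tvec[OF c(2) y(1)] by (simp add: y)
      also have "\<dots> = u \<bullet> ((transpose ?J ** gram A g c' ?y ** ?J) *v v)"
        by (simp add: adj matrix_vector_mul_assoc[symmetric])
      finally show ?thesis .
    qed
    then have "gram A g c x *v v = (transpose ?J ** gram A g c' ?y ** ?J) *v v" for v
      by (metis vector_eq_ldot)
    then show ?thesis by (simp add: matrix_eq)
  qed
  then show ?thesis
    by (simp add: det_mul det_transpose power2_eq_square)
qed

text \<open>Cramer's formula for the solution \<open>v\<close> of
  \<open>gram A g c x *v v = b\<close>, that is, the vector dual to the covector \<open>b\<close>.
  In terms of determinants its continuity and measurability in \<open>x\<close> can be read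
  off.\<close>

definition raise_index :: "('m, 'n) chart \<Rightarrow> real^'n \<Rightarrow> real^'n \<Rightarrow> real^'n"
  where "raise_index c x b
    = (\<chi> k. det (\<chi> i j. if j = k then b $ i else gram A g c x $ i $ j) / det (gram A g c x))"

lemma gram_raise_index:
  assumes "c \<in> A" "x \<in> chart_image c"
  shows "gram A g c x *v v = b \<longleftrightarrow> v = raise_index c x b"
  unfolding raise_index_def using cramer[of "gram A g c x" v b] det_gram_pos[OF assms] by simp

text \<open>A weak gradient is specified only through its products with the coordinate vectors. The
  Gram matrix is invertible, so these products determine the vector and its norm.\<close>

lemma norm_eq_raise_index:
  assumes c: "c \<in> A" "x \<in> chart_image c" and X: "X \<in> tangent_space A (chart_inv c x)"
  defines "b \<equiv> (\<chi> i. g (chart_inv c x) X (coord_vector A c i (chart_inv c x)))"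
  shows "g (chart_inv c x) X X = raise_index c x b \<bullet> b"
    and "X = tvec c (chart_inv c x) (raise_index c x b)"
proof -
  note p = c(1) chart_inv_in[OF c]
  have Xt: "X = tvec c (chart_inv c x) (X c)"
    using tvec_component[OF p X] by simp
  have "gram A g c x *v X c = b"
  proof -
    have "(gram A g c x *v X c) $ i = b $ i" for i
    proof -
      have "b $ i = g (chart_inv c x) (coord_vector A c i (chart_inv c x)) X"
        unfolding b_def coord_vector_eq using inner_sym[OF X tvec_in_tangent_space[OF p]] by simp
      also have "\<dots> = axis i 1 \<bullet> (gram A g c x *v X c)"
        unfolding coord_vector_eq by (subst Xt) (rule inner_tvec[OF c])
      finally show ?thesis by (simp add: inner_axis')
    qed
    then show ?thesis by (simp add: vec_eq_iff)
  qed
  then have r: "X c = raise_index c x b" using gram_raise_index[OF c] by simp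
  show "X = tvec c (chart_inv c x) (raise_index c x b)" using Xt r by simp
  have "g (chart_inv c x) X X = X c \<bullet> (gram A g c x *v X c)"
    by (subst (1 2) Xt) (rule inner_tvec[OF c])
  then show "g (chart_inv c x) X X = raise_index c x b \<bullet> b"
    using \<open>gram A g c x *v X c = b\<close> r by simp
qed

lemma inner_tvec_raise_index:
  assumes c: "c \<in> A" "x \<in> chart_image c"
  shows "g (chart_inv c x) (tvec c (chart_inv c x) (raise_index c x b)) (tvec c (chart_inv c x) v) = b \<bullet> v"
proof -
  note p = c(1) chart_inv_in[OF c]
  have "g (chart_inv c x) (tvec c (chart_inv c x) (raise_index c x b)) (tvec c (chart_inv c x) v)
      = v \<bullet> (gram A g c x *v raise_index c x b)"
    using inner_sym[OF tvec_in_tangent_space[OF p] tvec_in_tangent_space[OF p]]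
    by (simp add: inner_tvec[OF c])
  also have "gram A g c x *v raise_index c x b = b"
    using gram_raise_index[OF c] by simp
  finally show ?thesis by (simp add: inner_commute)
qed

lemma continuous_on_raise_index:
  assumes "c \<in> A" and "\<And>i. continuous_on (chart_image c) (\<lambda>x. b x $ i)"
  shows "continuous_on (chart_image c) (\<lambda>x. raise_index c x (b x) $ k)"
proof -
  have entry: "continuous_on (chart_image c)
      (\<lambda>x. (\<chi> i j. if j = k then b x $ i else gram A g c x $ i $ j) $ i $ j)" for i j
    using assms continuous_on_gram by (cases "j = k") simp_all
  then have "continuous_on (chart_image c)
      (\<lambda>x. det (\<chi> i j. if j = k then b x $ i else gram A g c x $ i $ j))"
    unfolding det_def
    by (intro continuous_on_sum continuous_on_mult continuous_on_prod continuous_on_const entry)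
  then show ?thesis
    unfolding raise_index_def vec_lambda_beta
    using det_gram_pos[OF assms(1)] continuous_on_det_gram[OF assms(1)]
    by (intro continuous_on_divide) force+
qed

end

section \<open>The Riemannian volume\<close>

lemma suminf_swap_ennreal:
  fixes f :: "nat \<Rightarrow> nat \<Rightarrow> ennreal"
  shows "(\<Sum>n. \<Sum>i. f i n) = (\<Sum>i. \<Sum>n. f i n)"
proof -
  have "(\<Sum>n. \<Sum>i. f i n) = (\<integral>\<^sup>+n. (\<Sum>i. f i n) \<partial>count_space UNIV)"
    by (simp add: nn_integral_count_space_nat)
  also have "\<dots> = (\<Sum>i. \<integral>\<^sup>+n. f i n \<partial>count_space UNIV)"
    by (rule nn_integral_suminf) simp
  finally show ?thesis by (simp add: nn_integral_count_space_nat)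
qed

context riemannian
begin

section \<open>Transport of Borel sets through charts\<close>

lemma borel_chart_domain: "c \<in> A \<Longrightarrow> fst c \<in> sets borel" "c \<in> A \<Longrightarrow> chart_image c \<in> sets borel"
  by (simp_all add: chart_open)

lemma chart_image_preimage:
  assumes "c \<in> A" "B \<subseteq> fst c"
  shows "snd c ` B = chart_image c \<inter> chart_inv c -` B"
proof (intro set_eqI iffI)
  show "x \<in> snd c ` B" if "x \<in> chart_image c \<inter> chart_inv c -` B" for x
    using that chart_chart_inv[OF assms(1), of x]
    by (intro image_eqI[where x = "chart_inv c x"]) simp_all
  show "x \<in> chart_image c \<inter> chart_inv c -` B" if x: "x \<in> snd c ` B" for x
  proof -
    obtain p where p: "p \<in> B" "x = snd c p" using x by blast
    then have "p \<in> fst c" using assms(2) by blast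
    then show ?thesis using p assms(1) by (simp add: chart_in chart_inv_chart)
  qed
qed

lemma chart_inv_image_preimage:
  assumes "c \<in> A" "Z \<subseteq> chart_image c"
  shows "chart_inv c ` Z = fst c \<inter> snd c -` Z"
proof (intro set_eqI iffI)
  show "p \<in> chart_inv c ` Z" if "p \<in> fst c \<inter> snd c -` Z" for p
    using that chart_inv_chart[OF assms(1), of p]
    by (intro image_eqI[where x = "snd c p"]) simp_all
  show "p \<in> fst c \<inter> snd c -` Z" if p: "p \<in> chart_inv c ` Z" for p
  proof -
    obtain x where x: "x \<in> Z" "p = chart_inv c x" using p by blast
    then have "x \<in> chart_image c" using assms(2) by blast
    then show ?thesis using x assms(1) by (simp add: chart_inv_in chart_chart_inv)
  qed
qed

lemma measurable_chart_inv: "c \<in> A \<Longrightarrow> chart_inv c \<in> borel_measurable (restrict_space borel (chart_image c))"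
  by (intro borel_measurable_continuous_on_restrict continuous_on_chart_inv)

lemma measurable_chart: "c \<in> A \<Longrightarrow> snd c \<in> borel_measurable (restrict_space borel (fst c))"
  by (intro borel_measurable_continuous_on_restrict continuous_on_chart)

lemma borel_chart_image:
  assumes "c \<in> A" "B \<in> sets borel" "B \<subseteq> fst c"
  shows "snd c ` B \<in> sets borel"
proof -
  have "chart_inv c -` B \<inter> chart_image c \<in> sets (restrict_space borel (chart_image c))"
    using measurable_sets[OF measurable_chart_inv[OF assms(1)] assms(2)]
    by (simp add: space_restrict_space)
  then show ?thesis
    using borel_chart_domain(2)[OF assms(1)]
    by (simp add: sets_restrict_space_iff chart_image_preimage[OF assms(1,3)] Int_commute)
qed

lemma borel_chart_inv_image:
  assumes "c \<in> A" "Z \<in> sets borel" "Z \<subseteq> chart_image c"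
  shows "chart_inv c ` Z \<in> sets borel"
proof -
  have "snd c -` Z \<inter> fst c \<in> sets (restrict_space borel (fst c))"
    using measurable_sets[OF measurable_chart[OF assms(1)] assms(2)]
    by (simp add: space_restrict_space)
  then show ?thesis
    using borel_chart_domain(1)[OF assms(1)]
    by (simp add: sets_restrict_space_iff chart_inv_image_preimage[OF assms(1,3)] Int_commute)
qed

text \<open>Off the chart image \<open>chart_inv\<close> takes arbitrary values; the indicator
  removes them, so that the density is Borel on the whole of \<open>real^'n\<close>.\<close>

definition vol_density :: "('m, 'n) chart \<Rightarrow> real^'n \<Rightarrow> real"
  where "vol_density c x = indicator (chart_image c) x * sqrt (det (gram A g c x))"

lemma vol_density_nonneg: "c \<in> A \<Longrightarrow> 0 \<le> vol_density c x"
  using less_imp_le[OF det_gram_pos] by (auto simp: vol_density_def indicator_def)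

lemma vol_density_pos: "c \<in> A \<Longrightarrow> x \<in> chart_image c \<Longrightarrow> 0 < vol_density c x"
  using det_gram_pos by (simp add: vol_density_def)

lemma measurable_vol_density: "c \<in> A \<Longrightarrow> vol_density c \<in> borel_measurable borel"
  unfolding vol_density_def[abs_def]
  using borel_measurable_continuous_on_indicator[OF borel_chart_domain(2)
      continuous_on_real_sqrt[OF continuous_on_det_gram]]
  by simp

section \<open>The volume of a set inside one chart\<close>

definition chart_volume :: "('m, 'n) chart \<Rightarrow> 'm set \<Rightarrow> ennreal"
  where "chart_volume c B = (\<integral>\<^sup>+x\<in>snd c ` B. ennreal (sqrt (det (gram A g c x))) \<partial>lborel)"

lemma chart_volume_eq_density:
  assumes "c \<in> A" "B \<in> sets borel" "B \<subseteq> fst c"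
  shows "chart_volume c B = emeasure (density lborel (\<lambda>x. ennreal (vol_density c x))) (snd c ` B)"
proof -
  have "ennreal (sqrt (det (gram A g c x))) * indicator (snd c ` B) x
      = ennreal (vol_density c x) * indicator (snd c ` B) x" for x
    using chart_in[OF assms(1)] assms(3) by (auto simp: vol_density_def indicator_def)
  then show ?thesis
    using borel_chart_image[OF assms] measurable_vol_density[OF assms(1)]
    by (simp add: chart_volume_def emeasure_density)
qed

lemma chart_volume_UN:
  assumes c: "c \<in> A" and B: "\<And>n. B n \<in> sets borel" "\<And>n. B n \<subseteq> fst c" and disj: "disjoint_family B"
  shows "(\<Sum>n::nat. chart_volume c (B n)) = chart_volume c (\<Union>n. B n)"
proof -
  let ?M = "density lborel (\<lambda>x. ennreal (vol_density c x))"
  have inj: "inj_on (snd c) (fst c)"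
    using chart_inv_chart[OF c] by (rule inj_on_inverseI)
  have "disjoint_family (\<lambda>n. snd c ` B n)"
    using disj inj B(2) unfolding disjoint_family_on_def
    by (metis image_empty inj_on_image_Int)
  moreover have "range (\<lambda>n. snd c ` B n) \<subseteq> sets ?M"
    using borel_chart_image[OF c B] by auto
  ultimately have "(\<Sum>n. emeasure ?M (snd c ` B n)) = emeasure ?M (\<Union>n. snd c ` B n)"
    by (intro suminf_emeasure)
  moreover have "chart_volume c (\<Union>n. B n) = emeasure ?M (\<Union>n. snd c ` B n)"
    using B by (subst chart_volume_eq_density[OF c]) (auto simp: image_UN)
  ultimately show ?thesis
    using chart_volume_eq_density[OF c B] by simp
qed

text \<open>The substitution rule for the transition map: its Jacobian factor cancels against the
  change of the Gram determinant in \<open>det_gram_transition\<close>.\<close>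

lemma chart_volume_change:
  assumes c: "c \<in> A" "c' \<in> A" and B: "B \<in> sets borel" "B \<subseteq> fst c" "B \<subseteq> fst c'"
  shows "chart_volume c B = chart_volume c' B"
proof -
  let ?S = "snd c ` B" and ?\<tau> = "transition c c'"
  have S: "?S \<in> sets borel" and S': "snd c' ` B \<in> sets borel"
    using borel_chart_image c B by auto
  have S_overlap: "?S \<subseteq> overlap c c'"
    using B by (auto simp: overlap_def)
  have im: "?\<tau> ` ?S = snd c' ` B"
  proof -
    have "?\<tau> (snd c p) = snd c' p" if "p \<in> B" for p
      using that B(2) transition_chart[OF c(1)] by blast
    then show ?thesis by (simp add: image_image cong: image_cong)
  qed
  have inj: "inj_on ?\<tau> ?S"
  proof (rule inj_onI)
    fix x y assume "x \<in> ?S" "y \<in> ?S" and eq: "?\<tau> x = ?\<tau> y"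
    then obtain p q where pq: "p \<in> B" "q \<in> B" "x = snd c p" "y = snd c q" by blast
    then have "p \<in> fst c" "q \<in> fst c" "p \<in> fst c'" "q \<in> fst c'" using B by blast+
    moreover from this have "snd c' p = snd c' q"
      using eq pq(3,4) transition_chart[OF c(1), of p c'] transition_chart[OF c(1), of q c'] by simp
    ultimately have "p = q"
      using chart_inv_chart[OF c(2)] by metis
    then show "x = y" using pq by simp
  qed
  have dens: "\<bar>det (matrix (dtrans c c' x))\<bar> * vol_density c' (?\<tau> x) = vol_density c x"
    if x: "x \<in> ?S" for x
  proof -
    obtain p where p: "p \<in> B" "x = snd c p" using x by blast
    have "x \<in> chart_image c" "?\<tau> x \<in> chart_image c'"
      using p(2) subsetD[OF B(2) p(1)] subsetD[OF B(3) p(1)] c by (simp_all add: chart_in transition_chart)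
    moreover have "x \<in> overlap c c'" using x S_overlap by blast
    ultimately show ?thesis
      using det_gram_transition[OF c, of x] by (simp add: vol_density_def real_sqrt_mult)
  qed
  have m: "(\<lambda>x. indicator ?S x * vol_density c x) \<in> borel_measurable borel"
    using S measurable_vol_density[OF c(1)] by simp
  have "emeasure (density lborel (\<lambda>x. ennreal (vol_density c' x))) (snd c' ` B)
      = (\<integral>\<^sup>+x\<in>?\<tau> ` ?S. ennreal (vol_density c' x) \<partial>lborel)"
    unfolding im using S' measurable_vol_density[OF c(2)] by (simp add: emeasure_density)
  also have "\<dots> = (\<integral>\<^sup>+x\<in>?S. ennreal (\<bar>det (matrix (dtrans c c' x))\<bar> * vol_density c' (?\<tau> x)) \<partial>lborel)"
  proof (rule nn_integral_change_of_variables[OF S _ inj])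
    show "(?\<tau> has_derivative dtrans c c' x) (at x within ?S)" if "x \<in> ?S" for x
      using transition_derivative[OF c] that S_overlap has_derivative_at_withinI by blast
    show "(\<lambda>x. indicator (?\<tau> ` ?S) x * vol_density c' x) \<in> borel_measurable borel"
      unfolding im using S' measurable_vol_density[OF c(2)] by simp
    have "(\<lambda>x. indicator ?S x * (\<bar>det (matrix (dtrans c c' x))\<bar> * vol_density c' (?\<tau> x)))
        = (\<lambda>x. indicator ?S x * vol_density c x)"
      using dens by (auto simp: fun_eq_iff indicator_def)
    then show "(\<lambda>x. indicator ?S x * (\<bar>det (matrix (dtrans c c' x))\<bar> * vol_density c' (?\<tau> x)))
        \<in> borel_measurable borel"
      using m by simp
  qed (rule vol_density_nonneg[OF c(2)])
  also have "\<dots> = (\<integral>\<^sup>+x\<in>?S. ennreal (vol_density c x) \<partial>lborel)"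
    using dens by (intro nn_integral_cong) (auto simp: indicator_def)
  also have "\<dots> = emeasure (density lborel (\<lambda>x. ennreal (vol_density c x))) ?S"
    using S measurable_vol_density[OF c(1)] by (simp add: emeasure_density)
  finally show ?thesis
    using chart_volume_eq_density[OF c(1) B(1,2)] chart_volume_eq_density[OF c(2) B(1,3)] by simp
qed

section \<open>Gluing the volume along a countable cover\<close>

definition cover :: "nat \<Rightarrow> ('m, 'n) chart"
  where "cover = (SOME C. range C \<subseteq> A \<and> (\<Union>n. fst (C n)) = UNIV)"

text \<open>The atlas may be uncountable. Second countability gives the Lindelof property, hence a
  sequence of charts, and with it countable sums and countable unions of null sets.\<close>

lemma cover: "cover n \<in> A" "(\<Union>n. fst (cover n)) = UNIV"
proof -
  obtain \<F> where F: "\<F> \<subseteq> fst ` A" "countable \<F>" "\<Union>\<F> = \<Union>(fst ` A)"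
    using Lindelof[of "fst ` A"] chart_open by blast
  then have FU: "\<Union>\<F> = UNIV"
    using atlas unfolding smooth_atlas_def by blast
  then have ne: "\<F> \<noteq> {}" by auto
  have "\<exists>C. range C \<subseteq> A \<and> (\<Union>n::nat. fst (C n)) = UNIV"
  proof -
    have "\<forall>n. \<exists>c. c \<in> A \<and> fst c = from_nat_into \<F> n"
      using from_nat_into[OF ne] F(1) by (metis imageE subsetD)
    then obtain C where C: "\<And>n. C n \<in> A" "\<And>n. fst (C n) = from_nat_into \<F> n" by metis
    have "(\<Union>n. fst (C n)) = UNIV"
      unfolding C(2) using range_from_nat_into[OF ne F(2)] FU by simp
    then show ?thesis using C(1) by blast
  qed
  then have "range cover \<subseteq> A \<and> (\<Union>n. fst (cover n)) = UNIV"
    unfolding cover_def by (rule someI_ex)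
  then show "cover n \<in> A" "(\<Union>n. fst (cover n)) = UNIV" by blast+
qed

definition piece :: "nat \<Rightarrow> 'm set"
  where "piece = disjointed (\<lambda>n. fst (cover n))"

lemma piece: "piece n \<subseteq> fst (cover n)" "piece n \<in> sets borel" "disjoint_family piece" "(\<Union>n. piece n) = UNIV"
proof -
  have "range piece \<subseteq> sets borel"
    unfolding piece_def using borel_chart_domain(1)[OF cover(1)]
    by (intro sets.range_disjointed_sets) auto
  then show "piece n \<in> sets borel" by blast
  show "piece n \<subseteq> fst (cover n)" unfolding piece_def by (rule disjointed_subset)
  show "disjoint_family piece" unfolding piece_def by (rule disjoint_family_disjointed)
  show "(\<Union>n. piece n) = UNIV" unfolding piece_def UN_disjointed_eq by (rule cover(2))
qed

definition glued_volume :: "'m measure"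
  where "glued_volume = measure_of UNIV (sets borel) (\<lambda>B. \<Sum>n. chart_volume (cover n) (B \<inter> piece n))"

lemma sets_glued_volume: "sets glued_volume = sets borel"
  unfolding glued_volume_def using sets.sigma_sets_eq[of borel] by (simp add: sets_measure_of_conv)

lemma disjoint_pieces: "disjoint_family (\<lambda>n. B \<inter> piece n)" "(\<Union>n. B \<inter> piece n) = B"
  using piece(3,4) by (auto simp: disjoint_family_on_def)

lemma emeasure_glued_volume:
  assumes "B \<in> sets borel"
  shows "emeasure glued_volume B = (\<Sum>n. chart_volume (cover n) (B \<inter> piece n))"
proof (rule emeasure_measure_of[OF glued_volume_def])
  show "positive (sets glued_volume) (\<lambda>B. \<Sum>n. chart_volume (cover n) (B \<inter> piece n))"
    by (simp add: positive_def chart_volume_def)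
  show "countably_additive (sets glued_volume) (\<lambda>B. \<Sum>n. chart_volume (cover n) (B \<inter> piece n))"
    unfolding countably_additive_def sets_glued_volume
  proof (intro allI impI)
    fix F :: "nat \<Rightarrow> 'm set" assume F: "range F \<subseteq> sets borel" "disjoint_family F"
    have "(\<Sum>i. \<Sum>n. chart_volume (cover n) (F i \<inter> piece n))
        = (\<Sum>n. \<Sum>i. chart_volume (cover n) (F i \<inter> piece n))"
      by (rule suminf_swap_ennreal)
    also have "\<dots> = (\<Sum>n. chart_volume (cover n) (\<Union>i. F i \<inter> piece n))"
    proof (intro suminf_cong chart_volume_UN cover)
      show "F i \<inter> piece n \<in> sets borel" for i n using F(1) piece(2) by auto
      show "F i \<inter> piece n \<subseteq> fst (cover n)" for i n using piece(1) by blast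
      show "disjoint_family (\<lambda>i. F i \<inter> piece n)" for n
        using F(2) by (auto simp: disjoint_family_on_def)
    qed
    finally show "(\<Sum>i. \<Sum>n. chart_volume (cover n) (F i \<inter> piece n))
        = (\<Sum>n. chart_volume (cover n) (\<Union>(range F) \<inter> piece n))"
      by (simp add: Int_UN_distrib2)
  qed
qed (use assms sets_glued_volume in auto)

text \<open>Each \<open>B \<inter> piece n\<close> lies in the domains of both \<open>c\<close> and
  \<open>cover n\<close>, where the two chart volumes agree; countable additivity inside
  \<open>c\<close> puts the parts together again. So the chosen cover leaves no trace.\<close>

lemma emeasure_glued_volume_chart:
  assumes c: "c \<in> A" and B: "B \<in> sets borel" "B \<subseteq> fst c"
  shows "emeasure glued_volume B = chart_volume c B"
proof -
  have "chart_volume (cover n) (B \<inter> piece n) = chart_volume c (B \<inter> piece n)" for n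
    using B piece(1,2) by (intro chart_volume_change cover c) auto
  then have "emeasure glued_volume B = (\<Sum>n. chart_volume c (B \<inter> piece n))"
    using emeasure_glued_volume[OF B(1)] by simp
  also have "\<dots> = chart_volume c (\<Union>n. B \<inter> piece n)"
    using B piece(2) disjoint_pieces by (intro chart_volume_UN c) auto
  finally show ?thesis by (simp only: disjoint_pieces)
qed

text \<open>Gluing gives existence, but the definite description also asks for uniqueness: every
  Borel measure is the sum of its restrictions to the disjoint \<open>piece n\<close>, and each of
  these lies in one chart domain, where the values are prescribed.\<close>

lemma riemannian_volume_eq: "riemannian_volume A g = glued_volume"
  unfolding riemannian_volume_def
proof (rule the_equality)
  show "sets glued_volume = sets borel \<and> (\<forall>c\<in>A. \<forall>B\<in>sets borel. B \<subseteq> fst c \<longrightarrow>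
      emeasure glued_volume B = (\<integral>\<^sup>+x\<in>snd c ` B. ennreal (sqrt (det (gram A g c x))) \<partial>lborel))"
    using sets_glued_volume emeasure_glued_volume_chart by (simp add: chart_volume_def)
next
  fix V assume "sets V = sets borel \<and> (\<forall>c\<in>A. \<forall>B\<in>sets borel. B \<subseteq> fst c \<longrightarrow>
      emeasure V B = (\<integral>\<^sup>+x\<in>snd c ` B. ennreal (sqrt (det (gram A g c x))) \<partial>lborel))"
  then have sV: "sets V = sets borel"
    and V: "\<And>c B. c \<in> A \<Longrightarrow> B \<in> sets borel \<Longrightarrow> B \<subseteq> fst c \<Longrightarrow> emeasure V B = chart_volume c B"
    unfolding chart_volume_def by blast+
  show "V = glued_volume"
  proof (rule measure_eqI)
    show "sets V = sets glued_volume" by (simp add: sV sets_glued_volume)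
    fix B assume "B \<in> sets V"
    then have B: "B \<in> sets borel" by (simp add: sV)
    have "emeasure V B = (\<Sum>n. emeasure V (B \<inter> piece n))"
    proof -
      have "range (\<lambda>n. B \<inter> piece n) \<subseteq> sets V" using B piece(2) by (auto simp: sV)
      from suminf_emeasure[OF this disjoint_pieces(1)] show ?thesis
        by (simp only: disjoint_pieces(2))
    qed
    also have "\<dots> = (\<Sum>n. chart_volume (cover n) (B \<inter> piece n))"
    proof (rule suminf_cong)
      fix n
      show "emeasure V (B \<inter> piece n) = chart_volume (cover n) (B \<inter> piece n)"
        by (rule V[OF cover(1)]) (use B piece(1,2)[of n] in auto)
    qed
    finally show "emeasure V B = emeasure glued_volume B"
      using emeasure_glued_volume[OF B] by simp
  qed
qed

section \<open>Null sets and measurability in charts\<close>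

abbreviation V :: "'m measure"
  where "V \<equiv> riemannian_volume A g"

lemma sets_V [simp, measurable_cong]: "sets V = sets borel"
  by (simp add: riemannian_volume_eq sets_glued_volume)

lemma space_V [simp]: "space V = UNIV"
  using sets_eq_imp_space_eq[OF sets_V] by simp

lemma emeasure_V_chart:
  assumes "c \<in> A" "B \<in> sets borel" "B \<subseteq> fst c"
  shows "emeasure V B = (\<integral>\<^sup>+x\<in>snd c ` B. ennreal (vol_density c x) \<partial>lborel)"
  using emeasure_glued_volume_chart[OF assms] chart_volume_eq_density[OF assms]
    borel_chart_image[OF assms] measurable_vol_density[OF assms(1)]
  by (simp add: riemannian_volume_eq emeasure_density)

text \<open>The density is strictly positive on the chart image, so a set of volume zero has a
  Lebesgue null image in each chart.\<close>

lemma AE_V_chartD: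
  assumes "AE p in V. P p" and c: "c \<in> A"
  shows "AE x in lborel. x \<in> chart_image c \<longrightarrow> P (chart_inv c x)"
proof -
  obtain N where N: "{p \<in> space V. \<not> P p} \<subseteq> N" "emeasure V N = 0" "N \<in> sets V"
    using assms(1) by (rule AE_E)
  let ?B = "N \<inter> fst c"
  have B: "?B \<in> sets borel" "?B \<subseteq> fst c" using N(3) borel_chart_domain(1)[OF c] by auto
  have "emeasure V ?B \<le> emeasure V N" using N(3) by (intro emeasure_mono) auto
  then have "(\<integral>\<^sup>+x. ennreal (vol_density c x) * indicator (snd c ` ?B) x \<partial>lborel) = 0"
    using N(2) emeasure_V_chart[OF c B] by simp
  then have "AE x in lborel. ennreal (vol_density c x) * indicator (snd c ` ?B) x = 0"
    using measurable_vol_density[OF c] borel_chart_image[OF c B]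
    by (subst (asm) nn_integral_0_iff_AE) auto
  then show ?thesis
  proof eventually_elim
    case (elim x)
    show ?case
    proof (intro impI, rule ccontr)
      assume x: "x \<in> chart_image c" and "\<not> P (chart_inv c x)"
      then have "chart_inv c x \<in> ?B" using N(1) chart_inv_in[OF c] by auto
      then have "x \<in> snd c ` ?B" using chart_image_preimage[OF c, of ?B] x by auto
      then show False using elim vol_density_pos[OF c x] by (auto simp: indicator_def)
    qed
  qed
qed

text \<open>A Lebesgue null set carries no volume whatever the density is, and countably many charts
  cover the manifold.\<close>

lemma AE_V_chartI:
  assumes "\<And>c. c \<in> A \<Longrightarrow> AE x in lborel. x \<in> chart_image c \<longrightarrow> P (chart_inv c x)"
  shows "AE p in V. P p"
proof -
  have "AE p in V. p \<in> fst c \<longrightarrow> P p" if c: "c \<in> A" for c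
  proof -
    obtain Z where Z: "{x \<in> space lborel. \<not> (x \<in> chart_image c \<longrightarrow> P (chart_inv c x))} \<subseteq> Z"
        "emeasure lborel Z = 0" "Z \<in> sets lborel"
      using assms[OF c] by (rule AE_E)
    let ?Z = "Z \<inter> chart_image c"
    let ?B = "chart_inv c ` ?Z"
    have Zb: "?Z \<in> sets borel" using Z(3) borel_chart_domain(2)[OF c] by auto
    have B: "?B \<in> sets borel" "?B \<subseteq> fst c"
      using borel_chart_inv_image[OF c Zb] chart_inv_in[OF c] by auto
    have "snd c ` ?B \<subseteq> Z" using chart_chart_inv[OF c] by auto
    then have "emeasure V ?B \<le> (\<integral>\<^sup>+x\<in>Z. ennreal (vol_density c x) \<partial>lborel)"
      unfolding emeasure_V_chart[OF c B] by (intro nn_integral_mono) (auto simp: indicator_def)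
    also have "\<dots> = 0"
      using Z(2,3) by (intro nn_integral_null_set) auto
    finally have "?B \<in> null_sets V" using B by (auto intro!: null_setsI)
    then show ?thesis
    proof (rule AE_I')
      show "{p \<in> space V. \<not> (p \<in> fst c \<longrightarrow> P p)} \<subseteq> ?B"
      proof
        fix p assume "p \<in> {p \<in> space V. \<not> (p \<in> fst c \<longrightarrow> P p)}"
        then have p: "p \<in> fst c" "\<not> P p" by auto
        then have "snd c p \<in> ?Z" using Z(1) chart_in[OF c] chart_inv_chart[OF c] by auto
        then show "p \<in> ?B" using p chart_inv_chart[OF c] by (metis imageI)
      qed
    qed
  qed
  then have "AE p in V. \<forall>n. p \<in> fst (cover n) \<longrightarrow> P p"
    unfolding AE_all_countable using cover(1) by blast
  then show ?thesis
    by eventually_elim (use cover(2) in blast)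
qed

lemma measurable_chartD:
  assumes f: "f \<in> borel_measurable borel" and c: "c \<in> A"
  shows "(\<lambda>x. indicator (chart_image c) x * f (chart_inv c x) :: real) \<in> borel_measurable borel"
proof -
  have "(\<lambda>x. f (chart_inv c x)) \<in> borel_measurable (restrict_space borel (chart_image c))"
    using measurable_compose[OF measurable_chart_inv[OF c] f] .
  then show ?thesis
    using borel_chart_domain(2)[OF c] by (subst (asm) borel_measurable_restrict_space_iff) auto
qed

lemma measurable_chartI:
  fixes f :: "'m \<Rightarrow> real"
  assumes "\<And>c. c \<in> A \<Longrightarrow> (\<lambda>x. indicator (chart_image c) x * f (chart_inv c x)) \<in> borel_measurable borel"
  shows "f \<in> borel_measurable borel"
proof (rule measurable_piecewise_restrict)
  show "countable (range (\<lambda>n. fst (cover n)))" by simp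
  show "space borel \<subseteq> \<Union>(range (\<lambda>n. fst (cover n)))" using cover(2) by simp
  fix \<Omega> assume "\<Omega> \<in> range (\<lambda>n. fst (cover n))"
  then obtain c where c: "c \<in> A" "\<Omega> = fst c" using cover(1) by blast
  then show "\<Omega> \<inter> space borel \<in> sets borel" using borel_chart_domain(1) by simp
  have "(\<lambda>p. indicator (chart_image c) (snd c p) * f (chart_inv c (snd c p)))
      \<in> borel_measurable (restrict_space borel (fst c))"
    using measurable_compose[OF measurable_chart[OF c(1)] assms[OF c(1)]] .
  then show "f \<in> borel_measurable (restrict_space borel \<Omega>)"
    unfolding c(2)
    by (rule measurable_cong[THEN iffD1, rotated])
      (simp add: space_restrict_space chart_in[OF c(1)] chart_inv_chart[OF c(1)])
qed

end

section \<open>Weak gradients\<close>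

text \<open>Integrability on a compact set includes measurability there; countably many closed boxes
  exhaust \<open>W\<close>, and on the complement of \<open>W\<close> the product is 0.\<close>

lemma measurable_locally_integrable_on:
  fixes h :: "real^'n::finite \<Rightarrow> real"
  assumes W: "open W" and h: "locally_integrable_on W h"
  shows "(\<lambda>x. indicator W x * h x) \<in> borel_measurable borel"
proof -
  obtain \<D> where D: "countable \<D>" "\<D> \<subseteq> Pow W" "\<And>X. X \<in> \<D> \<Longrightarrow> \<exists>a b. X = cbox a b" "\<Union>\<D> = W"
    using open_countable_Union_open_cbox[OF W] by blast
  show ?thesis
  proof (rule measurable_piecewise_restrict)
    show "countable (insert (- W) \<D>)" using D(1) by simp
    show "space borel \<subseteq> \<Union>(insert (- W) \<D>)" using D(4) by auto
    fix \<Omega> assume \<Omega>: "\<Omega> \<in> insert (- W) \<D>"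
    have Wb: "W \<in> sets borel" using W by simp
    show \<Omega>b: "\<Omega> \<inter> space borel \<in> sets borel" using \<Omega> D(3)[of \<Omega>] Wb by auto
    have "(\<lambda>x. indicator \<Omega> x *\<^sub>R (indicator W x * h x)) \<in> borel_measurable borel"
    proof (cases "\<Omega> = - W")
      case True
      then have "(\<lambda>x. indicator \<Omega> x *\<^sub>R (indicator W x * h x)) = (\<lambda>x. 0)"
        by (auto simp: indicator_def fun_eq_iff)
      then show ?thesis by simp
    next
      case False
      then have \<Omega>D: "\<Omega> \<in> \<D>" using \<Omega> by simp
      then have sub: "\<Omega> \<subseteq> W" using D(2) by blast
      obtain a b where "\<Omega> = cbox a b" using D(3)[OF \<Omega>D] by blast
      then have "integrable lborel (\<lambda>x. indicator \<Omega> x *\<^sub>R h x)"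
        using h[unfolded locally_integrable_on_def set_integrable_def, rule_format, of \<Omega>] sub by simp
      then have "(\<lambda>x. indicator \<Omega> x *\<^sub>R h x) \<in> borel_measurable borel"
        using borel_measurable_integrable[of lborel "\<lambda>x. indicator \<Omega> x *\<^sub>R h x"] by simp
      moreover have "(\<lambda>x. indicator \<Omega> x *\<^sub>R h x) = (\<lambda>x. indicator \<Omega> x *\<^sub>R (indicator W x * h x))"
        using sub by (auto simp: indicator_def fun_eq_iff)
      ultimately show ?thesis by simp
    qed
    then show "(\<lambda>x. indicator W x * h x) \<in> borel_measurable (restrict_space borel \<Omega>)"
      using \<Omega>b by (subst borel_measurable_restrict_space_iff)
  qed
qed

section \<open>Calculus of weak partial derivatives\<close>

lemma test_function_integrable:
  assumes h: "locally_integrable_on W h" and \<psi>: "test_function W \<psi>"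
  shows "set_integrable lborel W (\<lambda>x. h x * \<psi> x)"
    and "set_integrable lborel W (\<lambda>x. h x * frechet_derivative \<psi> (at x) v)"
proof -
  obtain K where K: "compact K" "K \<subseteq> W" and \<psi>0: "\<And>x. x \<notin> K \<Longrightarrow> \<psi> x = 0"
    using \<psi> by (auto simp: test_function_def)
  have d0: "frechet_derivative \<psi> (at x) v = 0" if x: "x \<notin> K" for x
  proof -
    have "((\<lambda>x. 0) has_derivative (\<lambda>v. 0)) (at x)" by simp
    then have "(\<psi> has_derivative (\<lambda>v. 0)) (at x)"
      by (rule has_derivative_transform_within_open[where s = "- K"])
        (use x K \<psi>0 in \<open>auto simp: compact_imp_closed\<close>)
    then show ?thesis using frechet_derivative_at by metis
  qed
  show "set_integrable lborel W (\<lambda>x. h x * \<psi> x)"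
    by (rule locally_integrable_on_mult_bounded[OF h K test_function_continuous[OF \<psi>] \<psi>0])
  show "set_integrable lborel W (\<lambda>x. h x * frechet_derivative \<psi> (at x) v)"
    by (rule locally_integrable_on_mult_bounded[OF h K test_function_derivative(2)[OF \<psi>] d0])
qed

lemma locally_integrable_on_lincomb:
  assumes "locally_integrable_on W f" "locally_integrable_on W h"
  shows "locally_integrable_on W (\<lambda>x. a * f x + b * h x)"
  unfolding locally_integrable_on_def
proof (intro allI impI)
  fix K assume K: "compact K \<and> K \<subseteq> W"
  have "set_integrable lborel K f" "set_integrable lborel K h"
    using assms[unfolded locally_integrable_on_def, rule_format, OF K] by simp_all
  then show "set_integrable lborel K (\<lambda>x. a * f x + b * h x)"
    by (intro set_integral_add(1) set_integrable_mult_right) auto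
qed

lemma integral_lincomb_mult:
  assumes "set_integrable lborel W (\<lambda>x. f x * u x)" "set_integrable lborel W (\<lambda>x. h x * u x :: real)"
  shows "(LINT x:W|lborel. (a * f x + b * h x) * u x)
    = a * (LINT x:W|lborel. f x * u x) + b * (LINT x:W|lborel. h x * u x)"
proof -
  have "(LINT x:W|lborel. (a * f x + b * h x) * u x)
      = (LINT x:W|lborel. a * (f x * u x) + b * (h x * u x))"
    by (simp only: distrib_right mult.assoc)
  also have "\<dots> = (LINT x:W|lborel. a * (f x * u x)) + (LINT x:W|lborel. b * (h x * u x))"
    using assms by (intro set_integral_add set_integrable_mult_right) auto
  finally show ?thesis by simp
qed

lemma weak_partial_lincomb:
  assumes 1: "weak_partial W i f1 h1" and 2: "weak_partial W i f2 h2"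
  shows "weak_partial W i (\<lambda>x. a * f1 x + b * f2 x) (\<lambda>x. a * h1 x + b * h2 x)"
  unfolding weak_partial_def
proof (intro conjI allI impI)
  note loc = 1[unfolded weak_partial_def, THEN conjunct1]
    1[unfolded weak_partial_def, THEN conjunct2, THEN conjunct1]
    2[unfolded weak_partial_def, THEN conjunct1]
    2[unfolded weak_partial_def, THEN conjunct2, THEN conjunct1]
  show "locally_integrable_on W (\<lambda>x. a * f1 x + b * f2 x)"
    by (rule locally_integrable_on_lincomb[OF loc(1,3)])
  show "locally_integrable_on W (\<lambda>x. a * h1 x + b * h2 x)"
    by (rule locally_integrable_on_lincomb[OF loc(2,4)])
  fix \<psi> assume \<psi>: "test_function W \<psi>"
  then show "(LINT x:W|lborel. (a * f1 x + b * f2 x) * frechet_derivative \<psi> (at x) (axis i 1))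
      = - (LINT x:W|lborel. (a * h1 x + b * h2 x) * \<psi> x)"
    using 1 2 integral_lincomb_mult[OF test_function_integrable(1)[OF loc(2) \<psi>]
        test_function_integrable(1)[OF loc(4) \<psi>]]
      integral_lincomb_mult[OF test_function_integrable(2)[OF loc(1) \<psi>]
        test_function_integrable(2)[OF loc(3) \<psi>]]
    unfolding weak_partial_def by simp
qed

lemma weak_partial_cong:
  fixes f :: "real^'n::finite \<Rightarrow> real"
  assumes "weak_partial W i f h"
    and "\<And>x. x \<in> W \<Longrightarrow> f' x = f x" "\<And>x. x \<in> W \<Longrightarrow> h' x = h x"
  shows "weak_partial W i f' h'"
proof -
  have int: "(LINT x:W|lborel. u' x * \<psi> x) = (LINT x:W|lborel. u x * \<psi> x)"
    if eq: "\<And>x. x \<in> W \<Longrightarrow> u' x = u x" for u u' \<psi> :: "real^'n \<Rightarrow> real"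
    unfolding set_lebesgue_integral_def
    by (intro Bochner_Integration.integral_cong) (auto simp: indicator_def eq)
  have loc: "locally_integrable_on W u'"
    if eq: "\<And>x. x \<in> W \<Longrightarrow> u' x = u x" and u: "locally_integrable_on W u" for u u' :: "real^'n \<Rightarrow> real"
    unfolding locally_integrable_on_def
  proof (intro allI impI)
    fix K assume K: "compact K \<and> K \<subseteq> W"
    have "(\<lambda>x. indicator K x *\<^sub>R u' x) = (\<lambda>x. indicator K x *\<^sub>R u x)"
      using eq K by (auto simp: indicator_def fun_eq_iff)
    then show "set_integrable lborel K u'"
      using u[unfolded locally_integrable_on_def, rule_format, OF K] by (simp add: set_integrable_def)
  qed
  have "locally_integrable_on W f'" "locally_integrable_on W h'"
    using assms loc[of f' f] loc[of h' h] unfolding weak_partial_def by blast+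
  then show ?thesis
    using assms(1) int[of f' f] int[of h' h] assms(2,3) unfolding weak_partial_def by simp
qed

text \<open>The measure \<open>lborel\<close> is not complete, so a function equal to
  \<open>f\<close> almost everywhere may fail to be Borel; hence the assumption
  \<open>m\<close>.\<close>

lemma weak_partial_cong_AE:
  fixes f :: "real^'n::finite \<Rightarrow> real"
  assumes f: "weak_partial W i f h" and W: "open W"
    and m: "(\<lambda>x. indicator W x * f' x) \<in> borel_measurable borel"
    and eq: "AE x in lborel. x \<in> W \<longrightarrow> f x = f' x"
  shows "weak_partial W i f' h"
  unfolding weak_partial_def
proof (intro conjI allI impI)
  have loc: "locally_integrable_on W f" "locally_integrable_on W h"
    using f unfolding weak_partial_def by blast+
  show "locally_integrable_on W h" by (rule loc)
  show "locally_integrable_on W f'"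
    unfolding locally_integrable_on_def set_integrable_def
  proof (intro allI impI)
    fix K assume K: "compact K \<and> K \<subseteq> W"
    have "(\<lambda>x. indicator K x *\<^sub>R f' x) = (\<lambda>x. indicator K x * (indicator W x * f' x))"
      using K by (auto simp: indicator_def fun_eq_iff)
    moreover have "(\<lambda>x. indicator K x * (indicator W x * f' x)) \<in> borel_measurable borel"
      by (rule borel_measurable_times[OF _ m]) (use K in \<open>simp add: compact_imp_closed\<close>)
    ultimately have m': "(\<lambda>x. indicator K x *\<^sub>R f' x) \<in> borel_measurable lborel" by simp
    have i: "integrable lborel (\<lambda>x. indicator K x *\<^sub>R f x)"
      using loc(1) K unfolding locally_integrable_on_def set_integrable_def by blast
    show "integrable lborel (\<lambda>x. indicator K x *\<^sub>R f' x)"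
    proof (rule integrable_cong_AE_imp[OF i m'])
      show "AE x in lborel. indicator K x *\<^sub>R f x = indicator K x *\<^sub>R f' x"
        using eq by eventually_elim (use K in \<open>auto simp: indicator_def\<close>)
    qed
  qed
  fix \<psi> assume \<psi>: "test_function W \<psi>"
  let ?d = "\<lambda>x. frechet_derivative \<psi> (at x) (axis i 1)"
  have dm: "?d \<in> borel_measurable borel"
    using test_function_derivative(2)[OF \<psi>] by (rule borel_measurable_continuous_onI)
  have m1: "(\<lambda>x. (indicator W x * f' x) * ?d x) \<in> borel_measurable borel"
    by (rule borel_measurable_times[OF m dm])
  have m2: "(\<lambda>x. (indicator W x * f x) * ?d x) \<in> borel_measurable borel"
    by (rule borel_measurable_times[OF measurable_locally_integrable_on[OF W loc(1)] dm])
  have "(LINT x:W|lborel. f' x * ?d x) = (LINT x:W|lborel. f x * ?d x)"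
    unfolding set_lebesgue_integral_def
  proof (rule integral_cong_AE)
    show "AE x in lborel. indicator W x *\<^sub>R (f' x * ?d x) = indicator W x *\<^sub>R (f x * ?d x)"
      using eq by eventually_elim (auto simp: indicator_def)
  qed (use m1 m2 in \<open>simp_all add: mult.assoc\<close>)
  then show "(LINT x:W|lborel. f' x * ?d x) = - (LINT x:W|lborel. h x * \<psi> x)"
    using f \<psi> unfolding weak_partial_def by simp
qed

text \<open>The difference of the two candidates is a weak derivative of the zero function, hence
  orthogonal to all test functions.\<close>

lemma weak_partial_unique:
  fixes f :: "real^'n::finite \<Rightarrow> real"
  assumes 1: "weak_partial W i f h1" and 2: "weak_partial W i f h2" and W: "open W"
  shows "AE x in lborel. x \<in> W \<longrightarrow> h1 x = h2 x"
proof -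
  have d: "weak_partial W i (\<lambda>x. 1 * f x + (- 1) * f x) (\<lambda>x. 1 * h1 x + (- 1) * h2 x)"
    by (rule weak_partial_lincomb[OF 1 2])
  then have loc: "locally_integrable_on W (\<lambda>x. 1 * h1 x + (- 1) * h2 x)"
    unfolding weak_partial_def by blast
  have "(LINT x:W|lborel. (1 * h1 x + (- 1) * h2 x) * \<psi> x) = 0" if \<psi>: "test_function W \<psi>" for \<psi>
    using d \<psi> unfolding weak_partial_def by (simp add: set_lebesgue_integral_def)
  from weak_zero_imp_AE_zero[OF W loc this] show ?thesis by simp
qed

lemma measurable_det:
  fixes M :: "'a \<Rightarrow> real^'n::finite^'n"
  assumes "\<And>i j. (\<lambda>x. M x $ i $ j) \<in> borel_measurable N"
  shows "(\<lambda>x. det (M x)) \<in> borel_measurable N"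
  unfolding det_def
  by (intro borel_measurable_sum borel_measurable_times borel_measurable_prod assms borel_measurable_const)

context riemannian
begin

lemma weak_gradient_tangent: "weak_gradient A g f X \<Longrightarrow> X p \<in> tangent_space A p"
  unfolding weak_gradient_def by blast

lemma weak_gradient_partial:
  "weak_gradient A g f X \<Longrightarrow> c \<in> A \<Longrightarrow> weak_partial (chart_image c) i (\<lambda>x. f (chart_inv c x))
    (\<lambda>x. g (chart_inv c x) (X (chart_inv c x)) (coord_vector A c i (chart_inv c x)))"
  unfolding weak_gradient_def by blast

lemma weak_gradient_cong_AE:
  assumes X: "weak_gradient A g f X" and f': "f' \<in> borel_measurable borel"
    and eq: "AE p in V. f p = f' p"
  shows "weak_gradient A g f' X"
  unfolding weak_gradient_def
proof (intro conjI allI ballI)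
  show "X p \<in> tangent_space A p" for p using X by (rule weak_gradient_tangent)
  fix c i assume c: "c \<in> A"
  show "weak_partial (chart_image c) i (\<lambda>x. f' (chart_inv c x))
      (\<lambda>x. g (chart_inv c x) (X (chart_inv c x)) (coord_vector A c i (chart_inv c x)))"
    by (rule weak_partial_cong_AE[OF weak_gradient_partial[OF X c] chart_open(2)[OF c]
          measurable_chartD[OF f' c] AE_V_chartD[OF eq c]])
qed

text \<open>In a chart the finitely many weak partial derivatives are unique almost everywhere, and
  by \<open>norm_eq_raise_index\<close> they determine the tangent vector.\<close>

lemma weak_gradient_unique:
  assumes X: "weak_gradient A g f X" and Y: "weak_gradient A g f Y"
  shows "AE p in V. X p = Y p"
proof (rule AE_V_chartI)
  fix c assume c: "c \<in> A"
  have "AE x in lborel. \<forall>i. x \<in> chart_image c \<longrightarrow>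
      g (chart_inv c x) (X (chart_inv c x)) (coord_vector A c i (chart_inv c x))
      = g (chart_inv c x) (Y (chart_inv c x)) (coord_vector A c i (chart_inv c x))"
    unfolding AE_all_countable
    using weak_partial_unique[OF weak_gradient_partial[OF X c] weak_gradient_partial[OF Y c]
        chart_open(2)[OF c]] by blast
  then show "AE x in lborel. x \<in> chart_image c \<longrightarrow> X (chart_inv c x) = Y (chart_inv c x)"
  proof eventually_elim
    case (elim x)
    show ?case
    proof
      assume x: "x \<in> chart_image c"
      then show "X (chart_inv c x) = Y (chart_inv c x)"
        using norm_eq_raise_index(2)[OF c x weak_gradient_tangent[OF X]]
          norm_eq_raise_index(2)[OF c x weak_gradient_tangent[OF Y]] elim by simp
    qed
  qed
qed

lemma weak_gradient_lincomb:
  assumes X: "weak_gradient A g f X" and Y: "weak_gradient A g h Y"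
  shows "weak_gradient A g (\<lambda>p. a * f p + b * h p) (\<lambda>p c. a *\<^sub>R X p c + b *\<^sub>R Y p c)"
  unfolding weak_gradient_def
proof (intro conjI allI ballI)
  note XY = weak_gradient_tangent[OF X] weak_gradient_tangent[OF Y]
  show "(\<lambda>c. a *\<^sub>R X p c + b *\<^sub>R Y p c) \<in> tangent_space A p" for p
    using XY by (rule tangent_space_lincomb)
  fix c i assume c: "c \<in> A"
  let ?q = "chart_inv c"
  have "weak_partial (chart_image c) i (\<lambda>x. a * f (?q x) + b * h (?q x))
      (\<lambda>x. a * g (?q x) (X (?q x)) (coord_vector A c i (?q x))
         + b * g (?q x) (Y (?q x)) (coord_vector A c i (?q x)))"
    by (rule weak_partial_lincomb[OF weak_gradient_partial[OF X c] weak_gradient_partial[OF Y c]])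
  then show "weak_partial (chart_image c) i (\<lambda>x. a * f (?q x) + b * h (?q x))
      (\<lambda>x. g (?q x) (\<lambda>c. a *\<^sub>R X (?q x) c + b *\<^sub>R Y (?q x) c) (coord_vector A c i (?q x)))"
  proof (rule weak_partial_cong)
    fix x assume "x \<in> chart_image c"
    then show "g (?q x) (\<lambda>c. a *\<^sub>R X (?q x) c + b *\<^sub>R Y (?q x) c) (coord_vector A c i (?q x))
        = a * g (?q x) (X (?q x)) (coord_vector A c i (?q x))
        + b * g (?q x) (Y (?q x)) (coord_vector A c i (?q x))"
      unfolding coord_vector_eq
      by (intro inner_lincomb XY tvec_in_tangent_space[OF c chart_inv_in[OF c]])
  qed simp
qed

text \<open>A weak gradient is a map into tangent vectors, where no measurable structure is given.
  In a chart its squared norm is a rational expression in the Gram entries and the weak partial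
  derivatives, all of them Borel.\<close>

lemma measurable_norm_weak_gradient:
  assumes X: "weak_gradient A g f X"
  shows "(\<lambda>p. g p (X p) (X p)) \<in> borel_measurable borel"
proof (rule measurable_chartI)
  fix c assume c: "c \<in> A"
  let ?W = "chart_image c" and ?q = "chart_inv c"
  note Wo = chart_open(2)[OF c]
  define b where "b i x = g (?q x) (X (?q x)) (coord_vector A c i (?q x))" for i x
  \<comment> \<open>The indicators make the entries Borel on the whole space. Off the chart image
    the determinants are irrelevant, since the last factor of each summand below is then 0.\<close>
  define M where "M k x = (\<chi> i j. indicator ?W x * (if j = k then b i x else gram A g c x $ i $ j))" for k x
  define N where "N x = (\<chi> i j. indicator ?W x * gram A g c x $ i $ j)" for x
  have bm: "(\<lambda>x. indicator ?W x * b i x) \<in> borel_measurable borel" for i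
    using weak_gradient_partial[OF X c, of i] Wo unfolding b_def weak_partial_def
    by (intro measurable_locally_integrable_on) auto
  have gm: "(\<lambda>x. indicator ?W x * gram A g c x $ i $ j) \<in> borel_measurable borel" for i j
    using borel_measurable_continuous_on_indicator[OF borel_chart_domain(2)[OF c] continuous_on_gram[OF c]]
    by simp
  have "(\<lambda>x. M k x $ i $ j) \<in> borel_measurable borel" for k i j
    using bm gm by (cases "j = k") (simp_all add: M_def)
  then have dM: "(\<lambda>x. det (M k x)) \<in> borel_measurable borel" for k
    by (rule measurable_det)
  have "(\<lambda>x. N x $ i $ j) \<in> borel_measurable borel" for i j
    using gm by (simp add: N_def)
  then have dN: "(\<lambda>x. det (N x)) \<in> borel_measurable borel"
    by (rule measurable_det)
  have "(\<lambda>x. \<Sum>k\<in>UNIV. det (M k x) / det (N x) * (indicator ?W x * b k x)) \<in> borel_measurable borel"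
    by (intro borel_measurable_sum borel_measurable_times borel_measurable_divide dM dN bm)
  moreover have "(\<Sum>k\<in>UNIV. det (M k x) / det (N x) * (indicator ?W x * b k x))
      = indicator ?W x * g (?q x) (X (?q x)) (X (?q x))" for x
  proof (cases "x \<in> ?W")
    case True
    then have "M k x = (\<chi> i j. if j = k then (\<chi> i. b i x) $ i else gram A g c x $ i $ j)" "N x = gram A g c x" for k
      by (simp_all add: M_def N_def vec_eq_iff)
    then have "det (M k x) / det (N x) = raise_index c x (\<chi> i. b i x) $ k" for k
      by (simp add: raise_index_def)
    then show ?thesis
      using norm_eq_raise_index(1)[OF c True weak_gradient_tangent[OF X]] True
      by (simp add: inner_vec_def b_def)
  qed simp
  ultimately show "(\<lambda>x. indicator ?W x * g (?q x) (X (?q x)) (X (?q x))) \<in> borel_measurable borel"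
    by simp
qed

end

section \<open>A function of finite energy with nonzero mean\<close>

context riemannian
begin

context
  fixes c :: "('m, 'n) chart" and a b :: "real^'n"
  assumes c: "c \<in> A" and cb: "cbox a b \<subseteq> chart_image c" and le: "\<And>i. a $ i \<le> b $ i"
begin

definition chart_bump :: "'m \<Rightarrow> real"
  where "chart_bump p = (if p \<in> fst c then bump a b 1 (snd c p) else 0)"

definition bump_differential :: "real^'n \<Rightarrow> real^'n"
  where "bump_differential x = (\<chi> i. frechet_derivative (bump a b 1) (at x) (axis i 1))"

text \<open>The differential with its index raised by the metric, that is, the classical gradient of
  \<open>chart_bump\<close>, extended by 0 outside the chart.\<close>

definition bump_gradient :: "'m \<Rightarrow> ('m, 'n) tangent"
  where "bump_gradient p = (if p \<in> fst c
    then tvec c p (raise_index c (snd c p) (bump_differential (snd c p))) else (\<lambda>c. 0))"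

lemma test_bump: "test_function (chart_image c) (bump a b 1)"
  by (rule test_function_bump[OF le _ cb]) simp

lemmas bump_derivative = test_function_derivative[OF test_bump]

lemma bump_differential_inner:
  "frechet_derivative (bump a b 1) (at x) v = bump_differential x \<bullet> v"
  using linear_real_vec_sum[OF has_derivative_linear[OF bump_derivative(1)], of x v]
  by (simp add: bump_differential_def inner_vec_def mult.commute)

lemma bump_differential_outside: "x \<notin> cbox a b \<Longrightarrow> bump_differential x = 0"
proof -
  assume x: "x \<notin> cbox a b"
  have "((\<lambda>x. 0) has_derivative (\<lambda>v. 0)) (at x)" by simp
  then have "(bump a b 1 has_derivative (\<lambda>v. 0)) (at x)"
  proof (rule has_derivative_transform_within_open)
    show "open (- cbox a b)" by (rule open_Compl[OF closed_cbox])
    show "x \<in> - cbox a b" using x by simp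
    fix y assume "y \<in> - cbox a b"
    then have "y \<notin> box a b" using box_subset_cbox[of a b] by blast
    then show "0 = bump a b 1 y" using bump_eq_0[OF le, of 1 y] by simp
  qed
  then have "frechet_derivative (bump a b 1) (at x) = (\<lambda>v. 0)"
    using frechet_derivative_at by metis
  then show "bump_differential x = 0"
    by (simp add: bump_differential_def vec_eq_iff)
qed

definition bump_support :: "'m set"
  where "bump_support = chart_inv c ` cbox a b"

lemma compact_bump_support: "compact bump_support"
  unfolding bump_support_def
  using continuous_on_subset[OF continuous_on_chart_inv[OF c] cb] by (intro compact_continuous_image) auto

lemma bump_support_subset: "bump_support \<subseteq> fst c"
  using cb chart_inv_in[OF c] by (auto simp: bump_support_def)

lemma chart_in_support:
  assumes "p \<in> fst c" "snd c p \<in> cbox a b"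
  shows "p \<in> bump_support"
  unfolding bump_support_def using assms chart_inv_chart[OF c, of p] by (metis imageI)

lemma raise_index_0: "x \<in> chart_image c \<Longrightarrow> raise_index c x 0 = 0"
  using gram_raise_index[OF c, of x 0 0] by simp

lemma bump_outside:
  assumes "p \<notin> bump_support"
  shows "chart_bump p = 0" "bump_gradient p = (\<lambda>c. 0)"
proof -
  have out: "snd c p \<notin> cbox a b" if "p \<in> fst c" using chart_in_support that assms by blast
  then show "chart_bump p = 0"
    using bump_eq_0[OF le, of 1 "snd c p"] box_subset_cbox[of a b] by (auto simp: chart_bump_def)
  show "bump_gradient p = (\<lambda>c. 0)"
  proof (cases "p \<in> fst c")
    case True
    then have "raise_index c (snd c p) (bump_differential (snd c p)) = 0"
      using bump_differential_outside[OF out[OF True]] raise_index_0 chart_in[OF c] by simp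
    then show ?thesis
      using True tvec_scale[OF c True, of 0 0] by (simp add: bump_gradient_def)
  qed (simp add: bump_gradient_def)
qed

lemma bump_gradient_tangent: "bump_gradient p \<in> tangent_space A p"
  using tvec_in_tangent_space[OF c] tangent_space_zero by (simp add: bump_gradient_def)

text \<open>A weak gradient is tested in every chart, not only in the one that carries the bump. The
  support is compact, hence closed in the Hausdorff space, so the image of \<open>c'\<close> is
  covered by two open sets: the overlap, where the chain rule applies, and the complement of the
  support, where everything is 0.\<close>

lemma bump_in_chart:
  assumes c': "c' \<in> A"
  defines "D \<equiv> \<lambda>x v. if x \<in> overlap c' c
      then bump_differential (transition c' c x) \<bullet> dtrans c' c x v else 0"
  shows "x \<in> chart_image c' \<Longrightarrow> ((\<lambda>x. chart_bump (chart_inv c' x)) has_derivative D x) (at x)"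
    and "continuous_on (chart_image c') (\<lambda>x. D x v)"
    and "x \<in> chart_image c' \<Longrightarrow>
      g (chart_inv c' x) (bump_gradient (chart_inv c' x)) (coord_vector A c' i (chart_inv c' x)) = D x (axis i 1)"
proof -
  let ?\<tau> = "transition c' c"
  define R where "R = chart_image c' \<inter> chart_inv c' -` (- bump_support)"
  have R: "open R"
    unfolding R_def using compact_bump_support
    by (intro continuous_open_preimage continuous_on_chart_inv[OF c'] chart_open(2)[OF c'])
      (simp add: compact_imp_closed open_Compl)
  have cover: "chart_image c' = overlap c' c \<union> R"
    unfolding overlap_eq[OF c'] R_def using bump_support_subset by blast
  have D_R: "D x = (\<lambda>v. 0)" if x: "x \<in> R" for x
  proof (cases "x \<in> overlap c' c")
    case True
    then have p: "chart_inv c' x \<in> fst c" using overlap_eq[OF c'] by blast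
    have "?\<tau> x \<notin> cbox a b"
      using chart_in_support[OF p] x by (auto simp: transition_def R_def)
    then show ?thesis by (simp add: D_def bump_differential_outside fun_eq_iff)
  qed (simp add: D_def)
  show "((\<lambda>x. chart_bump (chart_inv c' x)) has_derivative D x) (at x)" if x: "x \<in> chart_image c'" for x
  proof (cases "x \<in> overlap c' c")
    case True
    have "(bump a b 1 \<circ> ?\<tau> has_derivative
        frechet_derivative (bump a b 1) (at (?\<tau> x)) \<circ> dtrans c' c x) (at x)"
      by (rule diff_chain_at[OF transition_derivative[OF c' c True] bump_derivative(1)])
    then have "((\<lambda>x. chart_bump (chart_inv c' x)) has_derivative
        frechet_derivative (bump a b 1) (at (?\<tau> x)) \<circ> dtrans c' c x) (at x)"
    proof (rule has_derivative_transform_within_open[OF _ open_overlap[OF c' c] True])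
      fix y assume "y \<in> overlap c' c"
      then have "chart_inv c' y \<in> fst c" using overlap_eq[OF c'] by blast
      then show "(bump a b 1 \<circ> ?\<tau>) y = chart_bump (chart_inv c' y)"
        by (simp add: chart_bump_def transition_def)
    qed
    moreover have "frechet_derivative (bump a b 1) (at (?\<tau> x)) \<circ> dtrans c' c x = D x"
      using True by (simp add: D_def fun_eq_iff bump_differential_inner)
    ultimately show ?thesis by simp
  next
    case False
    then have xR: "x \<in> R" using x cover by blast
    have "((\<lambda>x. 0) has_derivative (\<lambda>v. 0)) (at x)" by simp
    then have "((\<lambda>x. chart_bump (chart_inv c' x)) has_derivative (\<lambda>v. 0)) (at x)"
      by (rule has_derivative_transform_within_open[OF _ R xR]) (simp add: R_def bump_outside)
    then show ?thesis using D_R[OF xR] by simp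
  qed
  show "continuous_on (chart_image c') (\<lambda>x. D x v)"
    unfolding cover
  proof (rule continuous_on_open_Un[OF open_overlap[OF c' c] R])
    have cd: "continuous_on (overlap c' c) (\<lambda>x. bump_differential (?\<tau> x) $ i)" for i
    proof -
      have "continuous_on (overlap c' c) ?\<tau>"
        using transition_derivative[OF c' c]
        by (meson continuous_at_imp_continuous_on has_derivative_continuous)
      from continuous_on_compose2[OF bump_derivative(2) this] show ?thesis
        by (simp add: bump_differential_def)
    qed
    have "continuous_on (overlap c' c) (\<lambda>x. \<Sum>i\<in>UNIV. bump_differential (?\<tau> x) $ i * dtrans c' c x v $ i)"
      by (intro continuous_on_sum continuous_on_mult cd continuous_on_component continuous_on_dtrans[OF c' c])
    then show "continuous_on (overlap c' c) (\<lambda>x. D x v)"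
      by (rule continuous_on_eq) (simp add: D_def inner_vec_def)
    show "continuous_on R (\<lambda>x. D x v)"
      by (rule continuous_on_eq[OF continuous_on_const[of _ 0]]) (simp add: D_R)
  qed
  show "g (chart_inv c' x) (bump_gradient (chart_inv c' x)) (coord_vector A c' i (chart_inv c' x)) = D x (axis i 1)"
    if x: "x \<in> chart_image c'" for x i
  proof (cases "x \<in> overlap c' c")
    case True
    define p where "p = chart_inv c' x"
    have p: "p \<in> fst c'" "p \<in> fst c" "snd c' p = x"
      using True x chart_inv_in[OF c' x] chart_chart_inv[OF c' x]
      unfolding overlap_eq[OF c'] by (simp_all add: p_def)
    have y: "snd c p \<in> chart_image c" "chart_inv c (snd c p) = p" "?\<tau> x = snd c p"
      using chart_in[OF c p(2)] chart_inv_chart[OF c p(2)] by (simp_all add: transition_def p_def)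
    have "coord_vector A c' i p = tvec c p (dtrans c' c x (axis i 1))"
      using tvec_change[OF c' c p(1,2)] by (simp add: coord_vector_eq p(3))
    then have "g p (bump_gradient p) (coord_vector A c' i p)
        = bump_differential (snd c p) \<bullet> dtrans c' c x (axis i 1)"
      using inner_tvec_raise_index[OF c y(1)] p(2) by (simp add: y(2) bump_gradient_def)
    then show ?thesis using True by (simp add: D_def p_def[symmetric] y(3))
  next
    case False
    then have "chart_inv c' x \<notin> bump_support"
      using x overlap_eq[OF c'] bump_support_subset by blast
    then show ?thesis
      using False tvec_in_tangent_space[OF c' chart_inv_in[OF c' x]]
      by (simp add: bump_outside D_def inner_zero coord_vector_eq)
  qed
qed

lemma weak_gradient_bump: "weak_gradient A g chart_bump bump_gradient"
  unfolding weak_gradient_def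
proof (intro conjI allI ballI)
  show "bump_gradient p \<in> tangent_space A p" for p by (rule bump_gradient_tangent)
  fix c' i assume c': "c' \<in> A"
  show "weak_partial (chart_image c') i (\<lambda>x. chart_bump (chart_inv c' x))
      (\<lambda>x. g (chart_inv c' x) (bump_gradient (chart_inv c' x)) (coord_vector A c' i (chart_inv c' x)))"
    by (rule weak_partial_cong[OF weak_partial_classical[OF chart_open(2)[OF c']
            bump_in_chart(1)[OF c'] bump_in_chart(2)[OF c']]])
      (simp_all add: bump_in_chart(3)[OF c'])
qed

lemma measurable_chart_bump: "chart_bump \<in> borel_measurable borel"
proof (rule measurable_chartI)
  fix c' assume c': "c' \<in> A"
  have "continuous_on (chart_image c') (\<lambda>x. chart_bump (chart_inv c' x))"
    using bump_in_chart(1)[OF c'] by (meson continuous_at_imp_continuous_on has_derivative_continuous)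
  from borel_measurable_continuous_on_indicator[OF borel_chart_domain(2)[OF c'] this]
  show "(\<lambda>x. indicator (chart_image c') x * chart_bump (chart_inv c' x)) \<in> borel_measurable borel"
    by simp
qed

lemma norm_bump_gradient_bounded:
  obtains B where "0 \<le> B" "\<And>p. g p (bump_gradient p) (bump_gradient p) \<le> B"
proof -
  let ?n = "\<lambda>x. \<Sum>i\<in>UNIV. bump_differential x $ i * raise_index c x (bump_differential x) $ i"
  have cd: "continuous_on S (\<lambda>x. bump_differential x $ i)" for S i
    using continuous_on_subset[OF bump_derivative(2)] by (simp add: bump_differential_def)
  have cn: "continuous_on (chart_image c) ?n"
    by (intro continuous_on_sum continuous_on_mult cd continuous_on_raise_index c)
  have "compact (?n ` cbox a b)"
    by (rule compact_continuous_image[OF continuous_on_subset[OF cn cb] compact_cbox])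
  then obtain B where B: "\<And>x. x \<in> cbox a b \<Longrightarrow> \<bar>?n x\<bar> \<le> B"
    using compact_imp_bounded[of "?n ` cbox a b"] by (auto simp: bounded_iff)
  show thesis
  proof (rule that[of "max 0 B"])
    fix p
    show "g p (bump_gradient p) (bump_gradient p) \<le> max 0 B"
    proof (cases "p \<in> bump_support")
      case True
      then obtain x where x: "x \<in> cbox a b" "p = chart_inv c x" by (auto simp: bump_support_def)
      have xc: "x \<in> chart_image c" using x(1) cb by blast
      have "g p (bump_gradient p) (bump_gradient p) = ?n x"
        using inner_tvec_raise_index[OF c xc] chart_inv_in[OF c xc] chart_chart_inv[OF c xc]
        by (simp add: bump_gradient_def x(2) inner_vec_def)
      then show ?thesis using B[OF x(1)] by simp
    next
      case False
      then show ?thesis using inner_zero[OF tangent_space_zero] by (simp add: bump_outside)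
    qed
  qed simp
qed

lemma emeasure_bump_support: "bump_support \<in> sets borel" "emeasure V bump_support < \<infinity>"
proof -
  show b: "bump_support \<in> sets borel"
    using compact_bump_support by (simp add: compact_imp_closed)
  have "snd c ` bump_support = cbox a b"
    using cb chart_chart_inv[OF c] by (force simp: bump_support_def image_image subset_iff)
  then have "emeasure V bump_support = (\<integral>\<^sup>+x\<in>cbox a b. ennreal (vol_density c x) \<partial>lborel)"
    using emeasure_V_chart[OF c b bump_support_subset] by simp
  also have "\<dots> = (\<integral>\<^sup>+x. ennreal (indicator (cbox a b) x *\<^sub>R sqrt (det (gram A g c x))) \<partial>lborel)"
    using cb by (intro nn_integral_cong) (auto simp: indicator_def vol_density_def)
  also have "\<dots> \<le> (\<integral>\<^sup>+x. ennreal (norm (indicator (cbox a b) x *\<^sub>R sqrt (det (gram A g c x)))) \<partial>lborel)"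
    by (intro nn_integral_mono ennreal_leI) simp
  also have "\<dots> < \<infinity>"
  proof -
    have "integrable lborel (\<lambda>x. indicator (cbox a b) x *\<^sub>R sqrt (det (gram A g c x)))"
      by (intro borel_integrable_compact continuous_on_real_sqrt
          continuous_on_subset[OF continuous_on_det_gram[OF c] cb]) auto
    then show ?thesis by (simp add: integrable_iff_bounded)
  qed
  finally show "emeasure V bump_support < \<infinity>" .
qed

lemma chart_bump_bounds: "0 \<le> chart_bump p" "chart_bump p \<le> 1"
  by (simp_all add: chart_bump_def bump_bounds)

lemma chart_bump_not_AE_0:
  assumes x: "x0 \<in> box a b"
  shows "\<not> (AE p in V. chart_bump p = 0)"
proof
  assume "AE p in V. chart_bump p = 0"
  then have "AE x in lborel. x \<in> chart_image c \<longrightarrow> chart_bump (chart_inv c x) = 0"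
    by (rule AE_V_chartD[OF _ c])
  then have "AE x in lborel. x \<notin> box a b"
  proof eventually_elim
    case (elim x)
    show ?case
    proof
      assume x: "x \<in> box a b"
      then have "x \<in> chart_image c" using cb box_subset_cbox[of a b] by blast
      then show False
        using elim bump_pos[OF _ x, of 1] chart_inv_in[OF c] chart_chart_inv[OF c]
        by (simp add: chart_bump_def)
    qed
  qed
  then have "emeasure lborel (box a b) = 0"
    by (subst (asm) AE_iff_null_sets[symmetric]) auto
  moreover have "0 < (\<Prod>i\<in>UNIV. b $ i - a $ i)"
    using x unfolding mem_box_cart by (intro prod_pos) (metis diff_gt_0_iff_gt order.strict_trans)
  ultimately show False using emeasure_lborel_box_cart[of a b] le by (metis ennreal_eq_0_iff not_le)
qed

end

text \<open>Bounds on function and gradient and a support of finite volume are what make the energy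
  finite for \<open>\<mu>\<close> and the Sobolev norm finite for the volume; not vanishing almost
  everywhere later gives a nonzero mean.\<close>

lemma finite_energy_function:
  obtains u X B K where "u \<in> borel_measurable borel" "\<And>p. 0 \<le> u p" "\<And>p. u p \<le> 1"
    "weak_gradient A g u X" "0 \<le> B" "\<And>p. g p (X p) (X p) \<le> B"
    "K \<in> sets borel" "emeasure V K < \<infinity>" "\<And>p. p \<notin> K \<Longrightarrow> u p = 0" "\<And>p. p \<notin> K \<Longrightarrow> X p = (\<lambda>c. 0)"
    "\<not> (AE p in V. u p = 0)"
proof -
  \<comment> \<open>Any base point serves; \<open>undefined\<close> names one.\<close>
  obtain c where c: "c \<in> A" "undefined \<in> fst c" by (rule chart_covers)
  have "snd c undefined \<in> chart_image c" by (rule chart_in[OF c])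
  then obtain a b where ab: "cbox a b \<subseteq> chart_image c" "snd c undefined \<in> box a b"
    using open_contains_cbox[OF chart_open(2)[OF c(1)]] by metis
  have le: "a $ i \<le> b $ i" for i
    using ab(2) unfolding mem_box_cart by (meson less_imp_le order.strict_trans)
  obtain B where B: "0 \<le> B" "\<And>p. g p (bump_gradient c a b p) (bump_gradient c a b p) \<le> B"
    using norm_bump_gradient_bounded[OF c(1) ab(1) le] by blast
  show thesis
    by (rule that[OF measurable_chart_bump[OF c(1) ab(1) le] chart_bump_bounds[OF c(1) ab(1) le]
          weak_gradient_bump[OF c(1) ab(1) le] B emeasure_bump_support[OF c(1) ab(1) le]
          bump_outside[OF c(1) ab(1) le] chart_bump_not_AE_0[OF c(1) ab(1) le ab(2)]])
qed

end

section \<open>Classes of square-integrable functions\<close>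

lemma square_integrableI:
  "f \<in> borel_measurable M \<Longrightarrow> integrable M (\<lambda>x. (f x)\<^sup>2) \<Longrightarrow> f \<in> square_integrable M"
  and square_integrableD: "f \<in> square_integrable M \<Longrightarrow> f \<in> borel_measurable M"
    "f \<in> square_integrable M \<Longrightarrow> integrable M (\<lambda>x. (f x)\<^sup>2)"
  by (auto simp: square_integrable_def)

lemma square_lincomb_le: "(a * x + b * y)\<^sup>2 \<le> 2 * a\<^sup>2 * x\<^sup>2 + 2 * b\<^sup>2 * y\<^sup>2" for a b x y :: real
proof -
  have "0 \<le> (a * x - b * y)\<^sup>2" by simp
  then show ?thesis by (simp add: power2_eq_square algebra_simps)
qed

lemma square_integrable_lincomb:
  assumes f: "f \<in> square_integrable M" and h: "h \<in> square_integrable M"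
  shows "(\<lambda>x. a * f x + b * h x) \<in> square_integrable M"
proof (rule square_integrableI)
  have [measurable]: "f \<in> borel_measurable M" "h \<in> borel_measurable M"
    using f h by (simp_all add: square_integrableD)
  show "(\<lambda>x. a * f x + b * h x) \<in> borel_measurable M" by measurable
  have i: "integrable M (\<lambda>x. 2 * a\<^sup>2 * (f x)\<^sup>2 + 2 * b\<^sup>2 * (h x)\<^sup>2)"
    using f h by (intro Bochner_Integration.integrable_add integrable_mult_right square_integrableD)
  show "integrable M (\<lambda>x. (a * f x + b * h x)\<^sup>2)"
  proof (rule Bochner_Integration.integrable_bound[OF i])
    show "(\<lambda>x. (a * f x + b * h x)\<^sup>2) \<in> borel_measurable M" by measurable
    show "AE x in M. norm ((a * f x + b * h x)\<^sup>2) \<le> norm (2 * a\<^sup>2 * (f x)\<^sup>2 + 2 * b\<^sup>2 * (h x)\<^sup>2)"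
      using square_lincomb_le by (intro AE_I2) (simp add: abs_of_nonneg)
  qed
qed

lemma square_integrable_cong_AE:
  assumes f: "f \<in> square_integrable M" and h: "h \<in> borel_measurable M" and eq: "AE x in M. f x = h x"
  shows "h \<in> square_integrable M"
proof (rule square_integrableI[OF h])
  show "integrable M (\<lambda>x. (h x)\<^sup>2)"
  proof (rule integrable_cong_AE_imp[OF square_integrableD(2)[OF f]])
    show "(\<lambda>x. (h x)\<^sup>2) \<in> borel_measurable M" using h by simp
    show "AE x in M. (f x)\<^sup>2 = (h x)\<^sup>2" using eq by eventually_elim simp
  qed
qed

lemma (in prob_space) square_integrable_integrable:
  assumes "f \<in> square_integrable M"
  shows "integrable M f"
  by (rule square_integrable_imp_integrable[OF square_integrableD(1,2)[OF assms]])

lemma equiv_ae_equal: "equiv (square_integrable M) (ae_equal M)"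
proof (rule equivI)
  show "ae_equal M \<subseteq> square_integrable M \<times> square_integrable M" by (auto simp: ae_equal_def)
  show "refl_on (square_integrable M) (ae_equal M)" by (auto simp: refl_on_def ae_equal_def)
  show "sym (ae_equal M)" by (auto simp: sym_def ae_equal_def elim: AE_mp)
  show "trans (ae_equal M)" by (auto simp: trans_def ae_equal_def elim: AE_mp)
qed

definition L2_class :: "'x measure \<Rightarrow> ('x \<Rightarrow> real) \<Rightarrow> ('x \<Rightarrow> real) set"
  where "L2_class M f = ae_equal M `` {f}"

lemma L2_class_in_L2: "f \<in> square_integrable M \<Longrightarrow> L2_class M f \<in> L2 M"
  unfolding L2_def L2_class_def by (rule quotientI)

lemma rep_L2_class:
  assumes "f \<in> square_integrable M"
  shows "rep (L2_class M f) \<in> square_integrable M" "AE x in M. rep (L2_class M f) x = f x"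
proof -
  have "f \<in> L2_class M f"
    unfolding L2_class_def using equiv_class_self[OF equiv_ae_equal assms] .
  then have "rep (L2_class M f) \<in> L2_class M f"
    unfolding rep_def by (rule someI[of "\<lambda>f'. f' \<in> L2_class M f"])
  then have *: "(f, rep (L2_class M f)) \<in> ae_equal M" by (simp add: L2_class_def)
  then show "rep (L2_class M f) \<in> square_integrable M" by (simp add: ae_equal_def)
  have "AE x in M. f x = rep (L2_class M f) x" using * by (simp add: ae_equal_def)
  then show "AE x in M. rep (L2_class M f) x = f x" by eventually_elim simp
qed

lemma rep_in_L2:
  assumes "F \<in> L2 M"
  shows "rep F \<in> square_integrable M" "L2_class M (rep F) = F"
proof -
  obtain f where f: "f \<in> square_integrable M" "F = L2_class M f"
    using assms unfolding L2_def L2_class_def by (rule quotientE)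
  show s: "rep F \<in> square_integrable M" using rep_L2_class(1)[OF f(1)] f(2) by simp
  have "AE x in M. f x = rep F x"
    using rep_L2_class(2)[OF f(1)] unfolding f(2) by eventually_elim simp
  then have "(f, rep F) \<in> ae_equal M" using f(1) s by (simp add: ae_equal_def)
  from equiv_class_eq[OF equiv_ae_equal this] show "L2_class M (rep F) = F"
    by (simp add: f(2) L2_class_def)
qed

lemma L2_dist_sq: "(L2_dist M F H)\<^sup>2 = (\<integral>x. (rep F x - rep H x)\<^sup>2 \<partial>M)"
  by (simp add: L2_dist_def)

lemma L2_dist_cong:
  assumes "F \<in> L2 M" "H \<in> L2 M" "f \<in> borel_measurable M" "h \<in> borel_measurable M"
    "AE x in M. rep F x = f x" "AE x in M. rep H x = h x"
  shows "(\<integral>x. (rep F x - rep H x)\<^sup>2 \<partial>M) = (\<integral>x. (f x - h x)\<^sup>2 \<partial>M)"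
proof (rule integral_cong_AE)
  have [measurable]: "rep F \<in> borel_measurable M" "rep H \<in> borel_measurable M"
    "f \<in> borel_measurable M" "h \<in> borel_measurable M"
    using assms rep_in_L2(1) square_integrableD(1) by blast+
  show "(\<lambda>x. (rep F x - rep H x)\<^sup>2) \<in> borel_measurable M" "(\<lambda>x. (f x - h x)\<^sup>2) \<in> borel_measurable M"
    by measurable
  show "AE x in M. (rep F x - rep H x)\<^sup>2 = (f x - h x)\<^sup>2"
    using assms(5,6) by eventually_elim simp
qed

text \<open>This takes the place of uniqueness of geodesics: a given geodesic is only ever compared
  with the segment at time 1/2.\<close>

lemma L2_midpoint:
  assumes F: "F \<in> L2 M" and G: "G \<in> L2 M" and H: "H \<in> L2 M"
    and d: "L2_dist M F G = L2_dist M F H / 2" "L2_dist M G H = L2_dist M F H / 2"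
  shows "AE x in M. rep G x = (1/2) * rep F x + (1/2) * rep H x"
proof -
  let ?f = "rep F" and ?g = "rep G" and ?h = "rep H"
  note s = rep_in_L2(1)[OF F] rep_in_L2(1)[OF G] rep_in_L2(1)[OF H]
  have diff: "(\<lambda>x. u x - v x) \<in> square_integrable M"
    if "u \<in> square_integrable M" "v \<in> square_integrable M" for u v
    using square_integrable_lincomb[OF that, of 1 "- 1"] by simp
  note i = diff[OF s(1,2), THEN square_integrableD(2)] diff[OF s(2,3), THEN square_integrableD(2)]
    diff[OF s(1,3), THEN square_integrableD(2)]
  have di: "(\<lambda>x. (?f x - ?g x) - (?g x - ?h x)) \<in> square_integrable M"
    by (rule diff[OF diff[OF s(1,2)] diff[OF s(2,3)]])
  \<comment> \<open>The two differences have sum \<open>f - h\<close> and are both half as long; the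
    parallelogram law leaves nothing for their difference \<open>f - 2 * g + h\<close>.\<close>
  have "(\<integral>x. ((?f x - ?g x) - (?g x - ?h x))\<^sup>2 \<partial>M)
      = (\<integral>x. 2 * (?f x - ?g x)\<^sup>2 + 2 * (?g x - ?h x)\<^sup>2 - (?f x - ?h x)\<^sup>2 \<partial>M)"
    by (intro Bochner_Integration.integral_cong) (simp_all add: power2_eq_square algebra_simps)
  also have "\<dots> = 2 * (L2_dist M F G)\<^sup>2 + 2 * (L2_dist M G H)\<^sup>2 - (L2_dist M F H)\<^sup>2"
    unfolding L2_dist_sq using i by simp
  also have "\<dots> = 0" by (simp add: d power_divide)
  finally have "AE x in M. ((?f x - ?g x) - (?g x - ?h x))\<^sup>2 = 0"
    by (subst (asm) integral_nonneg_eq_0_iff_AE[OF square_integrableD(2)[OF di]]) auto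
  then show ?thesis by eventually_elim simp
qed

section \<open>The Dirichlet energy\<close>

locale weighted_riemannian = riemannian A g
  for A :: "('m::{t2_space, second_countable_topology}, 'n::finite) chart set"
    and g :: "('m, 'n) metric_tensor" +
  fixes w :: "'m \<Rightarrow> real" and \<mu> :: "'m measure"
  assumes w_measurable: "w \<in> borel_measurable borel" and w_pos: "\<And>p. 0 < w p"
    and mu_eq: "\<mu> = density V (\<lambda>p. ennreal (w p))" and prob: "prob_space \<mu>"
begin

sublocale prob_space \<mu> by (rule prob)

lemma sets_mu [simp, measurable_cong]: "sets \<mu> = sets borel"
  by (simp add: mu_eq)

lemma space_mu [simp]: "space \<mu> = UNIV"
  by (simp add: mu_eq)

lemma measurable_mu [simp]: "measurable \<mu> N = measurable borel N"
  and measurable_V [simp]: "measurable V N = measurable borel N"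
  by (rule measurable_cong_sets; simp)+

text \<open>The density is strictly positive. This is the bridge between notions taken with the
  volume, such as \<open>H1\<close> and uniqueness of gradients, and those taken with
  \<open>\<mu>\<close>.\<close>

lemma AE_mu_iff: "(AE p in \<mu>. P p) \<longleftrightarrow> (AE p in V. P p)"
  unfolding mu_eq using w_measurable by (subst AE_density) (simp_all add: w_pos)

abbreviation energy :: "('m \<Rightarrow> real) \<Rightarrow> ennreal"
  where "energy \<equiv> dirichlet_energy A g \<mu>"

abbreviation energy_domain :: "('m \<Rightarrow> real) set"
  where "energy_domain \<equiv> square_integrable \<mu> \<inter> H1 A g"

lemma nn_integral_norm_gradient:
  assumes "weak_gradient A g f X"
  shows "(\<integral>\<^sup>+p. ennreal ((tangent_norm g p (X p))\<^sup>2) \<partial>N) = (\<integral>\<^sup>+p. ennreal (g p (X p) (X p)) \<partial>N)"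
  using tangent_norm_sq[OF weak_gradient_tangent[OF assms]] by simp

lemma H1I:
  assumes "f \<in> square_integrable V" "weak_gradient A g f X" "(\<integral>\<^sup>+p. ennreal (g p (X p) (X p)) \<partial>V) < \<infinity>"
  shows "f \<in> H1 A g"
  unfolding H1_def using assms nn_integral_norm_gradient[OF assms(2), of V] by auto

lemma H1_gradient:
  assumes "f \<in> H1 A g"
  obtains X where "weak_gradient A g f X" "(\<integral>\<^sup>+p. ennreal (g p (X p) (X p)) \<partial>V) < \<infinity>"
proof -
  obtain X where X: "weak_gradient A g f X"
      "(\<integral>\<^sup>+p. ennreal ((tangent_norm g p (X p))\<^sup>2) \<partial>V) < \<infinity>"
    using assms unfolding H1_def by blast
  show thesis
    by (rule that[OF X(1)]) (use X(2) nn_integral_norm_gradient[OF X(1), of V] in simp)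
qed

text \<open>The definition uses the gradient picked by \<open>SOME\<close>; uniqueness almost
  everywhere permits any weak gradient instead.\<close>

lemma energy_eq:
  assumes f: "f \<in> energy_domain" and X: "weak_gradient A g f X"
  shows "energy f = (\<integral>\<^sup>+p. ennreal (g p (X p) (X p)) \<partial>\<mu>)"
proof -
  have grad: "weak_gradient A g f (grad A g f)"
    unfolding grad_def using X by (rule someI[of "weak_gradient A g f"])
  have "AE p in \<mu>. grad A g f p = X p"
    unfolding AE_mu_iff by (rule weak_gradient_unique[OF grad X])
  then have "AE p in \<mu>. ennreal (g p (grad A g f p) (grad A g f p)) = ennreal (g p (X p) (X p))"
    by eventually_elim simp
  then have "(\<integral>\<^sup>+p. ennreal (g p (grad A g f p) (grad A g f p)) \<partial>\<mu>)
      = (\<integral>\<^sup>+p. ennreal (g p (X p) (X p)) \<partial>\<mu>)"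
    by (rule nn_integral_cong_AE)
  then show ?thesis
    using f nn_integral_norm_gradient[OF grad] by (simp add: dirichlet_energy_def)
qed

lemma energy_finiteD:
  assumes "energy f < \<infinity>"
  shows "f \<in> energy_domain"
proof (rule ccontr)
  assume "f \<notin> energy_domain"
  then have "energy f = \<infinity>" unfolding dirichlet_energy_def by (rule if_not_P)
  then show False using assms by simp
qed

text \<open>\<open>dirichlet_functional\<close> evaluates the energy at an arbitrary representative
  of a class, so this is what makes it a function of the class.\<close>

lemma energy_cong_AE:
  assumes f: "f \<in> borel_measurable borel" and h: "h \<in> borel_measurable borel" and eq: "AE p in \<mu>. f p = h p"
  shows "energy f = energy h"
proof -
  \<comment> \<open>Membership in the domain has to be transferred as well. One direction suffices,
    since the situation is symmetric in \<open>f\<close> and \<open>h\<close>.\<close>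
  have half: "h \<in> energy_domain \<and> energy f = energy h"
    if f: "f \<in> energy_domain" and h: "h \<in> borel_measurable borel" and eq: "AE p in \<mu>. f p = h p" for f h
  proof -
    have eqV: "AE p in V. f p = h p" using eq by (simp add: AE_mu_iff)
    obtain X where X: "weak_gradient A g f X" "(\<integral>\<^sup>+p. ennreal (g p (X p) (X p)) \<partial>V) < \<infinity>"
      using f H1_gradient by blast
    have hX: "weak_gradient A g h X"
      by (rule weak_gradient_cong_AE[OF X(1) h eqV])
    have "f \<in> square_integrable V" using f by (simp add: H1_def)
    then have "h \<in> square_integrable V"
      by (rule square_integrable_cong_AE) (simp_all add: h eqV)
    then have "h \<in> H1 A g" using hX X(2) by (rule H1I)
    moreover have "h \<in> square_integrable \<mu>"
      by (rule square_integrable_cong_AE[of f]) (use f h eq in simp_all)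
    ultimately have dom: "h \<in> energy_domain" by simp
    then show ?thesis using energy_eq[OF f X(1)] energy_eq[OF dom hX] by simp
  qed
  have eq': "AE p in \<mu>. h p = f p" using eq by eventually_elim simp
  show ?thesis
  proof (cases "f \<in> energy_domain")
    case True
    then show ?thesis using half[OF _ h eq] by blast
  next
    case False
    then have "h \<notin> energy_domain" using half[OF _ f eq'] by blast
    then show ?thesis using False unfolding dirichlet_energy_def by (simp only: if_False)
  qed
qed

section \<open>The energy as a quadratic form\<close>

lemma measurable_norm:
  assumes "weak_gradient A g f X"
  shows "(\<lambda>p. ennreal (g p (X p) (X p))) \<in> borel_measurable borel"
  using measurable_norm_weak_gradient[OF assms] by simp

text \<open>The form is nonnegative at \<open>a X - b Y\<close>, and this bounds the mixed
  term.\<close>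

lemma norm_lincomb_le:
  assumes X: "X \<in> tangent_space A p" and Y: "Y \<in> tangent_space A p"
  shows "g p (\<lambda>c. a *\<^sub>R X c + b *\<^sub>R Y c) (\<lambda>c. a *\<^sub>R X c + b *\<^sub>R Y c)
    \<le> 2 * a\<^sup>2 * g p X X + 2 * b\<^sup>2 * g p Y Y"
proof -
  have "0 \<le> a\<^sup>2 * g p X X + 2 * a * (- b) * g p X Y + (- b)\<^sup>2 * g p Y Y"
    using inner_nonneg[OF tangent_space_lincomb[OF X Y, of a "- b"]]
    unfolding norm_lincomb[OF X Y, of a "- b"] .
  then show ?thesis
    unfolding norm_lincomb[OF X Y, of a b] by (simp add: algebra_simps)
qed

text \<open>Both measures are needed: the volume for membership in \<open>H1\<close>, and
  \<open>\<mu>\<close> for the energy.\<close>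

lemma nn_integral_norm_lincomb_le:
  assumes X: "weak_gradient A g f X" and Y: "weak_gradient A g h Y"
    and N: "N = V \<or> N = \<mu>"
  shows "(\<integral>\<^sup>+p. ennreal (g p (\<lambda>c. a *\<^sub>R X p c + b *\<^sub>R Y p c) (\<lambda>c. a *\<^sub>R X p c + b *\<^sub>R Y p c)) \<partial>N)
    \<le> ennreal (2 * a\<^sup>2) * (\<integral>\<^sup>+p. ennreal (g p (X p) (X p)) \<partial>N)
      + ennreal (2 * b\<^sup>2) * (\<integral>\<^sup>+p. ennreal (g p (Y p) (Y p)) \<partial>N)"
proof -
  note XY = weak_gradient_tangent[OF X] weak_gradient_tangent[OF Y]
  have [measurable]: "(\<lambda>p. ennreal (g p (X p) (X p))) \<in> borel_measurable N"
    "(\<lambda>p. ennreal (g p (Y p) (Y p))) \<in> borel_measurable N"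
    using measurable_norm[OF X] measurable_norm[OF Y] N by auto
  have "(\<integral>\<^sup>+p. ennreal (g p (\<lambda>c. a *\<^sub>R X p c + b *\<^sub>R Y p c) (\<lambda>c. a *\<^sub>R X p c + b *\<^sub>R Y p c)) \<partial>N)
      \<le> (\<integral>\<^sup>+p. ennreal (2 * a\<^sup>2) * ennreal (g p (X p) (X p))
        + ennreal (2 * b\<^sup>2) * ennreal (g p (Y p) (Y p)) \<partial>N)"
  proof (rule nn_integral_mono)
    fix p
    have "ennreal (g p (\<lambda>c. a *\<^sub>R X p c + b *\<^sub>R Y p c) (\<lambda>c. a *\<^sub>R X p c + b *\<^sub>R Y p c))
        \<le> ennreal (2 * a\<^sup>2 * g p (X p) (X p) + 2 * b\<^sup>2 * g p (Y p) (Y p))"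
      by (rule ennreal_leI[OF norm_lincomb_le[OF XY]])
    also have "\<dots> = ennreal (2 * a\<^sup>2) * ennreal (g p (X p) (X p)) + ennreal (2 * b\<^sup>2) * ennreal (g p (Y p) (Y p))"
      using inner_nonneg[OF XY(1)] inner_nonneg[OF XY(2)] by (simp add: ennreal_plus ennreal_mult)
    finally show "ennreal (g p (\<lambda>c. a *\<^sub>R X p c + b *\<^sub>R Y p c) (\<lambda>c. a *\<^sub>R X p c + b *\<^sub>R Y p c))
        \<le> ennreal (2 * a\<^sup>2) * ennreal (g p (X p) (X p)) + ennreal (2 * b\<^sup>2) * ennreal (g p (Y p) (Y p))" .
  qed
  then show ?thesis by (simp add: nn_integral_add nn_integral_cmult)
qed

lemma energy_domain_lincomb:
  assumes f: "f \<in> energy_domain" and h: "h \<in> energy_domain"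
  shows "(\<lambda>p. a * f p + b * h p) \<in> energy_domain"
proof
  show "(\<lambda>p. a * f p + b * h p) \<in> square_integrable \<mu>"
    using f h by (intro square_integrable_lincomb) auto
  obtain X where X: "weak_gradient A g f X" "(\<integral>\<^sup>+p. ennreal (g p (X p) (X p)) \<partial>V) < \<infinity>"
    using f H1_gradient by blast
  obtain Y where Y: "weak_gradient A g h Y" "(\<integral>\<^sup>+p. ennreal (g p (Y p) (Y p)) \<partial>V) < \<infinity>"
    using h H1_gradient by blast
  show "(\<lambda>p. a * f p + b * h p) \<in> H1 A g"
  proof (rule H1I[OF _ weak_gradient_lincomb[OF X(1) Y(1)]])
    show "(\<lambda>p. a * f p + b * h p) \<in> square_integrable V"
      using f h by (intro square_integrable_lincomb) (auto simp: H1_def)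
    show "(\<integral>\<^sup>+p. ennreal (g p (\<lambda>c. a *\<^sub>R X p c + b *\<^sub>R Y p c) (\<lambda>c. a *\<^sub>R X p c + b *\<^sub>R Y p c)) \<partial>V) < \<infinity>"
      by (rule le_less_trans[OF nn_integral_norm_lincomb_le[OF X(1) Y(1)]])
        (use X(2) Y(2) in \<open>auto simp: ennreal_mult_less_top\<close>)
  qed
qed

lemma energy_lincomb_finite:
  assumes f: "energy f < \<infinity>" and h: "energy h < \<infinity>"
  shows "energy (\<lambda>p. a * f p + b * h p) < \<infinity>"
proof -
  note dom = energy_finiteD[OF f] energy_finiteD[OF h]
  obtain X where X: "weak_gradient A g f X" using dom(1) H1_gradient by blast
  obtain Y where Y: "weak_gradient A g h Y" using dom(2) H1_gradient by blast
  have "energy (\<lambda>p. a * f p + b * h p) \<le> ennreal (2 * a\<^sup>2) * energy f + ennreal (2 * b\<^sup>2) * energy h"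
    unfolding energy_eq[OF energy_domain_lincomb[OF dom] weak_gradient_lincomb[OF X Y]]
      energy_eq[OF dom(1) X] energy_eq[OF dom(2) Y]
    by (rule nn_integral_norm_lincomb_le[OF X Y]) simp
  also have "\<dots> < \<infinity>" using f h by (auto simp: ennreal_mult_less_top)
  finally show ?thesis .
qed

text \<open>Functions in the domain may still have infinite energy, since \<open>w\<close> may be
  unbounded. With sums on both sides the identity holds in \<open>ennreal\<close> all the same,
  where a subtraction would lose information.\<close>

lemma energy_segment:
  assumes f: "f \<in> energy_domain" and h: "h \<in> energy_domain" and t: "0 \<le> t" "t \<le> 1"
  shows "energy (\<lambda>p. (1 - t) * f p + t * h p) + ennreal (t * (1 - t)) * energy (\<lambda>p. f p - h p)
    = ennreal (1 - t) * energy f + ennreal t * energy h"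
proof -
  obtain X where X: "weak_gradient A g f X" using f H1_gradient by blast
  obtain Y where Y: "weak_gradient A g h Y" using h H1_gradient by blast
  note XY = weak_gradient_tangent[OF X] weak_gradient_tangent[OF Y]
  let ?Z = "\<lambda>a b p c. a *\<^sub>R X p c + b *\<^sub>R Y p c"
  let ?n = "\<lambda>X p. ennreal (g p (X p) (X p))"
  note Z = weak_gradient_lincomb[OF X Y]
  have e: "energy (\<lambda>p. a * f p + b * h p) = (\<integral>\<^sup>+p. ?n (?Z a b) p \<partial>\<mu>)" for a b
    by (rule energy_eq[OF energy_domain_lincomb[OF f h] Z])
  have e_diff: "energy (\<lambda>p. f p - h p) = (\<integral>\<^sup>+p. ?n (?Z 1 (- 1)) p \<partial>\<mu>)"
  proof -
    have "(\<lambda>p. f p - h p) = (\<lambda>p. 1 * f p + (- 1) * h p)" by simp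
    then show ?thesis using e[of 1 "- 1"] by (simp only:)
  qed
  have m: "?n X \<in> borel_measurable \<mu>" "?n Y \<in> borel_measurable \<mu>"
    unfolding measurable_mu by (rule measurable_norm[OF X], rule measurable_norm[OF Y])
  have mc: "(\<lambda>p. ennreal r * ?n X p) \<in> borel_measurable \<mu>" "(\<lambda>p. ennreal r * ?n Y p) \<in> borel_measurable \<mu>" for r
    by (rule borel_measurable_times_ennreal[OF borel_measurable_const m(1)],
        rule borel_measurable_times_ennreal[OF borel_measurable_const m(2)])
  have mZ: "?n (?Z a b) \<in> borel_measurable \<mu>" for a b
    unfolding measurable_mu by (rule measurable_norm[OF Z])
  have mcZ: "(\<lambda>p. ennreal r * ?n (?Z a b) p) \<in> borel_measurable \<mu>" for r a b
    using mZ by (rule borel_measurable_times_ennreal[OF borel_measurable_const])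
  \<comment> \<open>The mixed terms \<open>2 * (1 - t) * t\<close> and
    \<open>- 2 * t * (1 - t)\<close> cancel, and the coefficients of the squares are
    \<open>(1 - t)\<^sup>2 + t * (1 - t) = 1 - t\<close> and
    \<open>t\<^sup>2 + t * (1 - t) = t\<close>.\<close>
  have pw: "?n (?Z (1 - t) t) p + ennreal (t * (1 - t)) * ?n (?Z 1 (- 1)) p
      = ennreal (1 - t) * ?n X p + ennreal t * ?n Y p" for p
  proof -
    have nn: "0 \<le> g p (?Z a b p) (?Z a b p)" for a b
      by (rule inner_nonneg[OF weak_gradient_tangent[OF Z]])
    have "g p (?Z (1 - t) t p) (?Z (1 - t) t p) + t * (1 - t) * g p (?Z 1 (- 1) p) (?Z 1 (- 1) p)
        = (1 - t) * g p (X p) (X p) + t * g p (Y p) (Y p)"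
      unfolding norm_lincomb[OF XY] by (simp add: power2_eq_square algebra_simps)
    then have "ennreal (g p (?Z (1 - t) t p) (?Z (1 - t) t p) + t * (1 - t) * g p (?Z 1 (- 1) p) (?Z 1 (- 1) p))
        = ennreal ((1 - t) * g p (X p) (X p) + t * g p (Y p) (Y p))"
      by (rule arg_cong)
    then show ?thesis
      using t nn inner_nonneg[OF XY(1), of p] inner_nonneg[OF XY(2), of p]
      by (simp only: ennreal_plus ennreal_mult mult_nonneg_nonneg diff_ge_0_iff_ge)
  qed
  have 1: "(\<integral>\<^sup>+p. ?n (?Z (1 - t) t) p \<partial>\<mu>) + ennreal (t * (1 - t)) * (\<integral>\<^sup>+p. ?n (?Z 1 (- 1)) p \<partial>\<mu>)
      = (\<integral>\<^sup>+p. ?n (?Z (1 - t) t) p + ennreal (t * (1 - t)) * ?n (?Z 1 (- 1)) p \<partial>\<mu>)"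
    unfolding nn_integral_add[OF mZ mcZ] nn_integral_cmult[OF mZ] ..
  have 2: "(\<integral>\<^sup>+p. ennreal (1 - t) * ?n X p + ennreal t * ?n Y p \<partial>\<mu>)
      = ennreal (1 - t) * (\<integral>\<^sup>+p. ?n X p \<partial>\<mu>) + ennreal t * (\<integral>\<^sup>+p. ?n Y p \<partial>\<mu>)"
    unfolding nn_integral_add[OF mc] nn_integral_cmult[OF m(1)] nn_integral_cmult[OF m(2)] ..
  have 3: "(\<integral>\<^sup>+p. ?n (?Z (1 - t) t) p + ennreal (t * (1 - t)) * ?n (?Z 1 (- 1)) p \<partial>\<mu>)
      = (\<integral>\<^sup>+p. ennreal (1 - t) * ?n X p + ennreal t * ?n Y p \<partial>\<mu>)"
    by (rule nn_integral_cong) (rule pw)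
  have eX: "energy f = (\<integral>\<^sup>+p. ?n X p \<partial>\<mu>)"
    by (rule energy_eq[OF f X])
  have eY: "energy h = (\<integral>\<^sup>+p. ?n Y p \<partial>\<mu>)"
    by (rule energy_eq[OF h Y])
  have eZ: "energy (\<lambda>p. (1 - t) * f p + t * h p) = (\<integral>\<^sup>+p. ?n (?Z (1 - t) t) p \<partial>\<mu>)"
    by (rule e)
  show ?thesis
    unfolding eX eY eZ e_diff by (rule trans[OF 1 trans[OF 3 2]])
qed

text \<open>
  Constants have infinite energy when the volume of the manifold is infinite, so the base point
  of the segments in the converse direction is a bump function rather than the constant 1.
\<close>

lemma exists_mean_one_finite_energy:
  obtains u where "u \<in> square_integrable \<mu>" "energy u < \<infinity>" "(\<integral>p. u p \<partial>\<mu>) = 1"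
proof -
  obtain u X B K where u: "u \<in> borel_measurable borel" "\<And>p. 0 \<le> u p" "\<And>p. u p \<le> 1"
    and X: "weak_gradient A g u X" and B: "0 \<le> B" "\<And>p. g p (X p) (X p) \<le> B"
    and K: "K \<in> sets borel" "emeasure V K < \<infinity>" "\<And>p. p \<notin> K \<Longrightarrow> u p = 0" "\<And>p. p \<notin> K \<Longrightarrow> X p = (\<lambda>c. 0)"
    and nz: "\<not> (AE p in V. u p = 0)"
    using finite_energy_function by blast
  have u1: "(u p)\<^sup>2 \<le> 1" for p using u(2,3)[of p] by (simp add: power_le_one)
  have "integrable \<mu> (\<lambda>p. (u p)\<^sup>2)"
    by (rule integrable_const_bound[where B = 1]) (use u u1 in auto)
  then have s: "u \<in> square_integrable \<mu>" using u(1) by (intro square_integrableI) simp_all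
  have "integrable V (indicator K :: 'm \<Rightarrow> real)"
    using K(1,2) by (simp add: integrable_indicator_iff)
  then have "integrable V (\<lambda>p. (u p)\<^sup>2)"
  proof (rule Bochner_Integration.integrable_bound)
    show "AE p in V. norm ((u p)\<^sup>2) \<le> norm (indicator K p :: real)"
      using u1 K(3) by (intro AE_I2) (simp add: indicator_def)
  qed (use u(1) in simp)
  then have sV: "u \<in> square_integrable V" using u(1) by (intro square_integrableI) simp_all
  have "(\<integral>\<^sup>+p. ennreal (g p (X p) (X p)) \<partial>V) \<le> (\<integral>\<^sup>+p. ennreal B * indicator K p \<partial>V)"
  proof (rule nn_integral_mono)
    fix p
    show "ennreal (g p (X p) (X p)) \<le> ennreal B * indicator K p"
      using B(2)[of p] K(4)[of p] inner_zero[OF tangent_space_zero, of p]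
      by (cases "p \<in> K") (simp_all add: ennreal_leI)
  qed
  also have "\<dots> = ennreal B * emeasure V K"
    using K(1) by (simp add: nn_integral_cmult_indicator)
  also have "\<dots> < \<infinity>" using K(2) by (auto simp: ennreal_mult_less_top)
  finally have "u \<in> H1 A g" by (rule H1I[OF sV X])
  then have dom: "u \<in> energy_domain" using s by simp
  \<comment> \<open>For \<open>\<mu>\<close> the total mass 1 takes the place of the finite volume
    of \<open>K\<close>.\<close>
  have "energy u \<le> (\<integral>\<^sup>+p. ennreal B \<partial>\<mu>)"
    unfolding energy_eq[OF dom X] by (intro nn_integral_mono ennreal_leI B)
  also have "\<dots> < \<infinity>" using emeasure_space_1 by simp
  finally have E: "energy u < \<infinity>" .
  define m where "m = (\<integral>p. u p \<partial>\<mu>)"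
  have m: "m \<noteq> 0"
  proof
    assume "m = 0"
    then have "AE p in \<mu>. u p = 0"
      unfolding m_def using integral_nonneg_eq_0_iff_AE[OF square_integrable_integrable[OF s]] u(2) by simp
    then show False using nz by (simp add: AE_mu_iff)
  qed
  \<comment> \<open>The summand \<open>0 * u p\<close> only gives the multiple of \<open>u\<close>
    the form of a linear combination of two functions.\<close>
  let ?v = "\<lambda>p. inverse m * u p + 0 * u p"
  have "?v \<in> square_integrable \<mu>" by (rule square_integrable_lincomb[OF s s])
  moreover have "energy ?v < \<infinity>" by (rule energy_lincomb_finite[OF E E])
  moreover have "(\<integral>p. ?v p \<partial>\<mu>) = 1" using m by (simp add: m_def)
  ultimately show thesis by (rule that)
qed

end

section \<open>Geodesic convexity and the Poincare inequality\<close>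

text \<open>An endpoint of infinite energy makes the convexity inequality trivial strictly between
  the endpoints. At \<open>t = 0\<close> or \<open>t = 1\<close> this would fail, as
  \<open>0 * \<infinity> = 0\<close>.\<close>

lemma ereal_convex_combination_infinite:
  fixes a b :: ennreal
  assumes "0 < t" "t < 1" "a = \<infinity> \<or> b = \<infinity>"
  shows "ereal (1 - t) * enn2ereal a + ereal t * enn2ereal b - ereal r = \<infinity>"
  using assms by (cases a rule: ennreal_cases; cases b rule: ennreal_cases) auto

context weighted_riemannian
begin

lemma L2_mean_oneD:
  assumes "F \<in> L2_mean_one \<mu>"
  shows "F \<in> L2 \<mu>" "rep F \<in> square_integrable \<mu>" "(\<integral>p. rep F p \<partial>\<mu>) = 1"
  using assms rep_in_L2(1) unfolding L2_mean_one_def by blast+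

lemma borel_square_integrable: "f \<in> square_integrable \<mu> \<Longrightarrow> f \<in> borel_measurable borel"
  using square_integrableD(1)[of f \<mu>] by simp

lemma L2_class_mean_one:
  assumes f: "f \<in> square_integrable \<mu>" and mean: "(\<integral>p. f p \<partial>\<mu>) = 1"
  shows "L2_class \<mu> f \<in> L2_mean_one \<mu>"
proof -
  have "(\<integral>p. rep (L2_class \<mu> f) p \<partial>\<mu>) = (\<integral>p. f p \<partial>\<mu>)"
    by (rule integral_cong_AE[OF _ _ rep_L2_class(2)[OF f]])
      (use square_integrableD(1)[OF f] square_integrableD(1)[OF rep_L2_class(1)[OF f]] in simp_all)
  then show ?thesis
    using mean L2_class_in_L2[OF f] by (simp add: L2_mean_one_def)
qed

lemma energy_rep_L2_class:
  assumes "f \<in> square_integrable \<mu>"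
  shows "energy (rep (L2_class \<mu> f)) = energy f"
  by (rule energy_cong_AE[OF borel_square_integrable[OF rep_L2_class(1)[OF assms]]
        borel_square_integrable[OF assms] rep_L2_class(2)[OF assms]])

section \<open>Segments between classes of mean one\<close>

definition segment_class :: "('m \<Rightarrow> real) set \<Rightarrow> ('m \<Rightarrow> real) set \<Rightarrow> real \<Rightarrow> ('m \<Rightarrow> real) set"
  where "segment_class F H t = L2_class \<mu> (\<lambda>p. (1 - t) * rep F p + t * rep H p)"

lemma segment_square_integrable:
  assumes "F \<in> L2_mean_one \<mu>" "H \<in> L2_mean_one \<mu>"
  shows "(\<lambda>p. (1 - t) * rep F p + t * rep H p) \<in> square_integrable \<mu>"
  by (rule square_integrable_lincomb[OF L2_mean_oneD(2)[OF assms(1)] L2_mean_oneD(2)[OF assms(2)]])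

lemma segment_class_ends:
  assumes "F \<in> L2_mean_one \<mu>" "H \<in> L2_mean_one \<mu>"
  shows "segment_class F H 0 = F" "segment_class F H 1 = H"
  using rep_in_L2(2)[OF L2_mean_oneD(1)[OF assms(1)]] rep_in_L2(2)[OF L2_mean_oneD(1)[OF assms(2)]]
  by (simp_all add: segment_class_def)

lemma segment_class_mean_one:
  assumes F: "F \<in> L2_mean_one \<mu>" and H: "H \<in> L2_mean_one \<mu>"
  shows "segment_class F H t \<in> L2_mean_one \<mu>"
  unfolding segment_class_def
proof (rule L2_class_mean_one[OF segment_square_integrable[OF F H]])
  show "(\<integral>p. (1 - t) * rep F p + t * rep H p \<partial>\<mu>) = 1"
    using square_integrable_integrable[OF L2_mean_oneD(2)[OF F]] L2_mean_oneD(3)[OF F]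
      square_integrable_integrable[OF L2_mean_oneD(2)[OF H]] L2_mean_oneD(3)[OF H]
    by (simp add: Bochner_Integration.integral_add)
qed

lemma segment_class_dist:
  assumes F: "F \<in> L2_mean_one \<mu>" and H: "H \<in> L2_mean_one \<mu>"
  shows "L2_dist \<mu> (segment_class F H s) (segment_class F H t) = \<bar>s - t\<bar> * L2_dist \<mu> F H"
proof -
  let ?l = "\<lambda>t p. (1 - t) * rep F p + t * rep H p"
  note l = segment_square_integrable[OF F H]
  have "(\<integral>p. (rep (segment_class F H s) p - rep (segment_class F H t) p)\<^sup>2 \<partial>\<mu>)
      = (\<integral>p. (?l s p - ?l t p)\<^sup>2 \<partial>\<mu>)"
    unfolding segment_class_def
    by (rule L2_dist_cong[OF L2_class_in_L2[OF l] L2_class_in_L2[OF l] square_integrableD(1)[OF l]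
          square_integrableD(1)[OF l] rep_L2_class(2)[OF l] rep_L2_class(2)[OF l]])
  also have "\<dots> = (\<integral>p. (s - t)\<^sup>2 * (rep F p - rep H p)\<^sup>2 \<partial>\<mu>)"
    by (intro Bochner_Integration.integral_cong) (simp_all add: power2_eq_square algebra_simps)
  also have "\<dots> = (s - t)\<^sup>2 * (\<integral>p. (rep F p - rep H p)\<^sup>2 \<partial>\<mu>)" by simp
  finally show ?thesis
    by (simp add: L2_dist_def real_sqrt_mult)
qed

lemma segment_class_geodesic:
  assumes F: "F \<in> L2_mean_one \<mu>" and H: "H \<in> L2_mean_one \<mu>"
  shows "constant_speed_geodesic (L2_mean_one \<mu>) (L2_dist \<mu>) (segment_class F H)"
  unfolding constant_speed_geodesic_def
  using segment_class_mean_one[OF F H] by (auto simp: segment_class_dist[OF F H] segment_class_ends[OF F H])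

theorem poincare_imp_convex:
  assumes lam: "0 < lam" and P: "poincare_inequality A g \<mu> lam"
  shows "geodesically_convex (L2_mean_one \<mu>) (L2_dist \<mu>) (2 * lam) (dirichlet_functional A g \<mu>)"
  unfolding geodesically_convex_def
proof (intro ballI)
  fix F H assume F: "F \<in> L2_mean_one \<mu>" and H: "H \<in> L2_mean_one \<mu>"
  let ?E = "dirichlet_functional A g \<mu>"
  let ?f = "rep F" and ?h = "rep H"
  have E: "?E (segment_class F H t) = enn2ereal (energy (\<lambda>p. (1 - t) * ?f p + t * ?h p))" for t
    unfolding dirichlet_functional_def segment_class_def
    by (simp only: energy_rep_L2_class[OF segment_square_integrable[OF F H]])
  have ineq: "?E (segment_class F H t) \<le> ereal (1 - t) * ?E F + ereal t * ?E H
      - ereal (2 * lam * (t * (1 - t) / 2) * (L2_dist \<mu> F H)\<^sup>2)" if t: "t \<in> {0..1}" for t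
  proof -
    \<comment> \<open>Only the last case has content. The endpoints are separated because there a
      weight 0 may meet an infinite energy.\<close>
    consider "t = 0" | "t = 1" | "0 < t" "t < 1" "energy ?f = \<infinity> \<or> energy ?h = \<infinity>"
      | "0 < t" "t < 1" "energy ?f < \<infinity>" "energy ?h < \<infinity>"
      using t less_top by fastforce
    then show ?thesis
    proof cases
      case 1
      then show ?thesis by (simp add: segment_class_ends[OF F H] zero_ereal_def[symmetric] one_ereal_def[symmetric])
    next
      case 2
      then show ?thesis by (simp add: segment_class_ends[OF F H] zero_ereal_def[symmetric] one_ereal_def[symmetric])
    next
      case 3
      then show ?thesis
        using ereal_convex_combination_infinite[OF 3] by (simp add: dirichlet_functional_def)
    next
      case 4
      note dom = energy_finiteD[OF 4(3)] energy_finiteD[OF 4(4)]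
      let ?d = "\<lambda>p. ?f p - ?h p" and ?l = "\<lambda>p. (1 - t) * ?f p + t * ?h p"
      have fin: "energy ?l < \<infinity>" "energy ?d < \<infinity>"
        using energy_lincomb_finite[OF 4(3,4), of "1 - t" t] energy_lincomb_finite[OF 4(3,4), of 1 "- 1"]
        by simp_all
      obtain ef where ef: "0 \<le> ef" "energy ?f = ennreal ef" using 4(3) by (cases "energy ?f" rule: ennreal_cases) auto
      obtain eh where eh: "0 \<le> eh" "energy ?h = ennreal eh" using 4(4) by (cases "energy ?h" rule: ennreal_cases) auto
      obtain el where el: "0 \<le> el" "energy ?l = ennreal el" using fin(1) by (cases "energy ?l" rule: ennreal_cases) auto
      obtain ed where ed: "0 \<le> ed" "energy ?d = ennreal ed" using fin(2) by (cases "energy ?d" rule: ennreal_cases) auto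
      have tn: "0 \<le> 1 - t" "0 \<le> t" "0 \<le> t * (1 - t)" using 4 by auto
      \<comment> \<open>With all four energies finite the identity becomes one of real numbers,
        which can be solved for \<open>el\<close>.\<close>
      have "ennreal (el + t * (1 - t) * ed) = ennreal ((1 - t) * ef + t * eh)"
        using energy_segment[OF dom tn(2)] 4(2) tn ef eh el ed
        by (simp add: ennreal_plus ennreal_mult)
      then have seg: "el + t * (1 - t) * ed = (1 - t) * ef + t * eh"
        using tn ef(1) eh(1) el(1) ed(1) by (subst (asm) ennreal_inj) auto
      have d: "?d \<in> square_integrable \<mu>"
        using square_integrable_lincomb[OF L2_mean_oneD(2)[OF F] L2_mean_oneD(2)[OF H], of 1 "- 1"] by simp
      have "(\<integral>p. ?d p \<partial>\<mu>) = 0"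
        using square_integrable_integrable[OF L2_mean_oneD(2)[OF F]] L2_mean_oneD(3)[OF F]
          square_integrable_integrable[OF L2_mean_oneD(2)[OF H]] L2_mean_oneD(3)[OF H] by simp
      then have "ennreal (\<integral>p. (?d p)\<^sup>2 \<partial>\<mu>) \<le> ennreal (1 / lam) * energy ?d"
        using P d unfolding poincare_inequality_def by blast
      also have "\<dots> = ennreal (1 / lam * ed)"
        unfolding ed(2) using lam ed(1) by (simp add: ennreal_mult[symmetric])
      finally have "(L2_dist \<mu> F H)\<^sup>2 \<le> 1 / lam * ed"
        using lam ed(1) by (simp add: L2_dist_sq)
      then have "lam * (L2_dist \<mu> F H)\<^sup>2 \<le> ed"
        using lam by (simp add: field_simps)
      then have "t * (1 - t) * (lam * (L2_dist \<mu> F H)\<^sup>2) \<le> t * (1 - t) * ed"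
        using tn(3) by (rule mult_left_mono)
      \<comment> \<open>The factor 2 in the convexity constant only compensates the 1/2 in the
        definition of geodesic convexity.\<close>
      moreover have "2 * lam * (t * (1 - t) / 2) * (L2_dist \<mu> F H)\<^sup>2 = t * (1 - t) * (lam * (L2_dist \<mu> F H)\<^sup>2)"
        by simp
      ultimately have "el \<le> (1 - t) * ef + t * eh - 2 * lam * (t * (1 - t) / 2) * (L2_dist \<mu> F H)\<^sup>2"
        using seg by linarith
      then show ?thesis
        unfolding E using ef eh el by (simp add: dirichlet_functional_def enn2ereal_ennreal)
    qed
  qed
  show "\<exists>\<gamma>. constant_speed_geodesic (L2_mean_one \<mu>) (L2_dist \<mu>) \<gamma> \<and> \<gamma> 0 = F \<and> \<gamma> 1 = H \<and>
      (\<forall>t\<in>{0..1}. ?E (\<gamma> t) \<le> ereal (1 - t) * ?E F + ereal t * ?E H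
        - ereal (2 * lam * (t * (1 - t) / 2) * (L2_dist \<mu> F H)\<^sup>2))"
    using segment_class_geodesic[OF F H] segment_class_ends[OF F H] ineq by blast
qed

theorem convex_imp_poincare:
  assumes lam: "0 < lam"
    and convex: "geodesically_convex (L2_mean_one \<mu>) (L2_dist \<mu>) (2 * lam) (dirichlet_functional A g \<mu>)"
  shows "poincare_inequality A g \<mu> lam"
  unfolding poincare_inequality_def
proof (intro ballI impI)
  fix k assume k: "k \<in> square_integrable \<mu>" and k0: "(\<integral>p. k p \<partial>\<mu>) = 0"
  show "ennreal (\<integral>p. (k p)\<^sup>2 \<partial>\<mu>) \<le> ennreal (1 / lam) * energy k"
  proof (cases "energy k < \<infinity>")
    case False
    then have "energy k = \<top>" by (simp add: less_top[symmetric])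
    then show ?thesis using lam by (simp add: ennreal_mult_top)
  next
    case True
    obtain u where u: "u \<in> square_integrable \<mu>" "energy u < \<infinity>" "(\<integral>p. u p \<partial>\<mu>) = 1"
      by (rule exists_mean_one_finite_energy)
    \<comment> \<open>\<open>u + k\<close> and \<open>u\<close> have mean one and finite energy.
      Their difference is \<open>k\<close>, so their squared distance is the left-hand side of the
      Poincare inequality for \<open>k\<close>.\<close>
    let ?v = "\<lambda>p. u p + k p"
    have v: "?v \<in> square_integrable \<mu>" "energy ?v < \<infinity>"
      using square_integrable_lincomb[OF u(1) k, of 1 1] energy_lincomb_finite[OF u(2) True, of 1 1]
      by simp_all
    have v1: "(\<integral>p. ?v p \<partial>\<mu>) = 1"
      using square_integrable_integrable[OF u(1)] square_integrable_integrable[OF k] u(3) k0 by simp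
    define F where "F = L2_class \<mu> ?v"
    define H where "H = L2_class \<mu> u"
    have F: "F \<in> L2_mean_one \<mu>" unfolding F_def by (rule L2_class_mean_one[OF v(1) v1])
    have H: "H \<in> L2_mean_one \<mu>" unfolding H_def by (rule L2_class_mean_one[OF u(1,3)])
    let ?f = "rep F" and ?h = "rep H"
    have eF: "energy ?f < \<infinity>" unfolding F_def energy_rep_L2_class[OF v(1)] by (rule v(2))
    have eH: "energy ?h < \<infinity>" unfolding H_def energy_rep_L2_class[OF u(1)] by (rule u(2))
    obtain \<gamma> where \<gamma>: "constant_speed_geodesic (L2_mean_one \<mu>) (L2_dist \<mu>) \<gamma>" "\<gamma> 0 = F" "\<gamma> 1 = H"
      and conv: "\<And>t. t \<in> {0..1} \<Longrightarrow> dirichlet_functional A g \<mu> (\<gamma> t)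
        \<le> ereal (1 - t) * dirichlet_functional A g \<mu> F + ereal t * dirichlet_functional A g \<mu> H
          - ereal (2 * lam * (t * (1 - t) / 2) * (L2_dist \<mu> F H)\<^sup>2)"
      using bspec[OF bspec[OF convex[unfolded geodesically_convex_def] F] H] by blast
    have G: "\<gamma> (1/2) \<in> L2_mean_one \<mu>"
      using \<gamma>(1) unfolding constant_speed_geodesic_def by auto
    have dist: "L2_dist \<mu> (\<gamma> s) (\<gamma> t) = \<bar>s - t\<bar> * L2_dist \<mu> F H" if "s \<in> {0..1}" "t \<in> {0..1}" for s t
      using \<gamma> that unfolding constant_speed_geodesic_def by simp
    \<comment> \<open>The weight stays \<open>1 - 1/2\<close> so that \<open>?l\<close> has the form
      of \<open>energy_segment\<close> at \<open>t = 1/2\<close>.\<close>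
    let ?m = "rep (\<gamma> (1/2))" and ?l = "\<lambda>p. (1 - 1/2) * ?f p + 1/2 * ?h p"
    have "AE p in \<mu>. ?m p = 1/2 * ?f p + 1/2 * ?h p"
    proof (rule L2_midpoint[OF L2_mean_oneD(1)[OF F] L2_mean_oneD(1)[OF G] L2_mean_oneD(1)[OF H]])
      show "L2_dist \<mu> F (\<gamma> (1/2)) = L2_dist \<mu> F H / 2"
        using dist[of 0 "1/2"] \<gamma>(2) by simp
      show "L2_dist \<mu> (\<gamma> (1/2)) H = L2_dist \<mu> F H / 2"
        using dist[of "1/2" 1] \<gamma>(3) by simp
    qed
    then have m: "AE p in \<mu>. ?m p = ?l p" by simp
    have em: "energy ?m = energy ?l"
      by (rule energy_cong_AE[OF borel_square_integrable[OF L2_mean_oneD(2)[OF G]]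
            borel_square_integrable[OF segment_square_integrable[OF F H]] m])
    let ?d = "\<lambda>p. ?f p - ?h p"
    have fin: "energy ?l < \<infinity>" "energy ?d < \<infinity>"
      using energy_lincomb_finite[OF eF eH, of "1 - 1/2" "1/2"] energy_lincomb_finite[OF eF eH, of 1 "- 1"]
      by simp_all
    obtain ef where ef: "0 \<le> ef" "energy ?f = ennreal ef" using eF by (cases "energy ?f" rule: ennreal_cases) auto
    obtain eh where eh: "0 \<le> eh" "energy ?h = ennreal eh" using eH by (cases "energy ?h" rule: ennreal_cases) auto
    obtain el where el: "0 \<le> el" "energy ?l = ennreal el" using fin(1) by (cases "energy ?l" rule: ennreal_cases) auto
    obtain ed where ed: "0 \<le> ed" "energy ?d = ennreal ed" using fin(2) by (cases "energy ?d" rule: ennreal_cases) auto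
    have "ennreal (el + (1/2) * (1 - 1/2) * ed) = ennreal ((1 - 1/2) * ef + 1/2 * eh)"
      using energy_segment[OF energy_finiteD[OF eF] energy_finiteD[OF eH], of "1/2"] ef eh el ed
      by (simp only: ennreal_plus ennreal_mult mult_nonneg_nonneg)
    then have seg: "el + (1/2) * (1 - 1/2) * ed = (1 - 1/2) * ef + 1/2 * eh"
      using ef(1) eh(1) el(1) ed(1) by (subst (asm) ennreal_inj) auto
    \<comment> \<open>\<open>lam / 4\<close> is \<open>2 * lam * (t * (1 - t) / 2)\<close> at
      \<open>t = 1/2\<close>. The energy \<open>ed\<close> of the difference has the same factor 1/4
      in \<open>seg\<close>, so the comparison returns \<open>lam\<close> without loss.\<close>
    have "ereal el \<le> ereal ((1 - 1/2) * ef + 1/2 * eh - lam / 4 * (L2_dist \<mu> F H)\<^sup>2)"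
      using conv[of "1/2"] ef eh el em
      by (simp add: dirichlet_functional_def enn2ereal_ennreal)
    then have main: "lam * (L2_dist \<mu> F H)\<^sup>2 \<le> ed" using seg by simp
    have AE_f: "AE p in \<mu>. ?f p = ?v p" and AE_h: "AE p in \<mu>. ?h p = u p"
      unfolding F_def H_def by (rule rep_L2_class(2)[OF v(1)], rule rep_L2_class(2)[OF u(1)])
    have "(L2_dist \<mu> F H)\<^sup>2 = (\<integral>p. (?v p - u p)\<^sup>2 \<partial>\<mu>)"
      unfolding L2_dist_sq
      by (rule L2_dist_cong[OF L2_mean_oneD(1)[OF F] L2_mean_oneD(1)[OF H] square_integrableD(1)[OF v(1)]
            square_integrableD(1)[OF u(1)] AE_f AE_h])
    then have nk: "(L2_dist \<mu> F H)\<^sup>2 = (\<integral>p. (k p)\<^sup>2 \<partial>\<mu>)" by simp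
    have "energy ?d = energy k"
    proof (rule energy_cong_AE)
      show "?d \<in> borel_measurable borel"
        using borel_square_integrable L2_mean_oneD(2)[OF F] L2_mean_oneD(2)[OF H] by simp
      show "k \<in> borel_measurable borel" by (rule borel_square_integrable[OF k])
      show "AE p in \<mu>. ?d p = k p" using AE_f AE_h by eventually_elim simp
    qed
    then have ek: "energy k = ennreal ed" using ed(2) by simp
    have "(\<integral>p. (k p)\<^sup>2 \<partial>\<mu>) \<le> 1 / lam * ed"
      using main lam unfolding nk by (simp add: field_simps)
    then have "ennreal (\<integral>p. (k p)\<^sup>2 \<partial>\<mu>) \<le> ennreal (1 / lam * ed)" by (rule ennreal_leI)
    also have "\<dots> = ennreal (1 / lam) * energy k"
      unfolding ek using lam ed(1) by (simp add: ennreal_mult[symmetric])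
    finally show ?thesis .
  qed
qed

end

theorem proposition3p4:
  fixes A :: "('m::{t2_space, second_countable_topology}, 'n::finite) chart set"
    and g :: "('m, 'n) metric_tensor"
    and lam C :: real
    and \<phi> \<Psi> :: "'m \<Rightarrow> real"
    and \<mu> :: "'m measure"
  assumes "smooth_atlas A"
    and "riemannian_metric A g"
    and "connected (UNIV :: 'm set)"
    and "Metric_space.mcomplete UNIV (riemannian_dist A g)"
    and "0 < lam"
    and "(\<lambda>p. \<phi> p + \<Psi> p) \<in> borel_measurable borel"
    and "0 < C"
    and "\<mu> = density (riemannian_volume A g) (\<lambda>p. ennreal (C * exp (- \<phi> p - \<Psi> p)))"
    and "prob_space \<mu>"
  shows "poincare_inequality A g \<mu> lam \<longleftrightarrow>
    geodesically_convex (L2_mean_one \<mu>) (L2_dist \<mu>) (2 * lam) (dirichlet_functional A g \<mu>)"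
proof -
  interpret weighted_riemannian A g "\<lambda>p. C * exp (- \<phi> p - \<Psi> p)" \<mu>
  proof (intro weighted_riemannian.intro riemannian.intro weighted_riemannian_axioms.intro)
    \<comment> \<open>Measurability is assumed for the sum of \<open>\<phi>\<close> and
      \<open>\<Psi>\<close>, so the exponent is first written as minus that sum.\<close>
    have "(\<lambda>p. C * exp (- (\<phi> p + \<Psi> p))) \<in> borel_measurable borel"
      using assms(6) by measurable
    then show "(\<lambda>p. C * exp (- \<phi> p - \<Psi> p)) \<in> borel_measurable borel" by simp
    show "prob_space \<mu>" by (rule assms(9))
  qed (use assms in simp_all)
  show ?thesis
    using poincare_imp_convex[OF assms(5)] convex_imp_poincare[OF assms(5)] by blast
qed

end
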